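(* Let $(\widetilde{\mathbf{x}},\rho,\widetilde{B})$ be a generalized seed of geometric type. If the generalized cluster algebra $\mathcal{A}(\widetilde{\mathbf{x}},\rho,\widetilde{B})$ is acyclic, then it coincides with its generalized upper cluster algebra: $$\mathcal{A}(\widetilde{\mathbf{x}},\rho,\widetilde{B})=\widetilde{\mathcal{U}}(\widetilde{\mathbf{x}},\rho,\widetilde{B}).$$
   Context: Notation: $[i,j]=\{i,i+1,\ldots,j\}$; $[a]_+=a$ if $a\ge 0$ and $[a]_+=0$ otherwise. Let $m\ge n\ge 1$ be integers and let $\mathbf{ex}=[1,n]$. Generalized seed (of geometric type): a triple $(\widetilde{\mathbf{x}},\rho,\widetilde{B})$ with the following data. (1) The extended cluster $\widetilde{\mathbf{x}}=\{x_1,\ldots,x_m\}$ is a set of $m$ algebraically independent elements freely generating the field $\mathbb{Q}(x_1,\ldots,x_m)$; $\mathbf{x}=\{x_1,\ldots,x_n\}$ is the cluster, its elements are the cluster variables, and $x_{n+1},\ldots,x_m$ are the frozen variables. $\mathbb{P}$ is the multiplicative free abelian group generated by the frozen variables, and $\mathbb{ZP}$ is its integer group ring (the Laurent polynomial ring over $\mathbb{Z}$ in the frozen variables). (2) $\widetilde{B}=(b_{ij})$ is an $m\times n$ integer matrix whose principal part $B$ (rows $1,\ldots,n$) is skew-symmetrizable, i.e. $DB$ is skew-symmetric for some diagonal matrix $D$ with positive integer diagonal entries. For each $s\in[1,n]$ there is a given positive integer $d_s$ dividing $b_{is}$ for all $i\in[1,m]$, and $\beta_{is}:=b_{is}/d_s$.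 (3) $\rho=\{\rho_i\mid i\in[1,n]\}$, where the $i$th string $\rho_i=\{\rho_{i,0},\ldots,\rho_{i,d_i}\}$ satisfies $\rho_{i,0}=\rho_{i,d_i}=1$ and, for $1\le j\le d_i-1$, $\rho_{i,j}$ is a monomial in $\mathbb{Z}[x_{n+1},\ldots,x_m]$ (an integer coefficient is allowed). Mutation: for $i\in[1,n]$, $\mu_i(\widetilde{\mathbf{x}},\rho,\widetilde{B})=(\widetilde{\mathbf{x}}',\rho',\widetilde{B}')$ is the generalized seed with $\widetilde{\mathbf{x}}'=(\widetilde{\mathbf{x}}-\{x_i\})\cup\{x'_i\}$, where $x'_i=x_i^{-1}\sum_{r=0}^{d_i}\rho_{i,r}\prod_{j=1}^m x_j^{r[\beta_{ji}]_+ +(d_i-r)[-\beta_{ji}]_+}$; $\rho'=\{\rho'_i\}\cup\{\rho_j\mid j\ne i\}$ where $\rho'_{i,r}=\rho_{i,d_i-r}$ for $0\le r\le d_i$; and $\widetilde{B}'=(b'_{kl})$ with $b'_{kl}=-b_{kl}$ if $k=i$ or $l=i$, and $b'_{kl}=b_{kl}+[b_{il}]_+b_{ki}+b_{il}[-b_{ki}]_+$ otherwise. The integers $d_s$ and the frozen variables are unchanged. Two generalized seeds are mutation-equivalent (written $\sim$) if one is obtained from the other by a finite sequence of mutations. Generalized cluster algebra: $\mathcal{A}(\widetilde{\mathbf{x}},\rho,\widetilde{B})$ is the $\mathbb{ZP}$-subalgebra of $\mathbb{Q}(x_1,\ldots,x_m)$ generated by all cluster variables from all generalized seeds mutation-equivalent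 to $(\widetilde{\mathbf{x}},\rho,\widetilde{B})$. Acyclic: a generalized seed is acyclic if the directed graph with vertex set $[1,n]$ and a directed edge $(i,j)$ if and only if $b_{ij}>0$ contains no oriented cycle. A generalized cluster algebra is acyclic if it has an acyclic generalized seed, i.e. some generalized seed mutation-equivalent to $(\widetilde{\mathbf{x}},\rho,\widetilde{B})$ is acyclic. Generalized upper cluster algebra: $\widetilde{\mathcal{U}}(\widetilde{\mathbf{x}},\rho,\widetilde{B}):=\bigcap_{(\widetilde{\mathbf{y}},\varepsilon,\widetilde{A})\sim(\widetilde{\mathbf{x}},\rho,\widetilde{B})}\mathbb{ZP}[y_1^{\pm1},\ldots,y_n^{\pm1}]$, where $y_1,\ldots,y_n$ are the cluster variables of the generalized seed $(\widetilde{\mathbf{y}},\varepsilon,\widetilde{A})$.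
   Formalization: It is additionally assumed that every exchange polynomial of the initial seed is nonzero; otherwise (a zero column of B̃ with string sum 0, e.g. ρ_i = (1,−2,1)) x_i' = 0 and the mutated triple is not a generalized seed. *)

theory Defs
  imports Complex_Main "HOL-Library.Poly_Mapping"
begin

text \<open>
  The ambient type is an arbitrary field of characteristic 0; the field
  $\mathbb{Q}(x_1,\ldots,x_m)$ is a subfield \<open>K\<close> of it, freely generated by every extended cluster.
\<close>

definition is_subring :: "'a::field set \<Rightarrow> bool" where
  "is_subring R \<longleftrightarrow> 0 \<in> R \<and> 1 \<in> R \<and>
     (\<forall>a\<in>R. \<forall>b\<in>R. a + b \<in> R \<and> a * b \<in> R) \<and> (\<forall>a\<in>R. - a \<in> R)"

definition is_subfield :: "'a::field set \<Rightarrow> bool" where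
  "is_subfield F \<longleftrightarrow> is_subring F \<and> (\<forall>a\<in>F. inverse a \<in> F)"

text \<open>
  Polynomials over the rationals in variables indexed by \<open>nat\<close> are finitely supported maps from
  exponent vectors to coefficients.
\<close>

type_synonym qpoly = "(nat \<Rightarrow>\<^sub>0 nat) \<Rightarrow>\<^sub>0 rat"

definition poly_vars :: "qpoly \<Rightarrow> nat set" where
  "poly_vars p = (\<Union>e\<in>Poly_Mapping.keys p. Poly_Mapping.keys e)"

definition poly_eval :: "(nat \<Rightarrow> 'a::field_char_0) \<Rightarrow> qpoly \<Rightarrow> 'a" where
  "poly_eval x p = (\<Sum>e\<in>Poly_Mapping.keys p. of_rat (Poly_Mapping.lookup p e) *
     (\<Prod>j\<in>Poly_Mapping.keys e. x j ^ Poly_Mapping.lookup e j))"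

definition alg_independent :: "nat \<Rightarrow> (nat \<Rightarrow> 'a::field_char_0) \<Rightarrow> bool" where
  "alg_independent m x \<longleftrightarrow> (\<forall>p. poly_vars p \<subseteq> {1..m} \<longrightarrow> poly_eval x p = 0 \<longrightarrow> p = 0)"

definition freely_generates :: "nat \<Rightarrow> (nat \<Rightarrow> 'a::field_char_0) \<Rightarrow> 'a set \<Rightarrow> bool" where
  "freely_generates m x K \<longleftrightarrow> alg_independent m x \<and> is_subfield hull (x ` {1..m}) = K"

text \<open>\<open>laurent_ring R Y\<close> is the ring $R[y^{\pm1} : y \in Y]$ inside the ambient field.\<close>

definition laurent_ring :: "'a::field set \<Rightarrow> 'a set \<Rightarrow> 'a set" where
  "laurent_ring R Y = is_subring hull (R \<union> Y \<union> inverse ` Y)"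

text \<open>
  Indices are the mathematical ones, starting at 1: \<open>xvar S j\<close> is $x_j$ for \<open>j \<in> {1..m}\<close>,
  \<open>rho S i r\<close> is $\rho_{i,r}$ for \<open>i \<in> {1..n}\<close> and \<open>r \<le> d i\<close>, and \<open>bmat S i j\<close> is $b_{ij}$ for
  \<open>i \<in> {1..m}\<close> and \<open>j \<in> {1..n}\<close>.  Values at other indices play no role.  The numbers \<open>d i\<close> do not
  change under mutation and are a parameter rather than a component of the seed.
\<close>

record 'a seed =
  xvar :: "nat \<Rightarrow> 'a"
  rho  :: "nat \<Rightarrow> nat \<Rightarrow> 'a"
  bmat :: "nat \<Rightarrow> nat \<Rightarrow> int"

definition skew_symmetrizable :: "nat \<Rightarrow> (nat \<Rightarrow> nat \<Rightarrow> int) \<Rightarrow> bool" where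
  "skew_symmetrizable n b \<longleftrightarrow> (\<exists>D :: nat \<Rightarrow> int. (\<forall>i\<in>{1..n}. D i > 0) \<and>
     (\<forall>i\<in>{1..n}. \<forall>j\<in>{1..n}. D i * b i j = - (D j * b j i)))"

definition is_frozen_monomial :: "nat \<Rightarrow> nat \<Rightarrow> (nat \<Rightarrow> 'a::field_char_0) \<Rightarrow> 'a \<Rightarrow> bool" where
  "is_frozen_monomial m n x a \<longleftrightarrow>
     (\<exists>(c::int) (e :: nat \<Rightarrow> nat). a = of_int c * (\<Prod>k\<in>{n+1..m}. x k ^ e k))"

definition generalized_seed ::
    "'a::field_char_0 set \<Rightarrow> nat \<Rightarrow> nat \<Rightarrow> (nat \<Rightarrow> nat) \<Rightarrow> 'a seed \<Rightarrow> bool" where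
  "generalized_seed K m n d S \<longleftrightarrow>
     freely_generates m (xvar S) K \<and>
     skew_symmetrizable n (bmat S) \<and>
     (\<forall>s\<in>{1..n}. d s > 0 \<and> (\<forall>i\<in>{1..m}. int (d s) dvd bmat S i s)) \<and>
     (\<forall>i\<in>{1..n}. rho S i 0 = 1 \<and> rho S i (d i) = 1 \<and>
        (\<forall>j\<in>{1..d i - 1}. is_frozen_monomial m n (xvar S) (rho S i j)))"

definition pos_part :: "int \<Rightarrow> int" where
  "pos_part a = (if a \<ge> 0 then a else 0)"

definition beta :: "(nat \<Rightarrow> nat) \<Rightarrow> 'a seed \<Rightarrow> nat \<Rightarrow> nat \<Rightarrow> int" where
  "beta d S j i = bmat S j i div int (d i)"

definition exchange_poly :: "nat \<Rightarrow> (nat \<Rightarrow> nat) \<Rightarrow> nat \<Rightarrow> 'a::field_char_0 seed \<Rightarrow> 'a" where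
  "exchange_poly m d i S = (\<Sum>r\<in>{0..d i}. rho S i r *
     (\<Prod>j\<in>{1..m}. xvar S j ^
        (r * nat (pos_part (beta d S j i)) + (d i - r) * nat (pos_part (- beta d S j i)))))"

definition mutate :: "nat \<Rightarrow> (nat \<Rightarrow> nat) \<Rightarrow> nat \<Rightarrow> 'a::field_char_0 seed \<Rightarrow> 'a seed" where
  "mutate m d i S =
     \<lparr> xvar = (xvar S)(i := inverse (xvar S i) * exchange_poly m d i S),
       rho = (rho S)(i := (\<lambda>r. if r \<le> d i then rho S i (d i - r) else rho S i r)),
       bmat = (\<lambda>k l. if k = i \<or> l = i then - bmat S k l
                else bmat S k l + pos_part (bmat S i l) * bmat S k i
                     + bmat S i l * pos_part (- bmat S k i)) \<rparr>"

text \<open>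
  Mutation in a fixed direction is an involution on nondegenerate seeds, so the seeds reachable
  from \<open>S\<close> are exactly those mutation-equivalent to it.
\<close>

definition mutation_equivalent ::
    "nat \<Rightarrow> nat \<Rightarrow> (nat \<Rightarrow> nat) \<Rightarrow> 'a::field_char_0 seed \<Rightarrow> 'a seed \<Rightarrow> bool" where
  "mutation_equivalent m n d = (\<lambda>S T. \<exists>i\<in>{1..n}. T = mutate m d i S)\<^sup>*\<^sup>*"

text \<open>
  It is understood that each mutation of a generalized seed is again a generalized seed.
  This fails in exactly one case: when column $i$ of the exchange matrix vanishes, the exchange
  polynomial is the constant $\sum_r \rho_{i,r}$, which can be zero because the coefficients of the
  $\rho_{i,r}$ are arbitrary integers (for instance $1, -2, 1$).  Then $x'_i = 0$ and there is no
  mutated seed.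
\<close>

definition nondegenerate :: "nat \<Rightarrow> nat \<Rightarrow> (nat \<Rightarrow> nat) \<Rightarrow> 'a::field_char_0 seed \<Rightarrow> bool" where
  "nondegenerate m n d S \<longleftrightarrow> (\<forall>i\<in>{1..n}. exchange_poly m d i S \<noteq> 0)"

definition ZP :: "nat \<Rightarrow> nat \<Rightarrow> 'a::field_char_0 seed \<Rightarrow> 'a set" where
  "ZP m n S = laurent_ring \<int> (xvar S ` {n+1..m})"

definition cluster :: "nat \<Rightarrow> 'a seed \<Rightarrow> 'a set" where
  "cluster n S = xvar S ` {1..n}"

definition gen_cluster_algebra ::
    "nat \<Rightarrow> nat \<Rightarrow> (nat \<Rightarrow> nat) \<Rightarrow> 'a::field_char_0 seed \<Rightarrow> 'a set" where
  "gen_cluster_algebra m n d S =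
     is_subring hull (ZP m n S \<union> (\<Union>T\<in>{T. mutation_equivalent m n d S T}. cluster n T))"

definition gen_upper_cluster_algebra ::
    "nat \<Rightarrow> nat \<Rightarrow> (nat \<Rightarrow> nat) \<Rightarrow> 'a::field_char_0 seed \<Rightarrow> 'a set" where
  "gen_upper_cluster_algebra m n d S =
     (\<Inter>T\<in>{T. mutation_equivalent m n d S T}. laurent_ring (ZP m n S) (cluster n T))"

definition acyclic_seed :: "nat \<Rightarrow> 'a seed \<Rightarrow> bool" where
  "acyclic_seed n S \<longleftrightarrow> acyclic {(i, j). i \<in> {1..n} \<and> j \<in> {1..n} \<and> bmat S i j > 0}"

definition acyclic_cluster_algebra ::
    "nat \<Rightarrow> nat \<Rightarrow> (nat \<Rightarrow> nat) \<Rightarrow> 'a::field_char_0 seed \<Rightarrow> bool" where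
  "acyclic_cluster_algebra m n d S \<longleftrightarrow>
     (\<exists>T. mutation_equivalent m n d S T \<and> acyclic_seed n T)"

end

theory Submission imports Defs "HOL-Computational_Algebra.Fraction_Field" begin

text \<open>
  Write \<open>L(T)\<close> for the Laurent polynomial ring of a seed \<open>T\<close> over the integers, in all of its \<open>m\<close>
  variables. As frozen variables are invertible in the ground ring, the upper algebra is the
  intersection of the rings \<open>L(T)\<close>. Mutation is an involution, so both algebras may be computed
  from any seed of the mutation class, in particular from an acyclic one.

  The inclusion of the cluster algebra in the upper algebra is the Laurent phenomenon: every cluster
  variable lies in every \<open>L(T)\<close>. It is proved by induction on the length of a path
  \<open>T, \<mu>\<^sub>i T, \<mu>\<^sub>j \<mu>\<^sub>i T, \<dots>\<close> leading to the given variable \<open>X\<close>. The induction hypothesis puts \<open>X\<close> into the Laurent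
  rings of \<open>\<mu>\<^sub>i T\<close>, \<open>\<mu>\<^sub>j \<mu>\<^sub>i T\<close> and \<open>\<mu>\<^sub>i \<mu>\<^sub>j \<mu>\<^sub>i T\<close>. If \<open>b\<^sub>i\<^sub>j \<noteq> 0\<close>, the rank two computation of Berenstein, Fomin
  and Zelevinsky (\<open>rank_two_laurent\<close>) shows that the intersection of these three rings is contained in
  \<open>L(T)\<close>. If \<open>b\<^sub>i\<^sub>j = 0\<close>, the two mutations commute, so that \<open>X\<close> becomes an element of \<open>L(T)\<close> after
  multiplication with a power of the exchange polynomial \<open>P\<^sub>i\<close>, and also with a power of \<open>P\<^sub>j\<close>;
  this suffices if \<open>P\<^sub>i\<close> and \<open>P\<^sub>j\<close> are coprime.

  Coprimality may fail, but it can be forced: over a purely transcendental field, adjoin one new frozen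
  variable for each mutable direction, with an identity-like block of new rows in the exchange matrix.
  Then the columns are linearly independent on the rows that do not belong to variables of the
  coefficient strings, and they remain so under mutation (\<open>full_rank_mutate\<close>). Hence some
  integer weighting of the variables makes \<open>P\<^sub>i\<close> homogeneous while the lowest component of \<open>P\<^sub>j\<close> is a single
  monomial, and such polynomials are coprime (\<open>graded_coprime\<close>). Setting the new variables to 1
  carries the Laurent expansions back to the given seed (\<open>laurent_phenomenon\<close>).

  The reverse inclusion uses acyclicity, by induction on the set \<open>I\<close> of directions in which mutation is
  allowed (\<open>upper_subset_calg\<close>); the idea is Muller's. Suppose that some edge joins two vertices of \<open>I\<close>,
  and let \<open>i\<close> be a source with an edge to \<open>j\<close>. The exchange relation of \<open>i\<close> reads
  \<open>x\<^sub>i x\<^sub>i' = unit + x\<^sub>j q\<close>, so \<open>x\<^sub>i\<close> and \<open>x\<^sub>j\<close> generate the unit ideal. Freezing \<open>i\<close> or \<open>j\<close>, the induction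
  hypothesis puts an element \<open>f\<close> of the upper algebra into the cluster algebra after multiplication with
  a power of \<open>x\<^sub>i\<close>, and likewise with a power of \<open>x\<^sub>j\<close>; hence \<open>f\<close> itself lies there. If there is no edge
  within \<open>I\<close>, all the exchanges are independent of each other, and comparing the expansions of \<open>f\<close> in
  the seeds obtained by exchanging a subset of \<open>I\<close> gives an explicit expression of \<open>f\<close> by cluster variables.
\<close>

section \<open>Subrings of a field\<close>

lemma is_subring_hull: "is_subring (is_subring hull A)"
  by (rule hull_in) (auto simp: is_subring_def)

lemma subring_0: "is_subring R \<Longrightarrow> 0 \<in> R"
  and subring_1: "is_subring R \<Longrightarrow> 1 \<in> R"
  and subring_add: "is_subring R \<Longrightarrow> a \<in> R \<Longrightarrow> b \<in> R \<Longrightarrow> a + b \<in> R"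
  and subring_mult: "is_subring R \<Longrightarrow> a \<in> R \<Longrightarrow> b \<in> R \<Longrightarrow> a * b \<in> R"
  and subring_uminus: "is_subring R \<Longrightarrow> a \<in> R \<Longrightarrow> - a \<in> R"
  by (auto simp: is_subring_def)

lemma subring_diff: "is_subring R \<Longrightarrow> a \<in> R \<Longrightarrow> b \<in> R \<Longrightarrow> a - b \<in> R"
  using subring_add[of R a "- b"] subring_uminus[of R b] by simp

lemma subring_power: "is_subring R \<Longrightarrow> a \<in> R \<Longrightarrow> a ^ k \<in> R"
  by (induction k) (auto simp: subring_1 subring_mult)

lemma subring_sum: "is_subring R \<Longrightarrow> (\<And>a. a \<in> A \<Longrightarrow> f a \<in> R) \<Longrightarrow> sum f A \<in> R"
  by (induction A rule: infinite_finite_induct) (auto simp: subring_0 subring_add)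

lemma subring_prod: "is_subring R \<Longrightarrow> (\<And>a. a \<in> A \<Longrightarrow> f a \<in> R) \<Longrightarrow> prod f A \<in> R"
  by (induction A rule: infinite_finite_induct) (auto simp: subring_1 subring_mult)

lemma subring_of_nat: "is_subring R \<Longrightarrow> of_nat k \<in> R"
  by (induction k) (auto simp: subring_0 subring_1 subring_add)

lemma subring_of_int: "is_subring R \<Longrightarrow> of_int k \<in> R"
  by (cases k rule: int_cases2) (auto simp: subring_of_nat subring_uminus)

lemma subring_powi: "is_subring R \<Longrightarrow> a \<in> R \<Longrightarrow> inverse a \<in> R \<Longrightarrow> a powi k \<in> R"
  by (auto simp: power_int_def subring_power simp flip: power_inverse)

section \<open>Laurent monomials and their integer spans\<close>

definition mon :: "nat \<Rightarrow> (nat \<Rightarrow> 'a::field_char_0) \<Rightarrow> (nat \<Rightarrow> int) \<Rightarrow> 'a" where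
  "mon m x e = (\<Prod>j\<in>{1..m}. x j powi e j)"

text \<open>
  Laurent polynomials are treated inside the field, as integer combinations of monomials with
  exponent vectors in a prescribed set \<open>E\<close>. Conditions on support, sign and degree thus become
  conditions on \<open>E\<close>, and for independent variables the spans of disjoint sets of exponent vectors
  meet only in 0, which takes the place of comparing coefficients.
\<close>

inductive_set mspan :: "nat \<Rightarrow> (nat \<Rightarrow> 'a::field_char_0) \<Rightarrow> (nat \<Rightarrow> int) set \<Rightarrow> 'a set"
  for m x E where
  zero: "0 \<in> mspan m x E"
| step: "f \<in> mspan m x E \<Longrightarrow> e \<in> E \<Longrightarrow> f + of_int c * mon m x e \<in> mspan m x E"

text \<open>
  Requiring the exponents outside \<open>J\<close> to vanish makes the exponent vector of a monomial unique.
\<close>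

definition exps :: "nat set \<Rightarrow> (nat \<Rightarrow> int) set" where
  "exps J = {e. \<forall>j. j \<notin> J \<longrightarrow> e j = 0}"

definition nzero :: "nat \<Rightarrow> (nat \<Rightarrow> 'a::field_char_0) \<Rightarrow> bool" where
  "nzero m x \<longleftrightarrow> (\<forall>j\<in>{1..m}. x j \<noteq> 0)"

lemma mon_nonzero: "nzero m x \<Longrightarrow> mon m x e \<noteq> 0"
  by (auto simp: mon_def nzero_def)

lemma mon_zero: "mon m x (\<lambda>_. 0) = 1"
  by (simp add: mon_def)

lemma mon_add: "nzero m x \<Longrightarrow> mon m x (\<lambda>j. e j + e' j) = mon m x e * mon m x e'"
  by (auto simp: mon_def nzero_def power_int_add simp flip: prod.distrib intro!: prod.cong)

lemma mon_uminus: "mon m x (\<lambda>j. - e j) = inverse (mon m x e)"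
  by (simp add: mon_def power_int_minus prod_inversef[symmetric])

lemma mon_power: "mon m x e ^ k = mon m x (\<lambda>j. int k * e j)"
  by (auto simp: mon_def mult.commute[of "int k"] power_int_mult simp flip: prod_power_distrib intro!: prod.cong)

lemma mon_single: "k \<in> {1..m} \<Longrightarrow> mon m x (\<lambda>j. if j = k then a else 0) = x k powi a"
proof -
  assume k: "k \<in> {1..m}"
  have "mon m x (\<lambda>j. if j = k then a else 0) = (\<Prod>j\<in>{1..m}. if j = k then x j powi a else 1)"
    unfolding mon_def by (rule prod.cong) auto
  also have "\<dots> = x k powi a" using k by (simp add: prod.delta)
  finally show ?thesis .
qed

lemma mon_cong: "(\<And>j. j \<in> {1..m} \<Longrightarrow> e j \<noteq> 0 \<Longrightarrow> x j = y j) \<Longrightarrow> mon m x e = mon m y e"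
  unfolding mon_def by (rule prod.cong) (auto, metis power_int_0_right)

lemma mspan_mon: "e \<in> E \<Longrightarrow> mon m x e \<in> mspan m x E"
  using mspan.step[OF mspan.zero, of e E 1] by simp

lemma mspan_mono: "E \<subseteq> F \<Longrightarrow> mspan m x E \<subseteq> mspan m x F"
proof
  fix f assume "E \<subseteq> F" "f \<in> mspan m x E"
  from this(2) show "f \<in> mspan m x F"
    proof induction
      case (step f e c)
      then show ?case using \<open>E \<subseteq> F\<close> by (intro mspan.step) auto
    qed (rule mspan.zero)
qed

lemma mspan_monoD: "f \<in> mspan m x E \<Longrightarrow> E \<subseteq> F \<Longrightarrow> f \<in> mspan m x F"
  using mspan_mono by blast

lemma mspan_add: "f \<in> mspan m x E \<Longrightarrow> g \<in> mspan m x E \<Longrightarrow> f + g \<in> mspan m x E"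
proof -
  assume f: "f \<in> mspan m x E" and "g \<in> mspan m x E"
  from this(2) show ?thesis
    by induction (auto simp: f mspan.step simp flip: add.assoc)
qed

lemma mspan_uminus: "f \<in> mspan m x E \<Longrightarrow> - f \<in> mspan m x E"
proof (induction rule: mspan.induct)
  case (step f e c)
  then show ?case using mspan.step[of "- f" m x E e "- c"] by simp
qed (simp add: mspan.zero)

lemma mspan_diff: "f \<in> mspan m x E \<Longrightarrow> g \<in> mspan m x E \<Longrightarrow> f - g \<in> mspan m x E"
  using mspan_add[of f m x E "- g"] mspan_uminus[of g m x E] by simp

lemma mspan_sum: "(\<And>a. a \<in> A \<Longrightarrow> f a \<in> mspan m x E) \<Longrightarrow> sum f A \<in> mspan m x E"
  by (induction A rule: infinite_finite_induct) (auto simp: mspan.zero mspan_add)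

lemma mspan_cmult_mon: "e \<in> E \<Longrightarrow> of_int c * mon m x e \<in> mspan m x E"
  using mspan.step[OF mspan.zero, of e E c] by simp

lemma mspan_mult:
  assumes "nzero m x" "f \<in> mspan m x E" "g \<in> mspan m x F"
    and "\<And>e e'. e \<in> E \<Longrightarrow> e' \<in> F \<Longrightarrow> (\<lambda>j. e j + e' j) \<in> G"
  shows "f * g \<in> mspan m x G"
  using assms(2)
proof induction
  case (step f e c)
  have "of_int c * mon m x e * g \<in> mspan m x G"
    using assms(3)
  proof induction
    case (step g e' c')
    have "of_int c * mon m x e * (g + of_int c' * mon m x e') =
       of_int c * mon m x e * g + of_int (c * c') * mon m x (\<lambda>j. e j + e' j)"
      by (simp add: mon_add[OF assms(1)] algebra_simps)
    then show ?case
      using mspan.step[OF step(3) assms(4)[OF \<open>e \<in> E\<close> \<open>e' \<in> F\<close>], of "c * c'"] by simp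
  qed (simp add: mspan.zero)
  then show ?case using step by (simp add: algebra_simps mspan_add)
qed (simp add: mspan.zero)

lemma mspan_subset_subring:
  assumes "is_subring R" "\<And>e. e \<in> E \<Longrightarrow> mon m x e \<in> R"
  shows "mspan m x E \<subseteq> R"
proof
  fix f assume "f \<in> mspan m x E"
  then show "f \<in> R"
  proof induction
    case (step f e c)
    then show ?case
      by (intro subring_add[OF assms(1)] subring_mult[OF assms(1)] subring_of_int[OF assms(1)] assms(2))
  qed (rule subring_0[OF assms(1)])
qed

lemma subring_mspan:
  assumes "nzero m x" "(\<lambda>_. 0) \<in> E" "\<And>e e'. e \<in> E \<Longrightarrow> e' \<in> E \<Longrightarrow> (\<lambda>j. e j + e' j) \<in> E"
  shows "is_subring (mspan m x E)"
  unfolding is_subring_def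
proof (intro conjI ballI)
  show "1 \<in> mspan m x E" using mspan_mon[OF assms(2), of m x] by (simp add: mon_zero)
next
  fix a b assume "a \<in> mspan m x E" "b \<in> mspan m x E"
  then show "a * b \<in> mspan m x E" by (rule mspan_mult[OF assms(1)]) (rule assms(3))
qed (simp_all add: mspan.zero mspan_add mspan_uminus)

lemma subring_mspan_exps: "nzero m x \<Longrightarrow> is_subring (mspan m x (exps J))"
  by (rule subring_mspan) (auto simp: exps_def)

lemma mspan_split:
  assumes "f \<in> mspan m x E"
  obtains f1 f2 where "f = f1 + f2" "f1 \<in> mspan m x {e \<in> E. Q e}" "f2 \<in> mspan m x {e \<in> E. \<not> Q e}"
proof -
  have "\<exists>f1 f2. f = f1 + f2 \<and> f1 \<in> mspan m x {e \<in> E. Q e} \<and> f2 \<in> mspan m x {e \<in> E. \<not> Q e}"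
    using assms
  proof induction
    case zero
    show ?case by (rule exI[of _ 0], rule exI[of _ 0]) (simp add: mspan.zero)
  next
    case (step f e c)
    then obtain f1 f2 where *: "f = f1 + f2" "f1 \<in> mspan m x {e \<in> E. Q e}" "f2 \<in> mspan m x {e \<in> E. \<not> Q e}"
      by blast
    show ?case
    proof (cases "Q e")
      case True
      then show ?thesis
        using * step(2) by (intro exI[of _ "f1 + of_int c * mon m x e"] exI[of _ f2]) (auto intro!: mspan.step)
    next
      case False
      then show ?thesis
        using * step(2) by (intro exI[of _ f1] exI[of _ "f2 + of_int c * mon m x e"]) (auto intro!: mspan.step)
    qed
  qed
  then show thesis using that by blast
qed

text \<open>
  The grading by an arbitrary statistic \<open>w\<close> of the exponent vector: a degree, a weight, or the
  restriction to a set of variables.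
\<close>

lemma mspan_decomp:
  assumes "f \<in> mspan m x E"
  obtains A g where "finite A" "f = (\<Sum>a\<in>A. g a)" "\<And>a. g a \<in> mspan m x {e \<in> E. w e = a}"
proof -
  have "\<exists>A g. finite A \<and> f = (\<Sum>a\<in>A. g a) \<and> (\<forall>a. g a \<in> mspan m x {e \<in> E. w e = a})"
    using assms
  proof induction
    case zero
    show ?case by (rule exI[of _ "{}"], rule exI[of _ "\<lambda>_. 0"]) (simp add: mspan.zero)
  next
    case (step f e c)
    then obtain A g where *: "finite A" "f = (\<Sum>a\<in>A. g a)" "\<forall>a. g a \<in> mspan m x {e \<in> E. w e = a}"
      by blast
    have e: "of_int c * mon m x e \<in> mspan m x {e' \<in> E. w e' = w e}"
      using step(2) by (intro mspan_cmult_mon) simp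
    show ?case
    proof (cases "w e \<in> A")
      case True
      have "(\<Sum>a\<in>A. (g(w e := g (w e) + of_int c * mon m x e)) a) = f + of_int c * mon m x e"
        using sum.remove[OF *(1) True, of g] sum.remove[OF *(1) True, of "g(w e := g (w e) + of_int c * mon m x e)"]
        unfolding *(2) by (simp add: algebra_simps)
      moreover have "(g(w e := g (w e) + of_int c * mon m x e)) a \<in> mspan m x {e \<in> E. w e = a}" for a
        using *(3) e by (auto intro: mspan_add)
      ultimately show ?thesis using *(1) by metis
    next
      case False
      have "(\<Sum>a\<in>insert (w e) A. (g(w e := of_int c * mon m x e)) a) =
          of_int c * mon m x e + (\<Sum>a\<in>A. (g(w e := of_int c * mon m x e)) a)"
        using False *(1) by simp
      also have "(\<Sum>a\<in>A. (g(w e := of_int c * mon m x e)) a) = f"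
        unfolding *(2) using False by (intro sum.cong) auto
      finally have "(\<Sum>a\<in>insert (w e) A. (g(w e := of_int c * mon m x e)) a) = f + of_int c * mon m x e"
        by (simp only: add.commute)
      moreover have "(g(w e := of_int c * mon m x e)) a \<in> mspan m x {e \<in> E. w e = a}" for a
        using *(3) e by auto
      ultimately show ?thesis using *(1) by (metis finite.insertI)
    qed
  qed
  then show thesis using that by blast
qed

lemma mspan_normal:
  assumes "f \<in> mspan m x E"
  obtains B c where "finite B" "B \<subseteq> E" "f = (\<Sum>e\<in>B. of_int (c e) * mon m x e)"
proof -
  have "\<exists>B c. finite B \<and> B \<subseteq> E \<and> f = (\<Sum>e\<in>B. of_int (c e) * mon m x e)"
    using assms
  proof induction
    case zero
    show ?case by (rule exI[of _ "{}"]) simp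
  next
    case (step f e k)
    then obtain B c where *: "finite B" "B \<subseteq> E" "f = (\<Sum>e\<in>B. of_int (c e) * mon m x e)" by blast
    show ?case
    proof (cases "e \<in> B")
      case True
      let ?c = "c(e := c e + k)"
      have "(\<Sum>a\<in>B. of_int (?c a) * mon m x a) = of_int (c e + k) * mon m x e + (\<Sum>a\<in>B - {e}. of_int (?c a) * mon m x a)"
        using sum.remove[OF *(1) True, of "\<lambda>a. of_int (?c a) * mon m x a"] by simp
      also have "(\<Sum>a\<in>B - {e}. of_int (?c a) * mon m x a) = (\<Sum>a\<in>B - {e}. of_int (c a) * mon m x a)"
        by (rule sum.cong) auto
      also have "of_int (c e + k) * mon m x e + \<dots> = (\<Sum>a\<in>B. of_int (c a) * mon m x a) + of_int k * mon m x e"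
        using sum.remove[OF *(1) True, of "\<lambda>a. of_int (c a) * mon m x a"] by (simp add: distrib_right)
      finally have "(\<Sum>a\<in>B. of_int (?c a) * mon m x a) = f + of_int k * mon m x e" unfolding *(3) .
      then show ?thesis using *(1,2) by metis
    next
      case False
      have "(\<Sum>a\<in>insert e B. of_int ((c(e := k)) a) * mon m x a) =
          of_int k * mon m x e + (\<Sum>e'\<in>B. of_int ((c(e := k)) e') * mon m x e')"
        using False *(1) by simp
      also have "(\<Sum>e'\<in>B. of_int ((c(e := k)) e') * mon m x e') = f"
        unfolding *(3) using False by (intro sum.cong) auto
      finally show ?thesis using * step(2)
        by (intro exI[of _ "insert e B"] exI[of _ "c(e := k)"]) (simp add: add.commute)
    qed
  qed
  then show thesis using that by blast
qed

lemma mspan_normal_in: "(\<And>e. e \<in> B \<Longrightarrow> e \<in> E) \<Longrightarrow> (\<Sum>e\<in>B. of_int (c e) * mon m x e) \<in> mspan m x E"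
  by (intro mspan_sum mspan_cmult_mon) auto

text \<open>
  Algebraic independence in the form in which it is used: Laurent monomials with distinct exponent
  vectors are linearly independent. Integer coefficients are enough, since all rings in question
  are integer spans of monomials.
\<close>

definition lind :: "nat \<Rightarrow> (nat \<Rightarrow> 'a::field_char_0) \<Rightarrow> bool" where
  "lind m x \<longleftrightarrow> (\<forall>B c. finite B \<longrightarrow> B \<subseteq> exps {1..m} \<longrightarrow>
     (\<Sum>e\<in>B. of_int (c e) * mon m x e) = 0 \<longrightarrow> (\<forall>e\<in>B. c e = (0::int)))"

lemma lind_nzero:
  assumes "lind m x"
  shows "nzero m x"
proof (rule ccontr)
  assume "\<not> nzero m x"
  then obtain k where k: "k \<in> {1..m}" "x k = 0" by (auto simp: nzero_def)
  let ?e = "\<lambda>j. if j = k then 1 else (0::int)"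
  have "mon m x ?e = 0" using mon_single[OF k(1), of x 1] k(2) by simp
  moreover have "?e \<in> exps {1..m}" using k by (auto simp: exps_def)
  ultimately show False
    using assms[unfolded lind_def, THEN spec, THEN spec, of "{?e}" "\<lambda>_. 1"] by simp
qed

lemma lind_direct:
  assumes "lind m x" "E \<subseteq> exps {1..m}" "F \<subseteq> exps {1..m}" "E \<inter> F = {}"
    and "f \<in> mspan m x E" "g \<in> mspan m x F" "f + g = 0"
  shows "f = 0"
proof -
  obtain B c where B: "finite B" "B \<subseteq> E" "f = (\<Sum>e\<in>B. of_int (c e) * mon m x e)"
    using mspan_normal[OF assms(5)] by blast
  obtain B' c' where B': "finite B'" "B' \<subseteq> F" "g = (\<Sum>e\<in>B'. of_int (c' e) * mon m x e)"
    using mspan_normal[OF assms(6)] by blast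
  define k where "k = (\<lambda>e. if e \<in> B then c e else c' e)"
  have dis: "B \<inter> B' = {}" using B B' assms(4) by auto
  have "(\<Sum>e\<in>B \<union> B'. of_int (k e) * mon m x e) = (\<Sum>e\<in>B. of_int (k e) * mon m x e) + (\<Sum>e\<in>B'. of_int (k e) * mon m x e)"
    using dis B B' by (simp add: sum.union_disjoint)
  also have "\<dots> = f + g"
    unfolding B B' using dis by (intro arg_cong2[of _ _ _ _ "(+)"] sum.cong) (auto simp: k_def)
  finally have "(\<Sum>e\<in>B \<union> B'. of_int (k e) * mon m x e) = 0" using assms(7) by simp
  moreover have "finite (B \<union> B')" "B \<union> B' \<subseteq> exps {1..m}" using B B' assms(2,3) by auto
  ultimately have "\<forall>e\<in>B \<union> B'. k e = 0"
    using assms(1) unfolding lind_def by blast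
  then have "\<forall>e\<in>B. c e = 0" unfolding k_def by (metis UnI1)
  then show ?thesis unfolding B by simp
qed

lemma lind_direct_eq:
  assumes "lind m x" "E \<subseteq> exps {1..m}" "F \<subseteq> exps {1..m}" "E \<inter> F = {}"
    and "f \<in> mspan m x E" "g \<in> mspan m x F" "f' \<in> mspan m x E" "g' \<in> mspan m x F" "f + g = f' + g'"
  shows "f = f'"
proof -
  have "f - f' = 0"
  proof (rule lind_direct[OF assms(1-4)])
    show "f - f' \<in> mspan m x E" by (rule mspan_diff) fact+
    show "g - g' \<in> mspan m x F" by (rule mspan_diff) fact+
    show "f - f' + (g - g') = 0" using assms(9) by (simp add: algebra_simps)
  qed
  then show ?thesis by simp
qed

abbreviation laur :: "nat \<Rightarrow> (nat \<Rightarrow> 'a::field_char_0) \<Rightarrow> 'a set" where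
  "laur m x \<equiv> mspan m x (exps {1..m})"

lemma gen_mspan:
  assumes "j \<in> {1..m}" "(\<lambda>k. if k = j then a else 0) \<in> E"
  shows "x j powi a \<in> mspan m x E"
  using mspan_mon[OF assms(2), of m x] by (simp only: mon_single[OF assms(1)])

lemma laur_gen: "j \<in> {1..m} \<Longrightarrow> x j \<in> laur m x"
  using gen_mspan[of j m 1 "exps {1..m}" x] by (simp add: exps_def)

lemma laur_inverse_gen: "j \<in> {1..m} \<Longrightarrow> inverse (x j) \<in> laur m x"
  using gen_mspan[of j m "-1" "exps {1..m}" x] by (simp add: exps_def power_int_minus)

lemma mspan_gen_subset_subring:
  assumes "is_subring R" "\<And>e j. e \<in> E \<Longrightarrow> j \<in> {1..m} \<Longrightarrow> e j \<noteq> 0 \<Longrightarrow>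
      x j \<in> R \<and> (e j < 0 \<longrightarrow> inverse (x j) \<in> R)"
  shows "mspan m x E \<subseteq> R"
proof (rule mspan_subset_subring[OF assms(1)])
  fix e assume e: "e \<in> E"
  show "mon m x e \<in> R" unfolding mon_def
  proof (rule subring_prod[OF assms(1)])
    fix j assume j: "j \<in> {1..m}"
    show "x j powi e j \<in> R"
    proof (cases "e j < 0")
      case True
      then have "e j \<noteq> 0" by simp
      then show ?thesis using assms(2)[OF e j] True by (intro subring_powi[OF assms(1)]) blast+
    next
      case False
      then have "x j powi e j = x j ^ nat (e j)" by (simp add: power_int_def)
      then show ?thesis using assms(2)[OF e j] subring_1[OF assms(1)] subring_power[OF assms(1)]
        by (cases "e j = 0") auto
    qed
  qed
qed

lemma mspan_exps_subset_subring:
  assumes "is_subring R" "\<And>j. j \<in> J \<inter> {1..m} \<Longrightarrow> x j \<in> R \<and> inverse (x j) \<in> R"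
  shows "mspan m x (exps J) \<subseteq> R"
proof (rule mspan_gen_subset_subring[OF assms(1)])
  fix e j assume "e \<in> exps J" "j \<in> {1..m}" "e j \<noteq> 0"
  then have "j \<in> J \<inter> {1..m}" by (auto simp: exps_def)
  then show "x j \<in> R \<and> (e j < 0 \<longrightarrow> inverse (x j) \<in> R)" using assms(2) by blast
qed

section \<open>Exchange polynomials\<close>

lemma mspan_cong_subset:
  assumes "\<And>e j. e \<in> E \<Longrightarrow> j \<in> {1..m} \<Longrightarrow> e j \<noteq> 0 \<Longrightarrow> x j = y j"
  shows "mspan m x E \<subseteq> mspan m y E"
proof
  fix f assume "f \<in> mspan m x E"
  then show "f \<in> mspan m y E"
  proof induction
    case (step f e c)
    have "mon m x e = mon m y e" by (rule mon_cong) (use assms step in blast)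
    then show ?case using mspan.step[OF step(3,2), of c] by simp
  qed (rule mspan.zero)
qed

lemma mspan_cong:
  assumes "\<And>e j. e \<in> E \<Longrightarrow> j \<in> {1..m} \<Longrightarrow> e j \<noteq> 0 \<Longrightarrow> x j = y j"
  shows "mspan m x E = mspan m y E"
  using mspan_cong_subset[of E m x y] mspan_cong_subset[of E m y x] assms by (metis subset_antisym)

definition pexps :: "nat set \<Rightarrow> (nat \<Rightarrow> int) set" where
  "pexps J = {e \<in> exps J. \<forall>j. 0 \<le> e j}"

text \<open>
  The exchange polynomial is a binary form in two monomials \<open>u\<close> and \<open>v\<close>. A mutation in its own direction
  interchanges \<open>u\<close> and \<open>v\<close> and reverses the coefficients, which does not change the value.
\<close>

definition hpoly :: "(nat \<Rightarrow> 'a::field_char_0) \<Rightarrow> nat \<Rightarrow> 'a \<Rightarrow> 'a \<Rightarrow> 'a" where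
  "hpoly \<rho> d u v = (\<Sum>r\<in>{0..d}. \<rho> r * (u ^ r * v ^ (d - r)))"

lemma hpoly_rev: "hpoly (\<lambda>r. \<rho> (d - r)) d v u = hpoly \<rho> d u v"
  unfolding hpoly_def
  by (rule sum.reindex_bij_witness[of _ "\<lambda>r. d - r" "\<lambda>r. d - r"]) (auto simp: mult.commute)

lemma hpoly_cong: "(\<And>r. r \<le> d \<Longrightarrow> \<rho> r = \<rho>' r) \<Longrightarrow> hpoly \<rho> d u v = hpoly \<rho>' d u v"
  unfolding hpoly_def by (rule sum.cong) auto

definition pos_exp :: "nat \<Rightarrow> (nat \<Rightarrow> nat) \<Rightarrow> 'a seed \<Rightarrow> nat \<Rightarrow> nat \<Rightarrow> int" where
  "pos_exp m d T i = (\<lambda>j. if j \<in> {1..m} then pos_part (beta d T j i) else 0)"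

definition neg_exp :: "nat \<Rightarrow> (nat \<Rightarrow> nat) \<Rightarrow> 'a seed \<Rightarrow> nat \<Rightarrow> nat \<Rightarrow> int" where
  "neg_exp m d T i = (\<lambda>j. if j \<in> {1..m} then pos_part (- beta d T j i) else 0)"

lemma pos_part_nonneg: "0 \<le> pos_part a"
  by (simp add: pos_part_def)

lemma pos_part_diff: "pos_part a - pos_part (- a) = a"
  by (simp add: pos_part_def)

lemma pos_part_0 [simp]: "pos_part 0 = 0"
  by (simp add: pos_part_def)

lemma pos_part_scale: "0 \<le> c \<Longrightarrow> pos_part (c * a) = c * pos_part a"
  by (cases "c = 0") (auto simp: pos_part_def zero_le_mult_iff)

lemma exchange_hpoly:
  "exchange_poly m d i T = hpoly (rho T i) (d i) (mon m (xvar T) (pos_exp m d T i)) (mon m (xvar T) (neg_exp m d T i))"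
proof -
  have *: "mon m (xvar T) (\<lambda>j. if j \<in> {1..m} then pos_part (g j) else 0) = (\<Prod>j\<in>{1..m}. xvar T j ^ nat (pos_part (g j)))" for g
    unfolding mon_def by (rule prod.cong) (auto simp: power_int_def pos_part_nonneg)
  show ?thesis
    unfolding exchange_poly_def hpoly_def pos_exp_def neg_exp_def *
    by (simp add: power_add power_mult prod.distrib mult.commute[of _ "nat _"] prod_power_distrib)
qed

lemma hpoly_term_mon:
  assumes "nzero m x" "r \<le> d"
  shows "mon m x e ^ r * mon m x e' ^ (d - r) = mon m x (\<lambda>j. int r * e j + (int d - int r) * e' j)"
  using assms by (simp add: mon_power mon_add of_nat_diff)

lemma hpoly_in_mspan:
  assumes "nzero m x" "\<And>r. r \<le> d \<Longrightarrow> \<rho> r \<in> mspan m x R"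
    and "\<And>a r. a \<in> R \<Longrightarrow> r \<le> d \<Longrightarrow> (\<lambda>j. a j + (int r * e j + (int d - int r) * e' j)) \<in> E"
  shows "hpoly \<rho> d (mon m x e) (mon m x e') \<in> mspan m x E"
  unfolding hpoly_def
proof (rule mspan_sum)
  fix r assume "r \<in> {0..d}"
  then have r: "r \<le> d" by simp
  show "\<rho> r * (mon m x e ^ r * mon m x e' ^ (d - r)) \<in> mspan m x E"
    unfolding hpoly_term_mon[OF assms(1) r]
    by (rule mspan_mult[OF assms(1) assms(2)[OF r] mspan_mon[of _ "{\<lambda>j. int r * e j + (int d - int r) * e' j}"]])
      (use assms(3) r in auto)
qed

lemma hpoly_extract:
  assumes "\<rho> 0 = 1"
  shows "hpoly \<rho> d u v = v ^ d + (\<Sum>r\<in>{1..d}. \<rho> r * (u ^ r * v ^ (d - r)))"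
  unfolding hpoly_def by (subst sum.atLeast_Suc_atMost) (auto simp: assms)

lemma hpoly_rest_in_mspan:
  assumes "nzero m x" "\<And>r. r \<le> d \<Longrightarrow> \<rho> r \<in> mspan m x R"
    and "\<And>a r. a \<in> R \<Longrightarrow> 1 \<le> r \<Longrightarrow> r \<le> d \<Longrightarrow> (\<lambda>j. a j + (int r * e j + (int d - int r) * e' j)) \<in> E"
  shows "(\<Sum>r\<in>{1..d}. \<rho> r * (mon m x e ^ r * mon m x e' ^ (d - r))) \<in> mspan m x E"
proof (rule mspan_sum)
  fix r assume "r \<in> {1..d}"
  then have r: "1 \<le> r" "r \<le> d" by auto
  show "\<rho> r * (mon m x e ^ r * mon m x e' ^ (d - r)) \<in> mspan m x E"
    unfolding hpoly_term_mon[OF assms(1) r(2)]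
    by (rule mspan_mult[OF assms(1) assms(2)[OF r(2)] mspan_mon[of _ "{\<lambda>j. int r * e j + (int d - int r) * e' j}"]])
      (use assms(3) r in auto)
qed

text \<open>
  The term \<open>v^d\<close> has degree 0 in the variable \<open>k\<close> and all other terms have positive degree, so \<open>v^d\<close>
  cannot be cancelled.
\<close>

lemma hpoly_nonzero:
  assumes "lind m x" "\<And>r. r \<le> d \<Longrightarrow> \<rho> r \<in> mspan m x (pexps {1..m})" "\<rho> 0 = 1"
    and "e \<in> pexps {1..m}" "e' \<in> pexps {1..m}" "e k > 0" "e' k = 0"
  shows "hpoly \<rho> d (mon m x e) (mon m x e') \<noteq> 0"
proof
  assume 0: "hpoly \<rho> d (mon m x e) (mon m x e') = 0"
  note nz = lind_nzero[OF assms(1)]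
  let ?E = "{e \<in> exps {1..m}. e k = 0}" and ?F = "{e \<in> exps {1..m}. e k > 0}"
  have "mon m x e' ^ d = 0"
  proof (rule lind_direct[OF assms(1)])
    show "mon m x e' ^ d + (\<Sum>r\<in>{1..d}. \<rho> r * (mon m x e ^ r * mon m x e' ^ (d - r))) = 0"
      using 0 unfolding hpoly_extract[of \<rho>, OF assms(3)] .
    show "mon m x e' ^ d \<in> mspan m x ?E"
      unfolding mon_power by (rule mspan_mon) (use assms in \<open>auto simp: pexps_def exps_def\<close>)
    show "(\<Sum>r\<in>{1..d}. \<rho> r * (mon m x e ^ r * mon m x e' ^ (d - r))) \<in> mspan m x ?F"
    proof (rule hpoly_rest_in_mspan[OF nz assms(2)])
      fix a r assume "a \<in> pexps {1..m}" "1 \<le> r" "r \<le> d"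
      moreover from this have "0 < int r * e k" using assms(6) by simp
      ultimately show "(\<lambda>j. a j + (int r * e j + (int d - int r) * e' j)) \<in> ?F"
        using assms by (auto simp: pexps_def exps_def add_nonneg_pos)
    qed auto
  qed auto
  then show False using mon_nonzero[OF nz] by simp
qed

text \<open>
  The properties of a seed that survive mutation. The strings may be polynomials in the variables
  indexed by \<open>Q\<close>; this set stays the same when further frozen variables are adjoined. An exchange
  polynomial can only vanish for a zero column of the exchange matrix, and zero columns are never
  changed by mutation, so the last clause keeps all exchange polynomials nonzero.
\<close>

definition gseed :: "nat \<Rightarrow> nat \<Rightarrow> (nat \<Rightarrow> nat) \<Rightarrow> nat set \<Rightarrow> 'a::field_char_0 seed \<Rightarrow> bool" where
  "gseed m n d Q T \<longleftrightarrow> n \<le> m \<and> Q \<subseteq> {n+1..m} \<and> lind m (xvar T) \<and>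
     skew_symmetrizable n (bmat T) \<and>
     (\<forall>s\<in>{1..n}. d s > 0 \<and> (\<forall>i\<in>{1..m}. int (d s) dvd bmat T i s)) \<and>
     (\<forall>i\<in>{1..n}. rho T i 0 = 1 \<and> rho T i (d i) = 1 \<and> (\<forall>r\<le>d i. rho T i r \<in> mspan m (xvar T) (pexps Q))) \<and>
     (\<forall>i\<in>{1..n}. (\<forall>k\<in>{1..m}. bmat T k i = 0) \<longrightarrow> exchange_poly m d i T \<noteq> 0)"

lemma skew_diag: "skew_symmetrizable n b \<Longrightarrow> i \<in> {1..n} \<Longrightarrow> b i i = 0"
proof -
  assume "skew_symmetrizable n b" and i: "i \<in> {1..n}"
  then obtain D :: "nat \<Rightarrow> int" where "D i > 0" "D i * b i i = - (D i * b i i)"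
    unfolding skew_symmetrizable_def by blast
  then show ?thesis by simp
qed

lemma skew_sign: "skew_symmetrizable n b \<Longrightarrow> i \<in> {1..n} \<Longrightarrow> j \<in> {1..n} \<Longrightarrow> b i j > 0 \<longleftrightarrow> b j i < 0"
proof -
  assume "skew_symmetrizable n b" and ij: "i \<in> {1..n}" "j \<in> {1..n}"
  then obtain D where D: "\<forall>i\<in>{1..n}. D i > 0" "\<forall>i\<in>{1..n}. \<forall>j\<in>{1..n}. D i * b i j = - (D j * b j i)"
    unfolding skew_symmetrizable_def by (elim exE conjE)
  have *: "D i * b i j = - (D j * b j i)" "D i > 0" "D j > 0" using D ij by blast+
  have "b i j > 0 \<longleftrightarrow> D i * b i j > 0" using *(2) by (simp add: zero_less_mult_iff)
  also have "\<dots> \<longleftrightarrow> D j * b j i < 0" using *(1) by simp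
  also have "\<dots> \<longleftrightarrow> b j i < 0" using *(3) by (simp add: mult_less_0_iff)
  finally show ?thesis .
qed

lemma skew_zero: "skew_symmetrizable n b \<Longrightarrow> i \<in> {1..n} \<Longrightarrow> j \<in> {1..n} \<Longrightarrow> b i j = 0 \<longleftrightarrow> b j i = 0"
  using skew_sign[of n b i j] skew_sign[of n b j i] by linarith

context
  fixes m n :: nat and d :: "nat \<Rightarrow> nat" and Q :: "nat set" and T :: "'a::field_char_0 seed" and i :: nat
  assumes gs: "gseed m n d Q T" and i: "i \<in> {1..n}"
begin

lemma gseed_basic:
  "n \<le> m" "Q \<subseteq> {n+1..m}" "lind m (xvar T)" "skew_symmetrizable n (bmat T)" "nzero m (xvar T)" "i \<in> {1..m}" "i \<notin> Q"
  "d i > 0" "rho T i 0 = 1" "rho T i (d i) = 1" "bmat T i i = 0" "xvar T i \<noteq> 0"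
  using gs i lind_nzero[of m "xvar T"] unfolding gseed_def by (auto simp: skew_diag nzero_def)

lemma gseed_dvd: "k \<in> {1..m} \<Longrightarrow> int (d i) dvd bmat T k i"
  using gs i unfolding gseed_def by auto

lemma gseed_rho: "r \<le> d i \<Longrightarrow> rho T i r \<in> mspan m (xvar T) (pexps Q)"
  using gs i unfolding gseed_def by auto

lemma gseed_beta: "k \<in> {1..m} \<Longrightarrow> int (d i) * beta d T k i = bmat T k i"
  unfolding beta_def by (simp add: gseed_dvd)

lemma gseed_beta_0_iff: "k \<in> {1..m} \<Longrightarrow> beta d T k i = 0 \<longleftrightarrow> bmat T k i = 0"
  using gseed_beta[of k] gseed_basic(8) by auto

lemma gseed_beta_pos_iff: "k \<in> {1..m} \<Longrightarrow> beta d T k i > 0 \<longleftrightarrow> bmat T k i > 0"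
  using gseed_beta[of k] gseed_basic(8) by (metis mult_pos_pos of_nat_0_less_iff zero_less_mult_pos)

lemma gseed_Q_mspan: "mspan m (xvar T) (pexps Q) \<subseteq> mspan m (xvar T) (pexps {1..m})"
  by (rule mspan_mono) (use gseed_basic in \<open>auto simp: pexps_def exps_def\<close>)

text \<open>
  If some \<open>b\<^sub>k\<^sub>i\<close> is nonzero, exactly one of the two monomials contains \<open>x\<^sub>k\<close>. Reversing the form if
  necessary, it is the first one.
\<close>

lemma exchange_nonzero: "exchange_poly m d i T \<noteq> 0"
proof (cases "\<forall>k\<in>{1..m}. bmat T k i = 0")
  case True
  then show ?thesis using gs i unfolding gseed_def by auto
next
  case False
  then obtain k where k: "k \<in> {1..m}" "beta d T k i \<noteq> 0" using gseed_beta_0_iff by auto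
  have e: "pos_exp m d T i \<in> pexps {1..m}" "neg_exp m d T i \<in> pexps {1..m}"
    by (auto simp: pos_exp_def neg_exp_def pexps_def exps_def pos_part_nonneg)
  have rho: "\<And>r. r \<le> d i \<Longrightarrow> rho T i r \<in> mspan m (xvar T) (pexps {1..m})"
    using gseed_rho gseed_Q_mspan by blast
  show ?thesis
  proof (cases "beta d T k i > 0")
    case True
    show ?thesis unfolding exchange_hpoly
      by (rule hpoly_nonzero[where k = k and \<rho> = "rho T i", OF gseed_basic(3) _ gseed_basic(9) e])
        (use True k rho in \<open>auto simp: pos_exp_def neg_exp_def pos_part_def\<close>)
  next
    case False
    have "hpoly (\<lambda>r. rho T i (d i - r)) (d i) (mon m (xvar T) (neg_exp m d T i)) (mon m (xvar T) (pos_exp m d T i)) \<noteq> 0"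
      by (rule hpoly_nonzero[where k = k, OF gseed_basic(3) _ _ e(2,1)])
        (use False k rho gseed_basic(10) in \<open>auto simp: pos_exp_def neg_exp_def pos_part_def\<close>)
    then show ?thesis unfolding exchange_hpoly hpoly_rev .
  qed
qed

lemma exchange_in:
  "exchange_poly m d i T \<in> mspan m (xvar T) {e \<in> exps {1..m}. \<forall>j. 0 \<le> e j \<and> (e j \<noteq> 0 \<longrightarrow> j \<in> Q \<or> bmat T j i \<noteq> 0)}"
  unfolding exchange_hpoly
proof (rule hpoly_in_mspan[OF gseed_basic(5) gseed_rho])
  fix a :: "nat \<Rightarrow> int" and r assume a: "a \<in> pexps Q" "r \<le> d i"
  have "0 \<le> int r * pos_exp m d T i j + (int (d i) - int r) * neg_exp m d T i j" for j
    using a by (auto simp: pos_exp_def neg_exp_def pos_part_nonneg)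
  moreover have "a j = 0" if "j \<notin> Q" for j using that a by (auto simp: pexps_def exps_def)
  moreover have "pos_exp m d T i j = 0 \<and> neg_exp m d T i j = 0" if "j \<notin> {1..m} \<or> bmat T j i = 0" for j
    using that by (auto simp: pos_exp_def neg_exp_def beta_def)
  moreover have "0 \<le> a j" for j using a by (auto simp: pexps_def)
  moreover have "j \<in> {1..m}" if "j \<in> Q" for j using that gseed_basic(2) by auto
  ultimately have *: "0 \<le> a j + (int r * pos_exp m d T i j + (int (d i) - int r) * neg_exp m d T i j) \<and>
      (a j + (int r * pos_exp m d T i j + (int (d i) - int r) * neg_exp m d T i j) \<noteq> 0 \<longrightarrow> j \<in> {1..m} \<and> (j \<in> Q \<or> bmat T j i \<noteq> 0))" for j
    by (metis add_nonneg_nonneg add_0 mult_zero_right)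
  then show "(\<lambda>j. a j + (int r * pos_exp m d T i j + (int (d i) - int r) * neg_exp m d T i j))
      \<in> {e \<in> exps {1..m}. \<forall>j. 0 \<le> e j \<and> (e j \<noteq> 0 \<longrightarrow> j \<in> Q \<or> bmat T j i \<noteq> 0)}"
    unfolding exps_def by blast
qed

lemma exchange_in_others: "exchange_poly m d i T \<in> mspan m (xvar T) (exps ({1..m} - {i}))"
proof (rule mspan_monoD[OF exchange_in])
  show "{e \<in> exps {1..m}. \<forall>j. 0 \<le> e j \<and> (e j \<noteq> 0 \<longrightarrow> j \<in> Q \<or> bmat T j i \<noteq> 0)} \<subseteq> exps ({1..m} - {i})"
    using gseed_basic(7,11) by (auto simp: exps_def)
qed

end

lemma exchange_cong:
  assumes "\<And>j. j \<in> {1..m} \<Longrightarrow> bmat T' j l = bmat T j l" "\<And>r. r \<le> d l \<Longrightarrow> rho T' l r = rho T l r"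
    and "\<And>j. j \<in> {1..m} \<Longrightarrow> bmat T j l \<noteq> 0 \<Longrightarrow> xvar T' j = xvar T j"
  shows "exchange_poly m d l T' = exchange_poly m d l T"
  unfolding exchange_poly_def
proof (intro sum.cong arg_cong2[of _ _ _ _ "(*)"] prod.cong refl)
  fix r j assume "j \<in> {1..m}"
  then show "xvar T' j ^ (r * nat (pos_part (beta d T' j l)) + (d l - r) * nat (pos_part (- beta d T' j l))) =
      xvar T j ^ (r * nat (pos_part (beta d T j l)) + (d l - r) * nat (pos_part (- beta d T j l)))"
    using assms(1,3)[of j] by (cases "bmat T j l = 0") (auto simp: beta_def)
qed (use assms(2) in auto)

definition flip :: "nat set \<Rightarrow> (nat \<Rightarrow> int) \<Rightarrow> nat \<Rightarrow> int" where
  "flip J e = (\<lambda>j. if j \<in> J then - e j else e j)"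

lemma flip_flip [simp]: "flip J (flip J e) = e"
  by (auto simp: flip_def)

lemma flip_exps: "e \<in> exps V \<Longrightarrow> flip J e \<in> exps V"
  by (auto simp: flip_def exps_def)

lemma mon_exchange:
  assumes "J \<subseteq> {1..m}"
  shows "mon m (\<lambda>k. if k \<in> J then inverse (x k) * P k else x k) e = mon m x (flip J e) * (\<Prod>k\<in>J. P k powi e k)"
proof -
  have "mon m (\<lambda>k. if k \<in> J then inverse (x k) * P k else x k) e =
    (\<Prod>k\<in>{1..m}. x k powi flip J e k * (if k \<in> J then P k powi e k else 1))"
    unfolding mon_def by (rule prod.cong) (auto simp: flip_def power_int_mult_distrib power_int_minus power_int_inverse)
  also have "\<dots> = mon m x (flip J e) * (\<Prod>k\<in>{1..m}. if k \<in> J then P k powi e k else 1)"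
    by (simp add: prod.distrib mon_def)
  also have "(\<Prod>k\<in>{1..m}. if k \<in> J then P k powi e k else 1) = (\<Prod>k\<in>J. P k powi e k)"
    using assms by (simp add: prod.If_cases Int_absorb1)
  finally show ?thesis .
qed

lemma power_mult_powi:
  fixes P :: "'a::field"
  assumes "P \<noteq> 0" "- a \<le> int N"
  shows "P ^ N * P powi a = P ^ nat (int N + a)"
proof -
  have "P ^ N * P powi a = P powi (int N + a)" using assms by (simp add: power_int_add)
  then show ?thesis using assms by (simp add: power_int_def)
qed

text \<open>
  A relation between the new monomials is multiplied with a power of \<open>P\<close> and graded by the degree in
  \<open>x\<^sub>i\<close>. Since \<open>P\<close> does not contain \<open>x\<^sub>i\<close>, each component is a power of \<open>P\<close> times a relation between old
  monomials.
\<close>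

lemma lind_exchange:
  fixes x :: "nat \<Rightarrow> 'a::field_char_0"
  assumes "lind m x" "i \<in> {1..m}" "P \<in> mspan m x (exps ({1..m} - {i}))" "P \<noteq> 0"
  shows "lind m (x(i := inverse (x i) * P))"
  unfolding lind_def
proof (intro allI impI ballI)
  fix B :: "(nat \<Rightarrow> int) set" and c :: "(nat \<Rightarrow> int) \<Rightarrow> int" and e0
  define x' where "x' = x(i := inverse (x i) * P)"
  assume B: "finite B" "B \<subseteq> exps {1..m}" and 0: "(\<Sum>e\<in>B. of_int (c e) * mon m (x(i := inverse (x i) * P)) e) = 0"
    and e0: "e0 \<in> B"
  note nz = lind_nzero[OF assms(1)]
  \<comment> \<open>any power of \<open>P\<close> that clears all negative powers of \<open>P\<close> will do\<close>
  define N where "N = (\<Sum>e\<in>B. nat \<bar>e i\<bar>)"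
  have N: "\<bar>e i\<bar> \<le> int N" if "e \<in> B" for e
  proof -
    have "nat \<bar>e i\<bar> \<le> N" unfolding N_def using that B(1) by (intro member_le_sum) auto
    then show ?thesis by linarith
  qed
  have x': "x' = (\<lambda>k. if k \<in> {i} then inverse (x k) * P else x k)" by (auto simp: x'_def)
  have mon': "P ^ N * mon m x' e = P ^ nat (int N + e i) * mon m x (flip {i} e)" if "e \<in> B" for e
    using mon_exchange[of "{i}" m x "\<lambda>_. P" e] assms(2) power_mult_powi[OF assms(4), of "e i" N] N[OF that]
    unfolding x' by simp
  let ?t = "\<lambda>e. of_int (c e) * (P ^ N * mon m x' e)"
  let ?E = "{e \<in> exps {1..m}. e i = - e0 i}" and ?F = "{e \<in> exps {1..m}. e i \<noteq> - e0 i}"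
  have P': "P ^ k \<in> mspan m x (exps ({1..m} - {i}))" for k
    by (intro subring_power subring_mspan_exps nz assms)
  have term_in: "?t e \<in> mspan m x E" if "e \<in> B" "E = ?E \<and> e i = e0 i \<or> E = ?F \<and> e i \<noteq> e0 i" for e E
  proof -
    have "of_int (c e) * mon m x (flip {i} e) \<in> mspan m x {flip {i} e}" by (rule mspan_cmult_mon) simp
    then have "P ^ nat (int N + e i) * (of_int (c e) * mon m x (flip {i} e)) \<in> mspan m x E"
      using that(2) subsetD[OF B(2) that(1)]
      by (intro mspan_mult[OF nz P', of _ "{flip {i} e}"]) (auto simp: exps_def flip_def)
    then show ?thesis unfolding mon'[OF that(1)] by (simp add: mult.left_commute)
  qed
  define B1 where "B1 = {e \<in> B. e i = e0 i}"
  have fB1: "finite B1" using B by (simp add: B1_def)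
  have "(\<Sum>e\<in>B. ?t e) = P ^ N * (\<Sum>e\<in>B. of_int (c e) * mon m x' e)"
    by (simp add: sum_distrib_left mult.left_commute)
  also have "\<dots> = 0" using 0 unfolding x'_def by simp
  finally have "(\<Sum>e\<in>B1. ?t e) + (\<Sum>e\<in>B - B1. ?t e) = 0"
    using sum.subset_diff[of B1 B ?t] B(1) by (auto simp: B1_def add.commute)
  then have "(\<Sum>e\<in>B1. ?t e) = 0"
    by (rule lind_direct[OF assms(1), of ?E ?F, rotated 5])
      (auto intro!: mspan_sum term_in simp: B1_def)
  also have "(\<Sum>e\<in>B1. ?t e) = P ^ nat (int N + e0 i) * (\<Sum>e\<in>B1. of_int (c e) * mon m x (flip {i} e))"
    unfolding sum_distrib_left by (rule sum.cong) (auto simp: B1_def mon')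
  finally have "(\<Sum>e\<in>B1. of_int (c e) * mon m x (flip {i} e)) = 0" using assms(4) by simp
  also have "(\<Sum>e\<in>B1. of_int (c e) * mon m x (flip {i} e)) = (\<Sum>e\<in>flip {i} ` B1. of_int (c (flip {i} e)) * mon m x e)"
    by (subst sum.reindex) (auto intro: inj_on_inverseI[where g = "flip {i}"])
  finally have "\<forall>e\<in>flip {i} ` B1. c (flip {i} e) = 0"
    using assms(1) fB1 B(2) unfolding lind_def B1_def
    by (auto dest!: spec[of _ "flip {i} ` {e \<in> B. e i = e0 i}"] intro: flip_exps)
  then have "c (flip {i} (flip {i} e0)) = 0" using e0 by (simp add: B1_def)
  then show "c e0 = 0" by simp
qed

section \<open>Mutation and reachable seeds\<close>

lemma mutate_sel:
  "xvar (mutate m d i T) = (xvar T)(i := inverse (xvar T i) * exchange_poly m d i T)"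
  "rho (mutate m d i T) = (rho T)(i := (\<lambda>r. if r \<le> d i then rho T i (d i - r) else rho T i r))"
  "bmat (mutate m d i T) k l = (if k = i \<or> l = i then - bmat T k l
                else bmat T k l + pos_part (bmat T i l) * bmat T k i
                     + bmat T i l * pos_part (- bmat T k i))"
  by (simp_all add: mutate_def)

text \<open>
  In this form the mutation rule is visibly compatible with a skew-symmetrizing diagonal matrix.
\<close>

lemma bmat_mutate_alt:
  "bmat (mutate m d i T) k l = (if k = i \<or> l = i then - bmat T k l
     else bmat T k l + (pos_part (bmat T k i) * pos_part (bmat T i l) - pos_part (- bmat T k i) * pos_part (- bmat T i l)))"
  by (simp add: mutate_sel pos_part_def algebra_simps)

lemma skew_mutate:
  assumes "skew_symmetrizable n (bmat T)" "i \<in> {1..n}"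
  shows "skew_symmetrizable n (bmat (mutate m d i T))"
proof -
  obtain D where D: "\<forall>i\<in>{1..n}. D i > 0" "\<forall>i\<in>{1..n}. \<forall>j\<in>{1..n}. D i * bmat T i j = - (D j * bmat T j i)"
    using assms(1) unfolding skew_symmetrizable_def by (elim exE conjE)
  have "D k * bmat (mutate m d i T) k l = - (D l * bmat (mutate m d i T) l k)" if kl: "k \<in> {1..n}" "l \<in> {1..n}" for k l
  proof (cases "k = i \<or> l = i")
    case True
    moreover have "D k * bmat T k l = - (D l * bmat T l k)" using D(2) kl by blast
    ultimately show ?thesis by (auto simp: mutate_sel)
  next
    case False
    have scale: "D k * pos_part a = pos_part (D k * a)" "D i * pos_part a = pos_part (D i * a)"
        "D l * pos_part a = pos_part (D l * a)" for a
      using D(1) kl assms(2) by (simp_all add: pos_part_scale less_imp_le)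
    have *: "D k * pos_part (bmat T k i) = D i * pos_part (- bmat T i k)"
         "D k * pos_part (- bmat T k i) = D i * pos_part (bmat T i k)"
         "D i * pos_part (bmat T i l) = D l * pos_part (- bmat T l i)"
         "D i * pos_part (- bmat T i l) = D l * pos_part (bmat T l i)"
    proof -
      have D': "D k * bmat T k i = D i * (- bmat T i k)" "D k * (- bmat T k i) = D i * bmat T i k"
         "D i * bmat T i l = D l * (- bmat T l i)" "D i * (- bmat T i l) = D l * bmat T l i"
        using D(2)[rule_format, OF kl(1) assms(2)] D(2)[rule_format, OF assms(2) kl(2)] by simp_all
      show "D k * pos_part (bmat T k i) = D i * pos_part (- bmat T i k)"
         "D k * pos_part (- bmat T k i) = D i * pos_part (bmat T i k)"
         "D i * pos_part (bmat T i l) = D l * pos_part (- bmat T l i)"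
         "D i * pos_part (- bmat T i l) = D l * pos_part (bmat T l i)"
        unfolding scale by (simp_all only: D')
    qed
    have "D k * (pos_part (bmat T k i) * pos_part (bmat T i l) - pos_part (- bmat T k i) * pos_part (- bmat T i l)) =
      pos_part (- bmat T i k) * (D i * pos_part (bmat T i l)) - pos_part (bmat T i k) * (D i * pos_part (- bmat T i l))"
      by (simp only: right_diff_distrib mult.assoc[symmetric] *(1,2)) (simp only: ac_simps)
    also have "\<dots> = - (D l * (pos_part (bmat T l i) * pos_part (bmat T i k) - pos_part (- bmat T l i) * pos_part (- bmat T i k)))"
      unfolding *(3,4) by (simp add: algebra_simps)
    finally show ?thesis using False D(2)[rule_format, OF kl]
      by (simp only: bmat_mutate_alt distrib_left if_False) (simp add: algebra_simps)
  qed
  then show ?thesis using D(1) unfolding skew_symmetrizable_def by blast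
qed

lemma exchange_mutate_self:
  assumes "gseed m n d Q T" "i \<in> {1..n}"
  shows "exchange_poly m d i (mutate m d i T) = exchange_poly m d i T"
proof -
  note g = gseed_basic[OF assms]
  have beta: "beta d (mutate m d i T) k i = - beta d T k i" if "k \<in> {1..m}" for k
    unfolding beta_def using gseed_dvd[OF assms that] by (simp add: mutate_sel dvd_neg_div)
  have *: "pos_exp m d (mutate m d i T) i = neg_exp m d T i" "neg_exp m d (mutate m d i T) i = pos_exp m d T i"
    by (auto simp: pos_exp_def neg_exp_def fun_eq_iff beta)
  have "neg_exp m d T i i = 0" "pos_exp m d T i i = 0" using g by (auto simp: neg_exp_def pos_exp_def beta_def)
  then have mon: "mon m (xvar (mutate m d i T)) (neg_exp m d T i) = mon m (xvar T) (neg_exp m d T i)"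
    "mon m (xvar (mutate m d i T)) (pos_exp m d T i) = mon m (xvar T) (pos_exp m d T i)"
    by (auto simp: mutate_sel intro!: mon_cong)
  have "hpoly (rho (mutate m d i T) i) (d i) v u = hpoly (\<lambda>r. rho T i (d i - r)) (d i) v u" for u v
    by (rule hpoly_cong) (simp add: mutate_sel)
  then show ?thesis unfolding exchange_hpoly * mon by (simp add: hpoly_rev)
qed

lemma mutate_mutate:
  assumes "gseed m n d Q T" "i \<in> {1..n}"
  shows "mutate m d i (mutate m d i T) = T"
proof (rule seed.equality)
  note g = gseed_basic[OF assms]
  show "xvar (mutate m d i (mutate m d i T)) = xvar T"
    using exchange_nonzero[OF assms] g
    by (auto simp: mutate_sel exchange_mutate_self[OF assms] fun_eq_iff)
  show "rho (mutate m d i (mutate m d i T)) = rho T"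
    by (auto simp: mutate_sel fun_eq_iff)
  show "bmat (mutate m d i (mutate m d i T)) = bmat T"
  proof (intro ext)
    fix k l
    show "bmat (mutate m d i (mutate m d i T)) k l = bmat T k l"
      using g(11) by (simp add: mutate_sel(3)[of m d i "mutate m d i T"] mutate_sel(3)[of m d i T] pos_part_def algebra_simps)
  qed
qed simp

text \<open>
  The condition on zero columns is inherited because a zero column of the new matrix has a zero in
  row \<open>i\<close>, hence it was zero before, and its exchange polynomial is the same.
\<close>

lemma gseed_mutate:
  assumes "gseed m n d Q T" "i \<in> {1..n}"
  shows "gseed m n d Q (mutate m d i T)"
  unfolding gseed_def
proof (intro conjI ballI impI allI)
  note g = gseed_basic[OF assms]
  let ?T = "mutate m d i T"
  show "n \<le> m" "Q \<subseteq> {n+1..m}" by fact+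
  show "lind m (xvar ?T)"
    unfolding mutate_sel by (rule lind_exchange[OF g(3,6) exchange_in_others[OF assms] exchange_nonzero[OF assms]])
  show "skew_symmetrizable n (bmat ?T)" by (rule skew_mutate[OF g(4) assms(2)])
  fix l assume l: "l \<in> {1..n}"
  note gl = gseed_basic[OF assms(1) l]
  show "d l > 0" by (rule gl(8))
  show "int (d l) dvd bmat ?T k l" if k: "k \<in> {1..m}" for k
  proof -
    have "int (d l) dvd bmat T k l" "int (d l) dvd bmat T i l"
      using gseed_dvd[OF assms(1) l] k g(6) by auto
    moreover from this(2) have "int (d l) dvd pos_part (bmat T i l)" by (simp add: pos_part_def)
    ultimately show ?thesis by (auto simp: mutate_sel)
  qed
  show "rho ?T l 0 = 1" "rho ?T l (d l) = 1" using gl(9,10) by (auto simp: mutate_sel)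
  have eq: "mspan m (xvar ?T) (pexps Q) = mspan m (xvar T) (pexps Q)"
    by (rule mspan_cong) (use g(7) in \<open>auto simp: mutate_sel pexps_def exps_def\<close>)
  show "rho ?T l r \<in> mspan m (xvar ?T) (pexps Q)" if "r \<le> d l" for r
    unfolding eq using gseed_rho[OF assms(1) l] that by (auto simp: mutate_sel)
  assume zero: "\<forall>k\<in>{1..m}. bmat ?T k l = 0"
  show "exchange_poly m d l ?T \<noteq> 0"
  proof (cases "l = i")
    case True
    then show ?thesis using exchange_mutate_self[OF assms] exchange_nonzero[OF assms] by simp
  next
    case False
    have il: "bmat T i l = 0" using zero[rule_format, OF g(6)] by (simp add: mutate_sel)
    then have "bmat T k l = bmat ?T k l" for k using False by (simp add: mutate_sel)
    then have "exchange_poly m d l ?T = exchange_poly m d l T"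
      using False zero by (intro exchange_cong) (auto simp: mutate_sel)
    then show ?thesis using exchange_nonzero[OF assms(1) l] by simp
  qed
qed

definition reach :: "nat \<Rightarrow> (nat \<Rightarrow> nat) \<Rightarrow> nat set \<Rightarrow> 'a::field_char_0 seed \<Rightarrow> 'a seed \<Rightarrow> bool" where
  "reach m d I = (\<lambda>S T. \<exists>i\<in>I. T = mutate m d i S)\<^sup>*\<^sup>*"

lemma reach_refl: "reach m d I S S" by (simp add: reach_def)

lemma reach_mutate: "reach m d I S T \<Longrightarrow> i \<in> I \<Longrightarrow> reach m d I S (mutate m d i T)"
  unfolding reach_def by (rule rtranclp.rtrancl_into_rtrancl) auto

lemma reach_trans: "reach m d I S T \<Longrightarrow> reach m d I T U \<Longrightarrow> reach m d I S U"
  unfolding reach_def by (rule rtranclp_trans)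

lemma reach_mono: "reach m d I S T \<Longrightarrow> I \<subseteq> J \<Longrightarrow> reach m d J S T"
  unfolding reach_def by (erule rtranclp_mono[THEN predicate2D, rotated]) auto

lemma reach_induct [consumes 1, case_names refl step]:
  assumes "reach m d I S T" "P S"
    "\<And>T i. reach m d I S T \<Longrightarrow> P T \<Longrightarrow> i \<in> I \<Longrightarrow> P (mutate m d i T)"
  shows "P T"
  using assms(1) unfolding reach_def
proof (rule rtranclp_induct)
  fix T U
  assume *: "(\<lambda>S T. \<exists>i\<in>I. T = mutate m d i S)\<^sup>*\<^sup>* S T" "\<exists>i\<in>I. U = mutate m d i T" "P T"
  then obtain i where "i \<in> I" "U = mutate m d i T" by (elim bexE)
  then show "P U" using assms(3)[of T i] * by (simp add: reach_def)
qed (rule assms(2))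

lemma reach_gseed:
  assumes "reach m d I S T" "gseed m n d Q S" "I \<subseteq> {1..n}"
  shows "gseed m n d Q T"
  using assms(1)
proof (induction rule: reach_induct)
  case (step T i)
  then show ?case using gseed_mutate[of m n d Q T i] assms(3) by blast
qed (rule assms(2))

lemma reach_sym:
  assumes "reach m d I S T" "gseed m n d Q S" "I \<subseteq> {1..n}"
  shows "reach m d I T S"
  using assms(1)
proof (induction rule: reach_induct)
  case (step T i)
  have "gseed m n d Q T" by (rule reach_gseed[OF step(1) assms(2,3)])
  then have "mutate m d i (mutate m d i T) = T" using mutate_mutate[of m n d Q T i] step(2) assms(3) by blast
  then have "reach m d I (mutate m d i T) T" using reach_mutate[OF reach_refl step(2), of m d "mutate m d i T"] by simp
  then show ?case using step(3) by (rule reach_trans)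
qed (rule reach_refl)

lemma reach_frozen: "reach m d I S T \<Longrightarrow> k \<notin> I \<Longrightarrow> xvar T k = xvar S k"
  by (induction rule: reach_induct) (auto simp: mutate_sel)

section \<open>Comparing expansions in two seeds\<close>

lemma prod_power_mult_powi:
  fixes P :: "nat \<Rightarrow> 'a::field"
  assumes "\<And>k. k \<in> J \<Longrightarrow> P k \<noteq> 0 \<and> - e k \<le> int N"
  shows "(\<Prod>k\<in>J. P k) ^ N * (\<Prod>k\<in>J. P k powi e k) = (\<Prod>k\<in>J. P k ^ nat (int N + e k))"
  unfolding prod_power_distrib prod.distrib[symmetric]
  by (rule prod.cong[OF refl]) (use assms power_mult_powi in blast)

text \<open>
  Exchange all the variables in \<open>J\<close>, where the polynomials \<open>P\<^sub>k\<close> involve no variable of \<open>I\<close>. A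
  monomial in the new variables is a product of powers of the \<open>P\<^sub>k\<close> with the old monomial whose exponents
  in \<open>J\<close> have the opposite sign. Hence each component of \<open>f\<close> for the grading by the exponents in \<open>I\<close>
  comes from a single component of the new expansion, and its divisibility by the \<open>P\<^sub>k\<close> can be read off.
\<close>

lemma exchange_component:
  fixes x :: "nat \<Rightarrow> 'a::field_char_0"
  assumes "lind m x" "J \<subseteq> I" "I \<subseteq> {1..m}"
    and P: "\<And>k. k \<in> J \<Longrightarrow> P k \<in> mspan m x (exps ({1..m} - I)) \<and> P k \<noteq> 0"
    and f: "f1 + f2 \<in> laur m (\<lambda>k. if k \<in> J then inverse (x k) * P k else x k)"
    and f1: "f1 \<in> mspan m x {e \<in> exps {1..m}. \<forall>k\<in>I. e k = a k}"
    and f2: "f2 \<in> mspan m x {e \<in> exps {1..m}. \<not> (\<forall>k\<in>I. e k = a k)}"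
  obtains g where "g \<in> mspan m x {e \<in> exps {1..m}. \<forall>k\<in>I. e k = a k}" "f1 = (\<Prod>k\<in>J. P k powi - a k) * g"
proof -
  define x' where "x' = (\<lambda>k. if k \<in> J then inverse (x k) * P k else x k)"
  let ?E = "{e \<in> exps {1..m}. \<forall>k\<in>I. e k = a k}" and ?F = "{e \<in> exps {1..m}. \<not> (\<forall>k\<in>I. e k = a k)}"
  let ?R = "mspan m x (exps ({1..m} - I))"
  define \<Pi> where "\<Pi> = (\<Prod>k\<in>J. P k)"
  define A where "A = (\<Prod>k\<in>J. P k powi - a k)"
  note nz = lind_nzero[OF assms(1)]
  note R = subring_mspan_exps[OF nz, of "{1..m} - I"]
  have J: "J \<subseteq> {1..m}" using assms(2,3) by blast
  have fin: "finite J" using J finite_subset by blast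
  have mulE: "r * g \<in> mspan m x ?E" if "r \<in> ?R" "g \<in> mspan m x ?E" for r g
    by (rule mspan_mult[OF nz that]) (use assms(3) in \<open>auto simp: exps_def subset_eq\<close>)
  have mulF: "r * g \<in> mspan m x ?F" if "r \<in> ?R" "g \<in> mspan m x ?F" for r g
    by (rule mspan_mult[OF nz that]) (use assms(3) in \<open>auto simp: exps_def subset_eq\<close>)
  have \<Pi>: "\<Pi> ^ k \<in> ?R" for k unfolding \<Pi>_def by (intro subring_power subring_prod R) (use P in blast)
  have bound: "\<bar>e k\<bar> \<le> int (\<Sum>k\<in>J. nat \<bar>e k\<bar>)" if "k \<in> J" for e :: "nat \<Rightarrow> int" and k
  proof -
    have "nat \<bar>e k\<bar> \<le> (\<Sum>k\<in>J. nat \<bar>e k\<bar>)" using that fin by (intro member_le_sum) auto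
    then show ?thesis by linarith
  qed
  have clear: "\<Pi> ^ N * (\<Prod>k\<in>J. P k powi e k) \<in> ?R" if "(\<Sum>k\<in>J. nat \<bar>e k\<bar>) \<le> N" for N e
  proof -
    have "- e k \<le> int N" if "k \<in> J" for k using bound[OF that, of e] \<open>_ \<le> N\<close> by linarith
    then have "\<Pi> ^ N * (\<Prod>k\<in>J. P k powi e k) = (\<Prod>k\<in>J. P k ^ nat (int N + e k))"
      unfolding \<Pi>_def using P by (intro prod_power_mult_powi) blast
    then show ?thesis using P by (simp only:) (intro subring_prod subring_power R; blast)
  qed
  \<comment> \<open>the bound on \<open>N\<close> makes \<open>\<Pi> ^ N * A\<close> a polynomial, so that components can be compared at the end\<close>
  have "\<exists>N g1 g2. (\<Sum>k\<in>J. nat \<bar>- a k\<bar>) \<le> N \<and> g1 \<in> mspan m x ?E \<and> g2 \<in> mspan m x ?F \<and>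
      \<Pi> ^ N * f = \<Pi> ^ N * A * g1 + g2" if "f \<in> laur m x'" for f
    using that
  proof induction
    case zero
    show ?case
      by (rule exI[of _ "\<Sum>k\<in>J. nat \<bar>- a k\<bar>"], rule exI[of _ 0], rule exI[of _ 0]) (simp add: mspan.zero)
  next
    case (step f e c)
    from step(3) obtain N g1 g2 where IH: "(\<Sum>k\<in>J. nat \<bar>- a k\<bar>) \<le> N" "g1 \<in> mspan m x ?E" "g2 \<in> mspan m x ?F"
        "\<Pi> ^ N * f = \<Pi> ^ N * A * g1 + g2" by (elim exE conjE)
    have mon': "mon m x' e = mon m x (flip J e) * (\<Prod>k\<in>J. P k powi e k)"
      unfolding x'_def by (rule mon_exchange[OF J])
    have fe: "flip J e \<in> exps {1..m}" by (rule flip_exps[OF step(2)])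
    show ?case
    proof (cases "\<forall>k\<in>I. flip J e k = a k")
      case True
      have "e k = - a k" if "k \<in> J" for k
        using True[rule_format, of k] that assms(2) by (auto simp: flip_def)
      then have "(\<Prod>k\<in>J. P k powi e k) = A" unfolding A_def by (intro prod.cong) auto
      then have "\<Pi> ^ N * (f + of_int c * mon m x' e) = \<Pi> ^ N * A * (g1 + of_int c * mon m x (flip J e)) + g2"
        using IH(4) unfolding mon' by (simp add: algebra_simps)
      moreover have "g1 + of_int c * mon m x (flip J e) \<in> mspan m x ?E"
        using True fe by (intro mspan.step IH(2)) blast
      ultimately show ?thesis using IH(1,3) by blast
    next
      case False
      define K where "K = (\<Sum>k\<in>J. nat \<bar>e k\<bar>)"
      have "of_int c * mon m x (flip J e) \<in> mspan m x ?F" using False fe by (intro mspan_cmult_mon) blast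
      then have "(\<Pi> ^ (N + K) * (\<Prod>k\<in>J. P k powi e k)) * (of_int c * mon m x (flip J e)) \<in> mspan m x ?F"
        by (rule mulF[OF clear, rotated]) (simp add: K_def)
      then have "\<Pi> ^ K * g2 + \<Pi> ^ (N + K) * (of_int c * mon m x' e) \<in> mspan m x ?F"
        unfolding mon' by (intro mspan_add[OF mulF[OF \<Pi> IH(3)]]) (simp only: ac_simps)
      moreover have "\<Pi> ^ (N + K) * (f + of_int c * mon m x' e) =
          \<Pi> ^ K * (\<Pi> ^ N * f) + \<Pi> ^ (N + K) * (of_int c * mon m x' e)"
        by (simp add: algebra_simps power_add)
      then have "\<Pi> ^ (N + K) * (f + of_int c * mon m x' e) =
          \<Pi> ^ (N + K) * A * g1 + (\<Pi> ^ K * g2 + \<Pi> ^ (N + K) * (of_int c * mon m x' e))"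
        unfolding IH(4) by (simp add: algebra_simps power_add)
      ultimately show ?thesis using IH(1,2) by (meson trans_le_add1)
    qed
  qed
  from this[OF f[folded x'_def]] obtain N g1 g2 where *: "(\<Sum>k\<in>J. nat \<bar>- a k\<bar>) \<le> N" "g1 \<in> mspan m x ?E" "g2 \<in> mspan m x ?F"
      "\<Pi> ^ N * (f1 + f2) = \<Pi> ^ N * A * g1 + g2" by (elim exE conjE)
  have "\<Pi> ^ N * f1 = \<Pi> ^ N * A * g1"
  proof (rule lind_direct_eq[OF assms(1)])
    show "\<Pi> ^ N * f1 + \<Pi> ^ N * f2 = \<Pi> ^ N * A * g1 + g2" using *(4) by (simp only: distrib_left)
    show "\<Pi> ^ N * f1 \<in> mspan m x ?E" "\<Pi> ^ N * f2 \<in> mspan m x ?F" by (intro mulE mulF \<Pi> f1 f2)+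
    show "\<Pi> ^ N * A * g1 \<in> mspan m x ?E" unfolding A_def by (intro mulE clear *)
    show "g2 \<in> mspan m x ?F" by (rule *(3))
  qed auto
  moreover have "\<Pi> \<noteq> 0" unfolding \<Pi>_def using P fin by simp
  ultimately have "f1 = A * g1" by (simp add: mult.assoc)
  then show thesis using that *(2) unfolding A_def by blast
qed

text \<open>
  Exactly one of the two monomials of the exchange polynomial contains \<open>x\<^sub>k\<close>. Since the string begins
  and ends with 1, the only term without \<open>x\<^sub>k\<close> is a power of the other monomial.
\<close>

lemma exchange_lowest:
  assumes gs: "gseed m n d Q T" and j: "j \<in> {1..n}" and k: "k \<in> {1..m}" and b: "bmat T k j \<noteq> 0"
  obtains p where
    "exchange_poly m d j T = mon m (xvar T) (\<lambda>l. int (d j) * (if bmat T k j > 0 then neg_exp m d T j l else pos_exp m d T j l)) + p"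
    "p \<in> mspan m (xvar T) {e \<in> exps {1..m}. (\<forall>l. 0 \<le> e l \<and> (e l \<noteq> 0 \<longrightarrow> l \<in> Q \<or> bmat T l j \<noteq> 0)) \<and> 0 < e k}"
proof -
  note g = gseed_basic[OF gs j]
  define E where "E = {e \<in> exps {1..m}. (\<forall>l. 0 \<le> e l \<and> (e l \<noteq> 0 \<longrightarrow> l \<in> Q \<or> bmat T l j \<noteq> 0)) \<and> 0 < e k}"
  have *: "\<exists>p. hpoly \<rho> (d j) (mon m (xvar T) e) (mon m (xvar T) e') = mon m (xvar T) (\<lambda>l. int (d j) * e' l) + p \<and> p \<in> mspan m (xvar T) E"
    if \<rho>: "\<And>r. r \<le> d j \<Longrightarrow> \<rho> r \<in> mspan m (xvar T) (pexps Q)" "\<rho> 0 = 1"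
      and e: "\<And>l. 0 \<le> e l \<and> (e l \<noteq> 0 \<longrightarrow> l \<in> {1..m} \<and> bmat T l j \<noteq> 0)" "0 < e k"
      and e': "\<And>l. 0 \<le> e' l \<and> (e' l \<noteq> 0 \<longrightarrow> l \<in> {1..m} \<and> bmat T l j \<noteq> 0)" for \<rho> e e'
  proof -
    have "(\<Sum>r\<in>{1..d j}. \<rho> r * (mon m (xvar T) e ^ r * mon m (xvar T) e' ^ (d j - r))) \<in> mspan m (xvar T) E"
    proof (rule hpoly_rest_in_mspan[OF g(5) \<rho>(1)])
      fix a r assume a: "a \<in> pexps Q" and r: "1 \<le> r" "r \<le> d j"
      let ?f = "\<lambda>l. a l + (int r * e l + (int (d j) - int r) * e' l)"
      have aQ: "0 \<le> a l" "a l \<noteq> 0 \<Longrightarrow> l \<in> Q" for l using a by (auto simp: pexps_def exps_def)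
      have nn: "0 \<le> int r * e l" "0 \<le> (int (d j) - int r) * e' l" for l using e(1)[of l] e'[of l] r by auto
      have "0 \<le> ?f l" for l using aQ(1)[of l] nn[of l] by linarith
      moreover have "l \<in> {1..m} \<and> (l \<in> Q \<or> bmat T l j \<noteq> 0)" if "?f l \<noteq> 0" for l
      proof -
        have "a l \<noteq> 0 \<or> e l \<noteq> 0 \<or> e' l \<noteq> 0" using that by auto
        then show ?thesis using aQ(2)[of l] e(1)[of l] e'[of l] g(2) by auto
      qed
      moreover have "0 < int r * e k" using e(2) r by simp
      then have "0 < ?f k" using aQ(1)[of k] nn(2)[of k] by linarith
      ultimately show "?f \<in> E" unfolding E_def exps_def by blast
    qed
    then show ?thesis using hpoly_extract[of \<rho>, OF \<rho>(2)] by (auto simp: mon_power)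
  qed
  have u: "0 \<le> pos_exp m d T j l \<and> (pos_exp m d T j l \<noteq> 0 \<longrightarrow> l \<in> {1..m} \<and> bmat T l j \<noteq> 0)" for l
    by (auto simp: pos_exp_def pos_part_nonneg beta_def)
  have v: "0 \<le> neg_exp m d T j l \<and> (neg_exp m d T j l \<noteq> 0 \<longrightarrow> l \<in> {1..m} \<and> bmat T l j \<noteq> 0)" for l
    by (auto simp: neg_exp_def pos_part_nonneg beta_def)
  have "\<exists>p. exchange_poly m d j T = mon m (xvar T) (\<lambda>l. int (d j) * (if bmat T k j > 0 then neg_exp m d T j l else pos_exp m d T j l)) + p
     \<and> p \<in> mspan m (xvar T) E"
  proof (cases "bmat T k j > 0")
    case True
    then have "0 < pos_exp m d T j k" using gseed_beta_pos_iff[OF gs j k] k by (simp add: pos_exp_def pos_part_def)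
    then show ?thesis unfolding exchange_hpoly
      using True *[of "rho T j", OF gseed_rho[OF gs j] g(9) u _ v] by simp
  next
    case False
    then have "0 < neg_exp m d T j k"
      using gseed_beta_pos_iff[OF gs j k] gseed_beta_0_iff[OF gs j k] k b by (auto simp: neg_exp_def pos_part_def)
    then show ?thesis unfolding exchange_hpoly
      using False *[of "\<lambda>r. rho T j (d j - r)", OF _ _ v _ u] gseed_rho[OF gs j] g(10) by (simp add: hpoly_rev)
  qed
  then show thesis using that unfolding E_def by blast
qed

text \<open>
  The lowest component of the product in the \<open>i\<close>-degree is the lowest component of \<open>g\<close> times a
  monomial, so \<open>g\<close> has a component of negative degree only if the product has one.
\<close>

lemma unit_lowest_divides:
  assumes "lind m x" "\<mu> \<in> exps {1..m}" "\<mu> i = 0" "p \<in> mspan m x {e \<in> exps {1..m}. 0 < e i}"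
    and G: "G \<subseteq> exps {1..m}" and g: "g \<in> mspan m x G"
    and "(mon m x \<mu> + p) * g \<in> mspan m x {e \<in> exps {1..m}. 0 \<le> e i}"
  shows "g \<in> mspan m x {e \<in> G. 0 \<le> e i}"
proof -
  note nz = lind_nzero[OF assms(1)]
  have step: "g \<in> mspan m x {e \<in> G. - int N \<le> e i} \<Longrightarrow>
      (mon m x \<mu> + p) * g \<in> mspan m x {e \<in> exps {1..m}. 0 \<le> e i} \<Longrightarrow> g \<in> mspan m x {e \<in> G. 0 \<le> e i}" for N
  proof (induction N)
    case (Suc N)
    obtain h h' where h: "g = h + h'" "h \<in> mspan m x {e \<in> {e \<in> G. - int (Suc N) \<le> e i}. e i = - int (Suc N)}"
        "h' \<in> mspan m x {e \<in> {e \<in> G. - int (Suc N) \<le> e i}. \<not> e i = - int (Suc N)}"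
      using mspan_split[OF Suc(2), where Q = "\<lambda>e. e i = - int (Suc N)"] .
    have h1: "h \<in> mspan m x {e \<in> exps {1..m}. e i = - int (Suc N)}" using h(2) by (rule mspan_monoD) (use G in auto)
    have h2: "h' \<in> mspan m x {e \<in> G. - int N \<le> e i}" using h(3) by (rule mspan_monoD) auto
    let ?E = "{e \<in> exps {1..m}. e i = - int (Suc N)}" and ?F = "{e \<in> exps {1..m}. - int N \<le> e i}"
    have 1: "mon m x \<mu> * h \<in> mspan m x ?E"
      by (rule mspan_mult[OF nz mspan_mon h1, of _ "{\<mu>}"]) (use assms(2,3) in \<open>auto simp: exps_def\<close>)
    have 2: "p * h \<in> mspan m x ?F"
      by (rule mspan_mult[OF nz assms(4) h1]) (auto simp: exps_def)
    have 3: "mon m x \<mu> * h' \<in> mspan m x ?F"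
      by (rule mspan_mult[OF nz mspan_mon h2, of _ "{\<mu>}"]) (use assms(2,3) G in \<open>auto simp: exps_def subset_eq\<close>)
    have 4: "p * h' \<in> mspan m x ?F"
      by (rule mspan_mult[OF nz assms(4) h2]) (use G in \<open>auto simp: exps_def subset_eq\<close>)
    have 5: "- ((mon m x \<mu> + p) * g) \<in> mspan m x ?F"
      by (rule mspan_uminus, rule mspan_monoD[OF Suc(3)]) auto
    have "mon m x \<mu> * h = 0"
    proof (rule lind_direct[OF assms(1) _ _ _ 1])
      show "p * h + (mon m x \<mu> * h' + p * h') + - ((mon m x \<mu> + p) * g) \<in> mspan m x ?F"
        by (intro mspan_add 2 3 4 5)
      show "mon m x \<mu> * h + (p * h + (mon m x \<mu> * h' + p * h') + - ((mon m x \<mu> + p) * g)) = 0"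
        unfolding h(1) by (simp add: algebra_simps)
    qed auto
    then have "h = 0" using mon_nonzero[OF nz] by simp
    then show ?case using Suc(1) h2 Suc(3) h(1) by simp
  qed simp
  obtain B c where B: "finite B" "B \<subseteq> G" "g = (\<Sum>e\<in>B. of_int (c e) * mon m x e)" using mspan_normal[OF g] .
  have "- int (\<Sum>e\<in>B. nat \<bar>e i\<bar>) \<le> e i" if "e \<in> B" for e
  proof -
    have "nat \<bar>e i\<bar> \<le> (\<Sum>e\<in>B. nat \<bar>e i\<bar>)" using that B(1) by (intro member_le_sum) auto
    then show ?thesis by linarith
  qed
  then have "g \<in> mspan m x {e \<in> G. - int (\<Sum>e\<in>B. nat \<bar>e i\<bar>) \<le> e i}"
    unfolding B(3) by (intro mspan_normal_in) (use B(2) in auto)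
  from step[OF this assms(7)] show ?thesis .
qed

lemma unit_lowest_power_divides:
  assumes "lind m x" "\<mu> \<in> exps {1..m}" "\<mu> i = 0" "p \<in> mspan m x {e \<in> exps {1..m}. 0 < e i}"
    and G: "G \<subseteq> exps {1..m}" and g: "g \<in> mspan m x G"
    and "(mon m x \<mu> + p) ^ k * g \<in> mspan m x {e \<in> exps {1..m}. 0 \<le> e i}"
  shows "g \<in> mspan m x {e \<in> G. 0 \<le> e i}"
  using assms(7)
proof (induction k)
  case 0
  then show ?case
    using unit_lowest_divides[OF assms(1), of "\<lambda>_. 0" i 0 G g] G g by (simp add: mon_zero mspan.zero exps_def)
next
  case (Suc k)
  let ?p = "mon m x \<mu> + p"
  have "?p \<in> laur m x" 
    by (intro mspan_add mspan_mon assms(2) mspan_monoD[OF assms(4)]) auto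
  then have "?p ^ k * g \<in> laur m x"
    by (intro subring_mult subring_power subring_mspan_exps lind_nzero[OF assms(1)] mspan_monoD[OF g G])
  moreover have "?p * (?p ^ k * g) \<in> mspan m x {e \<in> exps {1..m}. 0 \<le> e i}" using Suc(2) by (simp add: mult.assoc)
  ultimately have "?p ^ k * g \<in> mspan m x {e \<in> exps {1..m}. 0 \<le> e i}"
    by (rule unit_lowest_divides[OF assms(1-4) subset_refl])
  then show ?case by (rule Suc(1))
qed


section \<open>The rank two argument\<close>

text \<open>
  The relation gives \<open>M / z1 = z3 - z2 * h / z1\<close>. Substituting it for one factor \<open>1 / z1\<close> either lowers the
  power of \<open>1 / z1\<close> or, as \<open>z2 * z0\<close> is under control, lowers the power of \<open>z0\<close>. In the application, \<open>W\<close>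
  contains \<open>z0, z1, z2, z3\<close>, and \<open>Y\<close> consists of the Laurent polynomials without negative powers of \<open>z2\<close>.
\<close>

lemma laurent_expand_absorb:
  fixes W Y :: "'a::field set"
  assumes W: "is_subring W" and Y: "is_subring Y"
    and z: "z0 \<in> W" "z1 \<in> W" "z1 \<noteq> 0" "inverse z1 \<in> Y" "z3 \<in> W \<inter> Y"
    and M: "M \<noteq> 0" "inverse M \<in> W \<inter> Y" and h: "h \<in> W \<inter> Y" and q: "z2 * z0 \<in> W \<inter> Y"
    and rel: "z1 * z3 = M + z2 * h"
  shows "\<exists>w\<in>W. \<exists>y\<in>Y. z0 ^ a * inverse z1 ^ b = w + y"
proof (induction a arbitrary: b)
  case 0
  have "inverse z1 ^ b \<in> Y" using subring_power[OF Y z(4)] .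
  then show ?case using subring_0[OF W] by force
next
  case (Suc a)
  show ?case
  proof (induction b)
    case 0
    have "z0 ^ Suc a \<in> W" using subring_power[OF W z(1)] .
    then show ?case using subring_0[OF Y] by force
  next
    case (Suc b)
    from Suc.IH obtain w y where wy: "w \<in> W" "y \<in> Y" "z0 ^ Suc a * inverse z1 ^ b = w + y" by blast
    from \<open>\<And>b. \<exists>w\<in>W. \<exists>y\<in>Y. z0 ^ a * inverse z1 ^ b = w + y\<close>[of "Suc b"]
    obtain w' y' where wy': "w' \<in> W" "y' \<in> Y" "z0 ^ a * inverse z1 ^ Suc b = w' + y'" by blast
    have "inverse z1 = inverse M * (z3 - z2 * h * inverse z1)"
      using rel z(3) M(1) by (simp add: field_simps)
    then have "z0 ^ Suc a * inverse z1 ^ Suc b = z0 ^ Suc a * inverse z1 ^ b * (inverse M * (z3 - z2 * h * inverse z1))"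
      by simp
    also have "\<dots> = inverse M * z3 * (z0 ^ Suc a * inverse z1 ^ b) - inverse M * h * (z2 * z0) * (z0 ^ a * inverse z1 ^ Suc b)"
      by (simp add: algebra_simps)
    also have "\<dots> = (inverse M * z3 * w - inverse M * h * (z2 * z0) * w') + (inverse M * z3 * y - inverse M * h * (z2 * z0) * y')"
      unfolding wy(3) wy'(3) by (simp add: algebra_simps)
    finally have "z0 ^ Suc a * inverse z1 ^ Suc b = \<dots>" .
    moreover have c: "inverse M * z3 \<in> W" "inverse M * h * (z2 * z0) \<in> W"
        "inverse M * z3 \<in> Y" "inverse M * h * (z2 * z0) \<in> Y"
      using z(5) M(2) h q by (simp_all add: subring_mult[OF W] subring_mult[OF Y])
    have "inverse M * z3 * w - inverse M * h * (z2 * z0) * w' \<in> W"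
      by (rule subring_diff[OF W subring_mult[OF W c(1) wy(1)] subring_mult[OF W c(2) wy'(1)]])
    moreover have "inverse M * z3 * y - inverse M * h * (z2 * z0) * y' \<in> Y"
      by (rule subring_diff[OF Y subring_mult[OF Y c(3) wy(2)] subring_mult[OF Y c(4) wy'(2)]])
    ultimately show ?case by blast
  qed
qed

text \<open>
  Modulo \<open>z2\<close>, the product \<open>z1 * z3\<close> is the unit \<open>M\<close>. Therefore \<open>z1 ^ (c * d)\<close> times the form in \<open>z3\<close> is
  congruent to a unit times the form in \<open>z1\<close>, which is \<open>z2 * z0\<close>; dividing by \<open>z2\<close>
  gives \<open>z1 ^ (c * d) * z4 \<in> W\<close>. Multiplying with \<open>z3 ^ (c * d)\<close> and using the congruence once more
  removes the power of \<open>z1\<close>.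
\<close>

lemma hpoly_quotient_in_subring:
  fixes W :: "'a::field_char_0 set"
  assumes W: "is_subring W" and \<rho>: "\<And>r. r \<le> d \<Longrightarrow> \<rho> r \<in> W"
    and u: "u0 \<in> W" "u' \<in> W" "v' \<in> W" "v0 \<noteq> 0" "inverse v0 \<in> W" "M \<noteq> 0" "M \<in> W" "inverse M \<in> W"
    and uv: "u' * v0 = u0 * v' * M ^ c"
    and z: "z0 \<in> W" "z1 \<in> W" "z2 \<in> W" "z3 \<in> W" "z2 \<noteq> 0" and h: "h \<in> W" and rel: "z1 * z3 = M + z2 * h"
    and P: "z2 * z0 = hpoly \<rho> d (z1 ^ c * u0) v0" and P': "z2 * z4 = hpoly \<rho> d u' (z3 ^ c * v')"
  shows "z4 \<in> W"
proof -
  note sr = subring_add[OF W] subring_mult[OF W] subring_power[OF W] subring_sum[OF W]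
  have cong_power: "\<exists>w\<in>W. (z1 * z3) ^ k = M ^ k + z2 * w" for k
  proof (induction k)
    case 0
    show ?case using subring_0[OF W] by force
  next
    case (Suc k)
    then obtain w where w: "w \<in> W" "(z1 * z3) ^ k = M ^ k + z2 * w" by blast
    have "(z1 * z3) ^ Suc k = M ^ Suc k + z2 * (h * M ^ k + h * z2 * w + M * w)"
      unfolding power_Suc w(2) unfolding rel by (simp add: algebra_simps)
    moreover have "h * M ^ k + h * z2 * w + M * w \<in> W" by (intro sr h w z u)
    ultimately show ?case by blast
  qed
  define C where "C = (\<lambda>k. SOME w. w \<in> W \<and> (z1 * z3) ^ k = M ^ k + z2 * w)"
  have C: "C k \<in> W" "(z1 * z3) ^ k = M ^ k + z2 * C k" for k
    using someI_ex[OF cong_power[of k, unfolded Bex_def]] unfolding C_def by blast+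
  define w where "w = (\<Sum>r\<in>{0..d}. \<rho> r * u' ^ r * z1 ^ (c * r) * C (c * (d - r)) * v' ^ (d - r))"
  define B where "B = (\<Sum>r\<in>{0..d}. \<rho> r * u' ^ r * z1 ^ (c * r) * M ^ (c * (d - r)) * v' ^ (d - r))"
  have w_in: "w \<in> W" unfolding w_def by (intro sr \<rho> u z C) auto
  have A: "z1 ^ (c * d) * (z2 * z4) = B + z2 * w"
    unfolding P' hpoly_def B_def w_def sum_distrib_left sum.distrib[symmetric]
  proof (rule sum.cong[OF refl])
    fix r assume "r \<in> {0..d}"
    then have "c * d = c * r + c * (d - r)" by (simp flip: distrib_left)
    then have "z1 ^ (c * d) * (\<rho> r * (u' ^ r * (z3 ^ c * v') ^ (d - r))) =
        \<rho> r * u' ^ r * z1 ^ (c * r) * (z1 * z3) ^ (c * (d - r)) * v' ^ (d - r)"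
      by (simp add: power_add power_mult_distrib power_mult ac_simps)
    then show "z1 ^ (c * d) * (\<rho> r * (u' ^ r * (z3 ^ c * v') ^ (d - r))) =
      \<rho> r * u' ^ r * z1 ^ (c * r) * M ^ (c * (d - r)) * v' ^ (d - r) +
      z2 * (\<rho> r * u' ^ r * z1 ^ (c * r) * C (c * (d - r)) * v' ^ (d - r))"
      unfolding C(2) by (simp add: algebra_simps)
  qed
  have "v0 ^ d * B = M ^ (c * d) * v' ^ d * (z2 * z0)"
    unfolding P hpoly_def B_def sum_distrib_left
  proof (rule sum.cong[OF refl])
    fix r assume "r \<in> {0..d}"
    then have d: "d = r + (d - r)" by simp
    then have cd: "c * d = c * r + c * (d - r)" by (simp flip: distrib_left)
    have "v0 ^ d * (\<rho> r * u' ^ r * z1 ^ (c * r) * M ^ (c * (d - r)) * v' ^ (d - r)) =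
      \<rho> r * (u' * v0) ^ r * z1 ^ (c * r) * M ^ (c * (d - r)) * v' ^ (d - r) * v0 ^ (d - r)"
      by (subst (1) d) (simp only: power_add power_mult_distrib ac_simps)
    also have "\<dots> = M ^ (c * d) * v' ^ d * (\<rho> r * ((z1 ^ c * u0) ^ r * v0 ^ (d - r)))"
      unfolding uv cd by (subst (3) d) (simp only: power_add power_mult_distrib power_mult ac_simps)
    finally show "v0 ^ d * (\<rho> r * u' ^ r * z1 ^ (c * r) * M ^ (c * (d - r)) * v' ^ (d - r)) =
      M ^ (c * d) * v' ^ d * (\<rho> r * ((z1 ^ c * u0) ^ r * v0 ^ (d - r)))" .
  qed
  then have "B = z2 * (inverse v0 ^ d * M ^ (c * d) * v' ^ d * z0)"
    using u(4) by (simp add: field_simps power_inverse)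
  then have "z2 * (z1 ^ (c * d) * z4) = z2 * (inverse v0 ^ d * M ^ (c * d) * v' ^ d * z0 + w)"
    using A by (simp add: algebra_simps)
  then have "z1 ^ (c * d) * z4 = inverse v0 ^ d * M ^ (c * d) * v' ^ d * z0 + w" using z(5) by simp
  also have "\<dots> \<in> W" by (intro sr u z w_in)
  finally have 1: "z1 ^ (c * d) * z4 \<in> W" .
  have 2: "z2 * z4 \<in> W" unfolding P' hpoly_def by (intro sr \<rho> u z) auto
  have "z3 ^ (c * d) * (z1 ^ (c * d) * z4) - z2 * z4 * C (c * d) \<in> W"
    by (rule subring_diff[OF W subring_mult[OF W subring_power[OF W z(4)] 1] subring_mult[OF W 2 C(1)]])
  also have "z3 ^ (c * d) * (z1 ^ (c * d) * z4) - z2 * z4 * C (c * d) = M ^ (c * d) * z4"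
    using C(2)[of "c * d"] by (simp add: power_mult_distrib algebra_simps)
  finally have "inverse M ^ (c * d) * (M ^ (c * d) * z4) \<in> W"
    by (rule subring_mult[OF W subring_power[OF W u(8)]])
  also have "inverse M ^ (c * d) * (M ^ (c * d) * z4) = z4"
    using u(6) by (simp add: power_inverse field_simps)
  finally show ?thesis .
qed

text \<open>
  The case of one exchanged variable, for a component of negative degree \<open>b\<close> in \<open>x\<^sub>i\<close>: it is divisible by
  \<open>P ^ (- b)\<close>, hence it can be written with the new variable in place of the inverse of \<open>x\<^sub>i\<close>.
\<close>

lemma mutation_component:
  assumes gs: "gseed m n d Q T" and i: "i \<in> {1..n}"
    and f: "(\<Sum>a\<in>A. g a) \<in> laur m (xvar (mutate m d i T))" and A: "finite A"
    and g: "\<And>a. a \<in> A \<Longrightarrow> g a \<in> mspan m (xvar T) {e \<in> exps {1..m}. e i = a}"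
    and b: "b \<in> A" "b < 0"
  obtains g' where "g' \<in> mspan m (xvar T) {e \<in> exps {1..m}. e i = b}" "g b = exchange_poly m d i T ^ nat (- b) * g'"
    "g b = xvar (mutate m d i T) i ^ nat (- b) * (xvar T i ^ nat (- b) * g')"
proof -
  note gg = gseed_basic[OF gs i]
  have x': "xvar (mutate m d i T) = (\<lambda>k. if k \<in> {i} then inverse (xvar T k) * exchange_poly m d i T else xvar T k)"
    by (auto simp: mutate_sel)
  obtain g' where g': "g' \<in> mspan m (xvar T) {e \<in> exps {1..m}. \<forall>k\<in>{i}. e k = b}"
      "g b = (\<Prod>k\<in>{i}. exchange_poly m d i T powi - b) * g'"
  proof (rule exchange_component[OF gg(3)])
    show "g b + (\<Sum>a\<in>A - {b}. g a) \<in> laur m (\<lambda>k. if k \<in> {i} then inverse (xvar T k) * exchange_poly m d i T else xvar T k)"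
      using f sum.remove[OF A b(1), of g] unfolding x' by simp
    show "g b \<in> mspan m (xvar T) {e \<in> exps {1..m}. \<forall>k\<in>{i}. e k = b}" using g[OF b(1)] by simp
    show "(\<Sum>a\<in>A - {b}. g a) \<in> mspan m (xvar T) {e \<in> exps {1..m}. \<not> (\<forall>k\<in>{i}. e k = b)}"
    proof (rule mspan_sum)
      fix a assume "a \<in> A - {b}"
      then show "g a \<in> mspan m (xvar T) {e \<in> exps {1..m}. \<not> (\<forall>k\<in>{i}. e k = b)}"
        using g[of a] by (auto elim!: mspan_monoD)
    qed
    show "{i} \<subseteq> {1..m}" using gg(6) by simp
    show "exchange_poly m d i T \<in> mspan m (xvar T) (exps ({1..m} - {i})) \<and> exchange_poly m d i T \<noteq> 0"
      using exchange_in_others[OF gs i] exchange_nonzero[OF gs i] by blast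
  qed (auto intro: that)
  have *: "g b = exchange_poly m d i T ^ nat (- b) * g'" using g'(2) b(2) by (simp add: power_int_def)
  also have "\<dots> = xvar (mutate m d i T) i ^ nat (- b) * (xvar T i ^ nat (- b) * g')"
    using gg(12) by (simp add: mutate_sel power_mult_distrib power_inverse field_simps)
  finally show thesis using that * g'(1) by simp
qed

lemma xvar_inverse_mon: "k \<in> {1..m} \<Longrightarrow> inverse (x k) = mon m x (\<lambda>j. if j = k then -1 else 0)"
  by (simp add: mon_single power_int_minus)

lemma xvar_power_mon: "k \<in> {1..m} \<Longrightarrow> x k ^ N = mon m x (\<lambda>j. if j = k then int N else 0)"
  by (simp add: mon_single)

text \<open>
  If \<open>b\<^sub>i\<^sub>j \<noteq> 0\<close>, the exchange polynomial of \<open>j\<close> is congruent modulo \<open>x\<^sub>i\<close> to a monomial in the variables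
  other than \<open>x\<^sub>i\<close> and \<open>x\<^sub>j\<close>, that is, to a unit.
\<close>

lemma exchange_affine:
  assumes gs: "gseed m n d Q T" and i: "i \<in> {1..n}" and j: "j \<in> {1..n}" and ij: "i \<noteq> j" and b: "bmat T i j \<noteq> 0"
  obtains \<mu> h where
    "\<mu> = (\<lambda>l. int (d j) * (if bmat T i j > 0 then neg_exp m d T j l else pos_exp m d T j l))"
    "\<mu> \<in> exps ({1..m} - {i, j})"
    "exchange_poly m d j T = mon m (xvar T) \<mu> + xvar T i * h"
    "h \<in> mspan m (xvar T) {e \<in> exps ({1..m} - {j}). 0 \<le> e i}"
    "xvar T i * h \<in> mspan m (xvar T) {e \<in> exps {1..m}. 0 < e i}"
proof -
  note g = gseed_basic[OF gs i] and gj = gseed_basic[OF gs j]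
  define \<mu> where "\<mu> = (\<lambda>l. int (d j) * (if bmat T i j > 0 then neg_exp m d T j l else pos_exp m d T j l))"
  obtain p where p: "exchange_poly m d j T = mon m (xvar T) \<mu> + p"
    "p \<in> mspan m (xvar T) {e \<in> exps {1..m}. (\<forall>l. 0 \<le> e l \<and> (e l \<noteq> 0 \<longrightarrow> l \<in> Q \<or> bmat T l j \<noteq> 0)) \<and> 0 < e i}"
    using exchange_lowest[OF gs j g(6) b] unfolding \<mu>_def .
  have "\<mu> \<in> exps ({1..m} - {i, j})"
    using gseed_beta_pos_iff[OF gs j g(6)] gj(11)
    by (auto simp: \<mu>_def exps_def pos_exp_def neg_exp_def pos_part_def beta_def)
  moreover have "inverse (xvar T i) * p \<in> mspan m (xvar T) {e \<in> exps ({1..m} - {j}). 0 \<le> e i}"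
    unfolding xvar_inverse_mon[of i m "xvar T", OF g(6)]
    by (rule mspan_mult[OF g(5) mspan_mon p(2), of _ "{\<lambda>j. if j = i then -1 else 0}"])
      (use ij gj(7,11) in \<open>auto simp: exps_def\<close>)
  moreover have eq: "xvar T i * (inverse (xvar T i) * p) = p" using g(12) by simp
  moreover have "p \<in> mspan m (xvar T) {e \<in> exps {1..m}. 0 < e i}" by (rule mspan_monoD[OF p(2)]) auto
  ultimately show thesis using that[OF \<mu>_def, of "inverse (xvar T i) * p"] p(1) unfolding eq by blast
qed

text \<open>
  With \<open>z1 = x\<^sub>j\<close>, \<open>z2 = x\<^sub>i\<close>, and \<open>z0\<close>, \<open>z3\<close> the exchanged variables, so that \<open>z0 z2 = P\<^sub>i\<close> and
  \<open>z1 z3 = P\<^sub>j\<close>, the claim is that the intersection of the three Laurent rings is generated by the four \<open>z\<close>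
  over the Laurent polynomials in the remaining variables. Comparison of \<open>L(T)\<close> and \<open>L(\<mu>\<^sub>i T)\<close> leaves
  negative powers of \<open>z1\<close> only; by \<open>laurent_expand_absorb\<close> the element splits into a part \<open>w\<close> in
  the generated ring and a part \<open>y\<close> without negative powers of \<open>z2\<close>. Then \<open>y\<close> is compared in \<open>L(T)\<close>
  and \<open>L(\<mu>\<^sub>j T)\<close>: its negative powers of \<open>z1\<close> turn into powers of \<open>z3\<close>, and the coefficients do not
  acquire negative powers of \<open>z2\<close> because \<open>P\<^sub>j\<close> is a unit modulo \<open>z2\<close>.
\<close>

lemma rank_two_intersection:
  assumes gs: "gseed m n d Q T" and i: "i \<in> {1..n}" and j: "j \<in> {1..n}" and ij: "i \<noteq> j" and b: "bmat T i j \<noteq> 0"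
    and f: "f \<in> laur m (xvar T)" "f \<in> laur m (xvar (mutate m d i T))" "f \<in> laur m (xvar (mutate m d j T))"
    and W: "is_subring W" "mspan m (xvar T) (exps ({1..m} - {i, j})) \<subseteq> W"
      "xvar T i \<in> W" "xvar T j \<in> W" "xvar (mutate m d i T) i \<in> W" "xvar (mutate m d j T) j \<in> W"
  shows "f \<in> W"
proof -
  note g = gseed_basic[OF gs i] and gj = gseed_basic[OF gs j]
  define x where "x = xvar T"
  define z0 where "z0 = xvar (mutate m d i T) i"
  define z3 where "z3 = xvar (mutate m d j T) j"
  let ?Pi = "exchange_poly m d i T" and ?Pj = "exchange_poly m d j T"
  let ?R = "mspan m x (exps ({1..m} - {i, j}))"
  define V where "V = is_subring hull (?R \<union> {x i, x j, z0, z3})"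
  define Y where "Y = mspan m x {e \<in> exps {1..m}. 0 \<le> e i}"
  note nz = g(5)[folded x_def]
  have V: "is_subring V" unfolding V_def by (rule is_subring_hull)
  have Vgen: "?R \<subseteq> V" "x i \<in> V" "x j \<in> V" "z0 \<in> V" "z3 \<in> V"
    unfolding V_def by (auto intro!: hull_inc)
  have Y: "is_subring Y" unfolding Y_def by (rule subring_mspan[OF nz]) (auto simp: exps_def)
  have xV: "x l \<in> V \<and> inverse (x l) \<in> V" if "l \<in> {1..m} - {i, j}" for l
  proof -
    have "x l \<in> ?R" using gen_mspan[of l m 1 "exps ({1..m} - {i, j})" x] that by (simp add: exps_def)
    moreover have "inverse (x l) \<in> ?R"
      unfolding xvar_inverse_mon[of l m x, OF DiffD1[OF that]] by (rule mspan_mon) (use that in \<open>auto simp: exps_def\<close>)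
    ultimately show ?thesis using Vgen(1) by blast
  qed
  have inV: "mspan m x E \<subseteq> V" if "\<And>e. e \<in> E \<Longrightarrow> 0 \<le> e i \<and> 0 \<le> e j" for E
  proof (rule mspan_gen_subset_subring[OF V])
    fix e l assume "e \<in> E" "l \<in> {1..m}" "e l \<noteq> 0"
    then show "x l \<in> V \<and> (e l < 0 \<longrightarrow> inverse (x l) \<in> V)"
      using xV[of l] Vgen(2,3) that[of e] by (cases "l = i"; cases "l = j") auto
  qed
  have z: "x i * z0 = ?Pi" "x j * z3 = ?Pj"
    using g(12) gj(12) unfolding z0_def z3_def x_def by (simp_all add: mutate_sel)
  obtain \<mu> h where \<mu>h: "\<mu> \<in> exps ({1..m} - {i, j})" "?Pj = mon m x \<mu> + x i * h"
    "h \<in> mspan m x {e \<in> exps ({1..m} - {j}). 0 \<le> e i}" "x i * h \<in> mspan m x {e \<in> exps {1..m}. 0 < e i}"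
    by (rule exchange_affine[OF gs i j ij b, folded x_def]) (rule that; assumption)
  have \<mu>V: "inverse (mon m x \<mu>) \<in> V \<inter> Y"
  proof -
    have "inverse (mon m x \<mu>) \<in> ?R"
      unfolding mon_uminus[symmetric] by (rule mspan_mon) (use \<mu>h(1) in \<open>auto simp: exps_def\<close>)
    moreover have "?R \<subseteq> Y" unfolding Y_def by (rule mspan_mono) (auto simp: exps_def)
    ultimately show ?thesis using Vgen(1) by blast
  qed
  have hV: "h \<in> V \<inter> Y"
  proof
    show "h \<in> V" by (rule subsetD[OF inV \<mu>h(3)]) (auto simp: exps_def)
    show "h \<in> Y" unfolding Y_def by (rule mspan_monoD[OF \<mu>h(3)]) (auto simp: exps_def)
  qed
  have PiV: "?Pi \<in> V \<inter> Y"
  proof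
    show "?Pi \<in> V" by (rule subsetD[OF inV exchange_in[OF gs i, folded x_def]]) auto
    show "?Pi \<in> Y" unfolding Y_def by (rule mspan_monoD[OF exchange_in[OF gs i, folded x_def]]) auto
  qed
  have ixY: "inverse (x j) \<in> Y"
    unfolding xvar_inverse_mon[of j m x, OF gj(6)] Y_def by (rule mspan_mon) (use ij gj(6) in \<open>auto simp: exps_def\<close>)
  have "?Pj \<in> Y" unfolding Y_def by (rule mspan_monoD[OF exchange_in[OF gs j, folded x_def]]) auto
  then have z3Y: "z3 \<in> V \<inter> Y" using Vgen(5) subring_mult[OF Y ixY] unfolding z3_def x_def by (simp add: mutate_sel)
  have expand: "\<exists>w\<in>V. \<exists>y\<in>Y. z0 ^ a * inverse (x j) ^ b = w + y" for a b
    by (rule laurent_expand_absorb[where ?z2.0 = "x i", OF V Y Vgen(4,3) _ ixY z3Y _ \<mu>V hV])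
      (use gj(12) mon_nonzero[OF nz] PiV z \<mu>h(2) in \<open>simp_all add: x_def\<close>)
  \<comment> \<open>the first comparison, of \<open>L(T)\<close> and \<open>L(\<mu>\<^sub>i T)\<close>, only yields \<open>f \<in> S\<close>\<close>
  define S where "S = {w + y | w y. w \<in> V \<and> y \<in> Y}"
  have S_add: "s + t \<in> S" if "s \<in> S" "t \<in> S" for s t
  proof -
    obtain w y w' y' where *: "w \<in> V" "y \<in> Y" "s = w + y" "w' \<in> V" "y' \<in> Y" "t = w' + y'" using \<open>s \<in> S\<close> \<open>t \<in> S\<close> unfolding S_def by blast
    then have "s + t = (w + w') + (y + y')" by simp
    then show ?thesis unfolding S_def using subring_add[OF V *(1,4)] subring_add[OF Y *(2,5)] by blast
  qed
  have S_mult: "r * s \<in> S" if "r \<in> V" "r \<in> Y" "s \<in> S" for r s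
  proof -
    obtain w y where *: "w \<in> V" "y \<in> Y" "s = w + y" using \<open>s \<in> S\<close> unfolding S_def by blast
    then have "r * s = r * w + r * y" by (simp add: algebra_simps)
    then show ?thesis unfolding S_def using subring_mult[OF V that(1) *(1)] subring_mult[OF Y that(2) *(2)] by blast
  qed
  have VS: "V \<subseteq> S" unfolding S_def using subring_0[OF Y] by force
  have YS: "Y \<subseteq> S" unfolding S_def using subring_0[OF V] by force
  have S1: "z0 ^ k * h' \<in> S" if "h' \<in> mspan m x (exps ({1..m} - {i}))" for k h'
    using that
  proof induction
    case zero
    show ?case using VS subring_0[OF V] by auto
  next
    case (step h' e c)
    have "z0 ^ k * mon m x e \<in> S"
    proof (cases "0 \<le> e j")
      case True
      have "mon m x e \<in> V"
        by (rule subsetD[OF inV mspan_mon[of e "{e}"]]) (use step(2) True in \<open>auto simp: exps_def\<close>)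
      then show ?thesis using VS subring_mult[OF V subring_power[OF V Vgen(4)]] by blast
    next
      case False
      let ?e = "\<lambda>l. if l = j then 0 else e l"
      have "mon m x e = mon m x (\<lambda>l. ?e l + (if l = j then e j else 0))" by (rule arg_cong[of _ _ "mon m x"]) auto
      also have "\<dots> = mon m x ?e * x j powi e j" by (simp add: mon_add[OF nz] mon_single[OF gj(6)])
      also have "x j powi e j = inverse (x j) ^ nat (- e j)" using False by (simp add: power_int_def power_inverse)
      finally have eq: "z0 ^ k * mon m x e = mon m x ?e * (z0 ^ k * inverse (x j) ^ nat (- e j))"
        by (simp only: ac_simps)
      have "mon m x ?e \<in> V"
        by (rule subsetD[OF inV mspan_mon[of ?e "{?e}"]]) (use step(2) in \<open>auto simp: exps_def\<close>)
      moreover have "mon m x ?e \<in> Y" unfolding Y_def by (rule mspan_mon) (use step(2) in \<open>auto simp: exps_def\<close>)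
      moreover have "z0 ^ k * inverse (x j) ^ nat (- e j) \<in> S" using expand[of k "nat (- e j)"] unfolding S_def by blast
      ultimately show ?thesis unfolding eq by (rule S_mult)
    qed
    then have "of_int c * (z0 ^ k * mon m x e) \<in> S"
      by (rule S_mult[rotated 2]) (intro subring_of_int V Y)+
    then have "z0 ^ k * h' + of_int c * (z0 ^ k * mon m x e) \<in> S" using S_add step(3) by blast
    then show ?case by (simp add: algebra_simps)
  qed
  obtain A c where A: "finite A" "f = (\<Sum>a\<in>A. c a)" "\<And>a. c a \<in> mspan m x {e \<in> exps {1..m}. e i = a}"
    by (rule mspan_decomp[OF f(1)[folded x_def], of "\<lambda>e. e i"]) (rule that; blast)
  have cS: "c a \<in> S" if a: "a \<in> A" for a
  proof (cases "0 \<le> a")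
    case True
    then have "c a \<in> Y" unfolding Y_def by (intro mspan_monoD[OF A(3)]) auto
    then show ?thesis using YS by blast
  next
    case False
    then have a0: "a < 0" by simp
    have cA: "c b \<in> mspan m (xvar T) {e \<in> exps {1..m}. e i = b}" for b using A(3) unfolding x_def .
    obtain g' where g': "g' \<in> mspan m x {e \<in> exps {1..m}. e i = a}" "c a = z0 ^ nat (- a) * (x i ^ nat (- a) * g')"
      by (rule mutation_component[where g = c and b = a, OF gs i f(2)[unfolded A(2)] A(1) cA a a0, folded x_def z0_def])
        (rule that; assumption)
    have "x i ^ nat (- a) * g' \<in> mspan m x (exps ({1..m} - {i}))"
      unfolding xvar_power_mon[of i m x, OF g(6)]
      by (rule mspan_mult[OF nz mspan_mon g'(1), of _ "{\<lambda>j. if j = i then int (nat (- a)) else 0}"])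
        (use False in \<open>auto simp: exps_def\<close>)
    then show ?thesis unfolding g'(2) by (rule S1)
  qed
  have S0: "0 \<in> S" using VS subring_0[OF V] by blast
  have "sum c B \<in> S" if "B \<subseteq> A" for B
    using finite_subset[OF that A(1)] that
    by (induction B rule: finite_induct) (simp_all add: S0 S_add cS)
  from this[OF subset_refl] obtain w y where wy: "f = w + y" "w \<in> V" "y \<in> Y" unfolding A(2) S_def by blast
  let ?x3 = "xvar (mutate m d j T)"
  have gs3: "gseed m n d Q (mutate m d j T)" by (rule gseed_mutate[OF gs j])
  note g3 = gseed_basic[OF gs3 i]
  note L3 = subring_mspan_exps[OF g3(5), of "{1..m}"]
  have x3: "?x3 l = x l" if "l \<noteq> j" for l using that unfolding x_def by (simp add: mutate_sel)
  have x3gen: "?x3 l \<in> laur m ?x3" "inverse (?x3 l) \<in> laur m ?x3" if "l \<in> {1..m}" for l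
    using laur_gen[OF that] laur_inverse_gen[OF that] by auto
  \<comment> \<open>needed to compare \<open>y = f - w\<close> in \<open>L(T)\<close> and \<open>L(\<mu>\<^sub>j T)\<close>\<close>
  have "V \<subseteq> laur m ?x3"
    unfolding V_def
  proof (rule hull_minimal[where S = is_subring, OF _ L3], intro Un_least insert_subsetI empty_subsetI)
    show R3: "?R \<subseteq> laur m ?x3"
      by (rule mspan_exps_subset_subring[OF L3]) (use x3gen x3 in \<open>metis DiffE Int_iff insertCI\<close>)
    show xi: "x i \<in> laur m ?x3" using x3gen(1)[OF g(6)] x3[OF ij] by simp
    have "x j = inverse (?x3 j) * exchange_poly m d j (mutate m d j T)"
      using mutate_mutate[OF gs j] unfolding x_def by (metis mutate_sel(1) fun_upd_same)
    moreover have "exchange_poly m d j (mutate m d j T) \<in> laur m ?x3"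
      by (rule mspan_monoD[OF exchange_in[OF gs3 j]]) auto
    ultimately show xj: "x j \<in> laur m ?x3" using subring_mult[OF L3 x3gen(2)[OF gj(6)]] by simp
    have "mspan m x {e \<in> exps {1..m}. \<forall>l. 0 \<le> e l \<and> (e l \<noteq> 0 \<longrightarrow> l \<in> Q \<or> bmat T l i \<noteq> 0)} \<subseteq> laur m ?x3"
    proof (rule mspan_gen_subset_subring[OF L3])
      fix e l assume "e \<in> {e \<in> exps {1..m}. \<forall>l. 0 \<le> e l \<and> (e l \<noteq> 0 \<longrightarrow> l \<in> Q \<or> bmat T l i \<noteq> 0)}" "l \<in> {1..m}"
      then have "0 \<le> e l" by auto
      then show "x l \<in> laur m ?x3 \<and> (e l < 0 \<longrightarrow> inverse (x l) \<in> laur m ?x3)"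
        using x3gen(1)[OF \<open>l \<in> {1..m}\<close>] xj x3[of l] by (cases "l = j") auto
    qed
    then have "?Pi \<in> laur m ?x3" using exchange_in[OF gs i] unfolding x_def by blast
    moreover have "z0 = inverse (?x3 i) * ?Pi" unfolding z0_def x3[OF ij] x_def by (simp add: mutate_sel)
    ultimately show "z0 \<in> laur m ?x3" using subring_mult[OF L3 x3gen(2)[OF g(6)]] by simp
    show "z3 \<in> laur m ?x3" using x3gen(1)[OF gj(6)] unfolding z3_def .
  qed
  then have "f - w \<in> laur m ?x3" using subring_diff[OF L3 f(3)] wy(2) by blast
  then have y3: "y \<in> laur m ?x3" using wy(1) by simp
  obtain A c where A: "finite A" "y = (\<Sum>a\<in>A. c a)"
      "\<And>a. c a \<in> mspan m x {e \<in> {e \<in> exps {1..m}. 0 \<le> e i}. e j = a}"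
    by (rule mspan_decomp[OF wy(3)[unfolded Y_def], of "\<lambda>e. e j"]) (rule that; blast)
  have A': "c a \<in> mspan m x {e \<in> exps {1..m}. e j = a}" for a by (rule mspan_monoD[OF A(3)]) auto
  have "c a \<in> V" if a: "a \<in> A" for a
  proof (cases "0 \<le> a")
    case True
    then show ?thesis using subsetD[OF inV A(3)[of a]] by auto
  next
    case False
    then have a0: "a < 0" by simp
    have cA: "c b \<in> mspan m (xvar T) {e \<in> exps {1..m}. e j = b}" for b using A' unfolding x_def .
    obtain g' where g': "g' \<in> mspan m x {e \<in> exps {1..m}. e j = a}"
        "c a = ?Pj ^ nat (- a) * g'" "c a = z3 ^ nat (- a) * (x j ^ nat (- a) * g')"
      by (rule mutation_component[where g = c and b = a, OF gs j y3[unfolded A(2)] A(1) cA a a0, folded x_def z3_def])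
        (rule that; assumption)
    have g1: "g' \<in> mspan m x {e \<in> {e \<in> exps {1..m}. e j = a}. 0 \<le> e i}"
    proof (rule unit_lowest_power_divides[OF g(3)[folded x_def] _ _ \<mu>h(4) _ g'(1)])
      show "(mon m x \<mu> + x i * h) ^ nat (- a) * g' \<in> mspan m x {e \<in> exps {1..m}. 0 \<le> e i}"
        unfolding \<mu>h(2)[symmetric] g'(2)[symmetric] by (rule mspan_monoD[OF A(3)]) auto
    qed (use \<mu>h(1) in \<open>auto simp: exps_def\<close>)
    have "x j ^ nat (- a) * g' \<in> mspan m x {e \<in> exps {1..m}. 0 \<le> e i \<and> e j = 0}"
      unfolding xvar_power_mon[of j m x, OF gj(6)]
      by (rule mspan_mult[OF nz mspan_mon g1, of _ "{\<lambda>l. if l = j then int (nat (- a)) else 0}"])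
        (use False ij in \<open>auto simp: exps_def\<close>)
    then have "x j ^ nat (- a) * g' \<in> V" using inV by (rule subsetD[rotated]) auto
    then show ?thesis unfolding g'(3) by (intro subring_mult[OF V subring_power[OF V Vgen(5)]])
  qed
  then have "y \<in> V" unfolding A(2) by (rule subring_sum[OF V])
  then have "f \<in> V" using wy subring_add[OF V] by simp
  moreover have "V \<subseteq> W"
    unfolding V_def by (rule hull_minimal[where S = is_subring, OF _ W(1)]) (use W in \<open>auto simp: x_def z0_def z3_def\<close>)
  ultimately show ?thesis by blast
qed

text \<open>
  By the mutation rule, the column \<open>i\<close> of \<open>\<mu>\<^sub>j T\<close> differs from that of \<open>T\<close> by the sign in row \<open>j\<close> and by \<open>c\<close>
  times the exponents of the monomial \<open>M\<close> to which \<open>P\<^sub>j\<close> reduces modulo \<open>x\<^sub>i\<close>. This is the hypothesis on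
  \<open>u'\<close> and \<open>v'\<close> in \<open>hpoly_quotient_in_subring\<close>. The sign of \<open>b\<^sub>j\<^sub>i\<close> decides which of the two monomials
  contains \<open>x\<^sub>j\<close>; in the second case the form is reversed.
\<close>

lemma second_mutation_in_subring:
  assumes gs: "gseed m n d Q T" and i: "i \<in> {1..n}" and j: "j \<in> {1..n}" and ij: "i \<noteq> j" and b: "bmat T i j \<noteq> 0"
    and W: "is_subring W" "mspan m (xvar T) (exps ({1..m} - {i, j})) \<subseteq> W"
      "xvar T i \<in> W" "xvar T j \<in> W" "xvar (mutate m d i T) i \<in> W" "xvar (mutate m d j T) j \<in> W"
  shows "xvar (mutate m d i (mutate m d j T)) i \<in> W"
proof -
  note g = gseed_basic[OF gs i] and gj = gseed_basic[OF gs j]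
  define T' where "T' = mutate m d j T"
  have gs': "gseed m n d Q T'" unfolding T'_def by (rule gseed_mutate[OF gs j])
  note g' = gseed_basic[OF gs' i]
  define x where "x = xvar T"
  define x' where "x' = xvar T'"
  define z0 where "z0 = xvar (mutate m d i T) i"
  define z3 where "z3 = xvar T' j"
  define z4 where "z4 = xvar (mutate m d i T') i"
  note nz = g(5)[folded x_def] and nz' = g'(5)[folded x'_def]
  have x': "x' j = z3" "x' l = x l" if "l \<noteq> j" for l
    using that unfolding x'_def T'_def x_def z3_def by (simp_all add: mutate_sel)
  have x'j: "x' j = z3" by (simp add: x'_def z3_def)
  have z: "x i * z0 = exchange_poly m d i T" "x j * z3 = exchange_poly m d j T" "x i * z4 = exchange_poly m d i T'"
    using g(12) gj(12) g'(12) x'(2)[OF ij] unfolding z0_def z3_def z4_def x_def x'_def T'_def by (simp_all add: mutate_sel)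
  have ji: "bmat T j i > 0 \<longleftrightarrow> bmat T i j < 0" "bmat T j i < 0 \<longleftrightarrow> bmat T i j > 0"
    using skew_sign[OF g(4) j i] skew_sign[OF g(4) i j] by auto
  obtain \<mu> h where \<mu>: "\<mu> = (\<lambda>l. int (d j) * (if bmat T i j > 0 then neg_exp m d T j l else pos_exp m d T j l))"
    and \<mu>h: "\<mu> \<in> exps ({1..m} - {i, j})" "exchange_poly m d j T = mon m x \<mu> + x i * h"
    "h \<in> mspan m x {e \<in> exps ({1..m} - {j}). 0 \<le> e i}"
    by (rule exchange_affine[OF gs i j ij b, folded x_def]) (rule that; assumption)
  have monW: "mon m x e \<in> W" "inverse (mon m x e) \<in> W" if "e \<in> exps ({1..m} - {i, j})" for e
  proof -
    show "mon m x e \<in> W" using W(2) mspan_mon[OF that] unfolding x_def by blast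
    have "(\<lambda>l. - e l) \<in> exps ({1..m} - {i, j})" using that by (auto simp: exps_def)
    then show "inverse (mon m x e) \<in> W" unfolding mon_uminus[symmetric] using W(2) mspan_mon unfolding x_def by blast
  qed
  have hW: "h \<in> W"
  proof (rule subsetD[OF mspan_gen_subset_subring[OF W(1)] \<mu>h(3)])
    fix e l assume e: "e \<in> {e \<in> exps ({1..m} - {j}). 0 \<le> e i}" "l \<in> {1..m}" "e l \<noteq> 0"
    show "x l \<in> W \<and> (e l < 0 \<longrightarrow> inverse (x l) \<in> W)"
    proof (cases "l = i")
      case True
      then show ?thesis using e W(3) by (auto simp: x_def)
    next
      case False
      then have "(\<lambda>k. if k = l then 1 else 0) \<in> exps ({1..m} - {i, j})" using e by (auto simp: exps_def)
      from monW[OF this] show ?thesis using mon_single[OF e(2), of x 1] by simp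
    qed
  qed
  define c where "c = nat \<bar>beta d T j i\<bar>"
  have \<rho>: "rho T i r \<in> W" if "r \<le> d i" for r
  proof -
    have "l \<in> {1..m} - {i, j}" if "l \<in> Q" for l using that g(2,7) gj(7) by auto
    then have "pexps Q \<subseteq> exps ({1..m} - {i, j})" unfolding pexps_def exps_def by blast
    from mspan_monoD[OF gseed_rho[OF gs i that] this]
    have "rho T i r \<in> mspan m x (exps ({1..m} - {i, j}))" unfolding x_def .
    then show ?thesis using W(2) unfolding x_def by blast
  qed
  have rho': "rho T' i = rho T i" unfolding T'_def using ij by (simp add: mutate_sel)
  \<comment> \<open>removes the variable \<open>j\<close>, the only one in which the seeds \<open>T\<close> and \<open>T'\<close> differ\<close>
  define cut where "cut = (\<lambda>e :: nat \<Rightarrow> int. \<lambda>l. if l = j then 0 else e l)"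
  have split: "mon m y e = y j ^ nat (e j) * mon m x (cut e)"
    if "0 \<le> e j" "\<And>l. l \<noteq> j \<Longrightarrow> y l = x l" "nzero m y" for y e
  proof -
    have "mon m y e = mon m y (\<lambda>l. (if l = j then e j else 0) + cut e l)"
      by (rule arg_cong[of _ _ "mon m y"]) (auto simp: cut_def)
    also have "\<dots> = y j powi e j * mon m y (cut e)" by (simp add: mon_add[OF that(3)] mon_single[OF gj(6)])
    also have "mon m y (cut e) = mon m x (cut e)" by (rule mon_cong) (use that(2) in \<open>auto simp: cut_def split: if_splits\<close>)
    finally show ?thesis using that(1) by (simp add: power_int_def)
  qed
  have beta': "beta d T' j i = - beta d T j i"
    unfolding beta_def T'_def using gseed_dvd[OF gs i gj(6)] by (simp add: mutate_sel dvd_neg_div)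
  \<comment> \<open>as \<open>[a]\<^sub>+ - [- a]\<^sub>+ = a\<close>, only one of the two correction terms of the mutation rule remains\<close>
  have beta'_l: "beta d T' l i = beta d T l i + (if bmat T j i > 0 then int c * pos_part (bmat T l j) else - int c * pos_part (- bmat T l j))"
    if l: "l \<in> {1..m}" "l \<noteq> i" "l \<noteq> j" for l
  proof -
    have "int (d i) * beta d T' l i = bmat T' l i" by (rule gseed_beta[OF gs' i l(1)])
    also have "\<dots> = bmat T l i + pos_part (bmat T j i) * bmat T l j + bmat T j i * pos_part (- bmat T l j)"
      unfolding T'_def using l ij by (simp add: mutate_sel)
    also have "\<dots> = bmat T l i + (if bmat T j i > 0 then bmat T j i * pos_part (bmat T l j) else bmat T j i * pos_part (- bmat T l j))"
      by (auto simp: pos_part_def algebra_simps)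
    also have "bmat T l i = int (d i) * beta d T l i" by (rule gseed_beta[OF gs i l(1), symmetric])
    also have "bmat T j i = int (d i) * beta d T j i" by (rule gseed_beta[OF gs i gj(6), symmetric])
    also have "int (d i) * beta d T l i + (if 0 < int (d i) * beta d T j i then int (d i) * beta d T j i * pos_part (bmat T l j)
        else int (d i) * beta d T j i * pos_part (- bmat T l j)) =
      int (d i) * (beta d T l i + (if bmat T j i > 0 then beta d T j i * pos_part (bmat T l j) else beta d T j i * pos_part (- bmat T l j)))"
      using gseed_beta[OF gs i gj(6)] by (simp add: algebra_simps)
    finally have "beta d T' l i = beta d T l i + (if bmat T j i > 0 then beta d T j i * pos_part (bmat T l j) else beta d T j i * pos_part (- bmat T l j))"
      using g(8) by simp
    moreover have "beta d T j i = (if bmat T j i > 0 then int c else - int c)"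
      using gseed_beta_pos_iff[OF gs i gj(6)] by (auto simp: c_def)
    ultimately show ?thesis by simp
  qed
  \<comment> \<open>so the column changes by \<open>c\<close> times the exponent vector \<open>\<mu>\<close>, up to the sign\<close>
  have \<mu>_l: "\<mu> l = (if bmat T j i > 0 then pos_part (bmat T l j) else pos_part (- bmat T l j))" if "l \<in> {1..m}" for l
  proof -
    have "int (d j) * pos_part (beta d T l j) = pos_part (bmat T l j)"
      "int (d j) * pos_part (- beta d T l j) = pos_part (- bmat T l j)"
      using gseed_beta[OF gs j that] by (simp_all flip: pos_part_scale)
    then show ?thesis using that b ji unfolding \<mu> by (auto simp: pos_exp_def neg_exp_def)
  qed
  have ne: "bmat T j i \<noteq> 0" using b ji by linarith
  have cut_in: "cut (pos_exp m d T i) \<in> exps ({1..m} - {i, j})" "cut (neg_exp m d T i) \<in> exps ({1..m} - {i, j})"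
    "cut (pos_exp m d T' i) \<in> exps ({1..m} - {i, j})" "cut (neg_exp m d T' i) \<in> exps ({1..m} - {i, j})"
    using g(11) g'(11) by (auto simp: cut_def exps_def pos_exp_def neg_exp_def beta_def)
  have nn: "0 \<le> pos_exp m d T i j" "0 \<le> neg_exp m d T i j" "0 \<le> pos_exp m d T' i j" "0 \<le> neg_exp m d T' i j"
    by (auto simp: pos_exp_def neg_exp_def pos_part_nonneg)
  have P: "x i * z0 = hpoly (rho T i) (d i) (x j ^ nat (pos_exp m d T i j) * mon m x (cut (pos_exp m d T i))) (x j ^ nat (neg_exp m d T i j) * mon m x (cut (neg_exp m d T i)))"
    unfolding z exchange_hpoly x_def[symmetric] using split[where y = x and e = "pos_exp m d T i", OF nn(1)] split[where y = x and e = "neg_exp m d T i", OF nn(2)] nz by simp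
  have P': "x i * z4 = hpoly (rho T i) (d i) (z3 ^ nat (pos_exp m d T' i j) * mon m x (cut (pos_exp m d T' i))) (z3 ^ nat (neg_exp m d T' i j) * mon m x (cut (neg_exp m d T' i)))"
    unfolding z exchange_hpoly x'_def[symmetric] rho'
    using split[where y = x' and e = "pos_exp m d T' i", OF nn(3) x'(2) nz']
      split[where y = x' and e = "neg_exp m d T' i", OF nn(4) x'(2) nz'] x'j by simp
  have diff: "pos_exp m d T i l - neg_exp m d T i l = beta d T l i" "pos_exp m d T' i l - neg_exp m d T' i l = beta d T' l i" if "l \<in> {1..m}" for l
    using that by (simp_all add: pos_exp_def neg_exp_def pos_part_diff)
  have wz: "x i \<in> W" "x j \<in> W" "z0 \<in> W" "z3 \<in> W" "x i \<noteq> 0" "mon m x e \<noteq> 0" for e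
    using W g(12) mon_nonzero[OF nz] unfolding x_def z0_def z3_def T'_def by auto
  have rel: "x j * z3 = mon m x \<mu> + x i * h" using z(2) \<mu>h(2) by simp
  note monWs = monW[OF cut_in(1)] monW[OF cut_in(2)] monW[OF cut_in(3)] monW[OF cut_in(4)] monW[OF \<mu>h(1)]
  have "z4 \<in> W"
  proof (cases "bmat T j i > 0")
    case True
    then have bp: "beta d T j i > 0" using gseed_beta_pos_iff[OF gs i gj(6)] by simp
    have e: "nat (pos_exp m d T i j) = c" "nat (neg_exp m d T i j) = 0" "nat (pos_exp m d T' i j) = 0" "nat (neg_exp m d T' i j) = c"
      using bp gj(6) by (simp_all add: pos_exp_def neg_exp_def beta' pos_part_def c_def)
    have "cut (pos_exp m d T' i) l + cut (neg_exp m d T i) l = cut (pos_exp m d T i) l + (cut (neg_exp m d T' i) l + int c * \<mu> l)" for l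
    proof (cases "l \<in> {1..m} - {i, j}")
      case l: True
      then show ?thesis using diff[of l] beta'_l[of l] \<mu>_l[of l] True by (simp add: cut_def)
    next
      case False
      then show ?thesis using cut_in \<mu>h(1) unfolding exps_def by simp
    qed
    then have "mon m x (cut (pos_exp m d T' i)) * mon m x (cut (neg_exp m d T i)) =
        mon m x (cut (pos_exp m d T i)) * mon m x (cut (neg_exp m d T' i)) * mon m x \<mu> ^ c"
      unfolding mon_power mon_add[OF nz, symmetric] by (simp only: add.assoc)
    from hpoly_quotient_in_subring[OF W(1) \<rho> monWs(1,5,7) wz(6) monWs(4) wz(6) monWs(9,10) this wz(3,2,1,4,5) hW rel]
    show ?thesis using P P' e by simp
  next
    case False
    then have bp: "beta d T j i < 0"
      using gseed_beta_pos_iff[OF gs i gj(6)] gseed_beta_0_iff[OF gs i gj(6)] ne by linarith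
    have e: "nat (pos_exp m d T i j) = 0" "nat (neg_exp m d T i j) = c" "nat (pos_exp m d T' i j) = c" "nat (neg_exp m d T' i j) = 0"
      using bp gj(6) by (simp_all add: pos_exp_def neg_exp_def beta' pos_part_def c_def)
    have "cut (neg_exp m d T' i) l + cut (pos_exp m d T i) l = cut (neg_exp m d T i) l + (cut (pos_exp m d T' i) l + int c * \<mu> l)" for l
    proof (cases "l \<in> {1..m} - {i, j}")
      case l: True
      then show ?thesis using diff[of l] beta'_l[of l] \<mu>_l[of l] False by (simp add: cut_def)
    next
      case False
      then show ?thesis using cut_in \<mu>h(1) unfolding exps_def by simp
    qed
    then have *: "mon m x (cut (neg_exp m d T' i)) * mon m x (cut (pos_exp m d T i)) =
        mon m x (cut (neg_exp m d T i)) * mon m x (cut (pos_exp m d T' i)) * mon m x \<mu> ^ c"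
      unfolding mon_power mon_add[OF nz, symmetric] by (simp only: add.assoc)
    have \<rho>': "rho T i (d i - r) \<in> W" if "r \<le> d i" for r using \<rho>[of "d i - r"] by simp
    show ?thesis
    proof (rule hpoly_quotient_in_subring[OF W(1) \<rho>' monWs(3,7,5) wz(6) monWs(2) wz(6) monWs(9,10) * wz(3,2,1,4,5) hW rel])
      show "x i * z0 = hpoly (\<lambda>r. rho T i (d i - r)) (d i) (x j ^ c * mon m x (cut (neg_exp m d T i))) (mon m x (cut (pos_exp m d T i)))"
        unfolding hpoly_rev using P e by simp
      show "x i * z4 = hpoly (\<lambda>r. rho T i (d i - r)) (d i) (mon m x (cut (neg_exp m d T' i))) (z3 ^ c * mon m x (cut (pos_exp m d T' i)))"
        unfolding hpoly_rev using P' e by simp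
    qed
  qed
  then show ?thesis unfolding z4_def T'_def .
qed

lemma exchange_in_subring:
  assumes gs: "gseed m n d Q T" and i: "i \<in> {1..n}" and W: "is_subring W"
    and x: "\<And>l. l \<in> {1..m} \<Longrightarrow> l \<noteq> i \<Longrightarrow> xvar T l \<in> W"
  shows "exchange_poly m d i T \<in> W"
proof (rule subsetD[OF mspan_gen_subset_subring[OF W] exchange_in[OF gs i]])
  fix e l assume e: "e \<in> {e \<in> exps {1..m}. \<forall>j. 0 \<le> e j \<and> (e j \<noteq> 0 \<longrightarrow> j \<in> Q \<or> bmat T j i \<noteq> 0)}"
    and l: "l \<in> {1..m}" "e l \<noteq> 0"
  have "l \<noteq> i" using e l gseed_basic(7,11)[OF gs i] by auto
  moreover have "0 \<le> e l" using e by auto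
  ultimately show "xvar T l \<in> W \<and> (e l < 0 \<longrightarrow> inverse (xvar T l) \<in> W)" using x l by auto
qed

text \<open>
  The three seeds are \<open>\<mu>\<^sub>j T\<close> and its neighbours in the directions \<open>i\<close> and \<open>j\<close>. Hence the intersection is
  generated by \<open>x\<^sub>i\<close>, \<open>x\<^sub>j\<close>, \<open>x\<^sub>j'\<close> and the variable obtained by mutating \<open>\<mu>\<^sub>j T\<close> at \<open>i\<close>. The first three lie
  in \<open>L(\<mu>\<^sub>i T)\<close> by the exchange relations, the last one by \<open>second_mutation_in_subring\<close>.
\<close>

lemma rank_two_laurent:
  assumes gs: "gseed m n d Q T" and i: "i \<in> {1..n}" and j: "j \<in> {1..n}" and ij: "i \<noteq> j" and b: "bmat T i j \<noteq> 0"
    and f: "f \<in> laur m (xvar T)" "f \<in> laur m (xvar (mutate m d j T))" "f \<in> laur m (xvar (mutate m d i (mutate m d j T)))"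
  shows "f \<in> laur m (xvar (mutate m d i T))"
proof -
  note g = gseed_basic[OF gs i] and gj = gseed_basic[OF gs j]
  let ?T0 = "mutate m d i T" and ?T2 = "mutate m d j T"
  let ?W = "laur m (xvar ?T0)"
  have gs0: "gseed m n d Q ?T0" by (rule gseed_mutate[OF gs i])
  have gs2: "gseed m n d Q ?T2" by (rule gseed_mutate[OF gs j])
  have W: "is_subring ?W" by (rule subring_mspan_exps[OF gseed_basic(5)[OF gs0 i]])
  have x0: "xvar ?T0 l = xvar T l" if "l \<noteq> i" for l using that by (simp add: mutate_sel)
  have x2: "xvar ?T2 l = xvar T l" if "l \<noteq> j" for l using that by (simp add: mutate_sel)
  have gen: "xvar ?T0 l \<in> ?W" "inverse (xvar ?T0 l) \<in> ?W" if "l \<in> {1..m}" for l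
    using laur_gen[OF that] laur_inverse_gen[OF that] by auto
  have xi: "xvar T i \<in> ?W"
  proof -
    have "xvar T i = inverse (xvar ?T0 i) * exchange_poly m d i ?T0"
      using mutate_mutate[OF gs i] by (metis mutate_sel(1) fun_upd_same)
    then show ?thesis using subring_mult[OF W gen(2)[OF g(6)] exchange_in_subring[OF gs0 i W gen(1)]] by simp
  qed
  have xT: "xvar T l \<in> ?W" if "l \<in> {1..m}" for l
    using xi gen(1)[OF that] x0[of l] by (cases "l = i") auto
  have z3: "xvar ?T2 j \<in> ?W"
    using subring_mult[OF W gen(2)[OF gj(6)] exchange_in_subring[OF gs j W xT]] x0[of j] ij by (simp add: mutate_sel)
  have R: "mspan m (xvar T) (exps ({1..m} - {i, j})) \<subseteq> ?W"
    by (rule mspan_exps_subset_subring[OF W]) (use gen x0 in \<open>metis DiffE Int_iff insertCI\<close>)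
  have R2: "mspan m (xvar ?T2) (exps ({1..m} - {j, i})) \<subseteq> ?W"
    by (rule mspan_exps_subset_subring[OF W]) (use gen x0 x2 in \<open>metis DiffE Int_iff insertCI\<close>)
  have z4: "xvar (mutate m d i ?T2) i \<in> ?W"
    by (rule second_mutation_in_subring[OF gs i j ij b W R xi xT[OF gj(6)] gen(1)[OF g(6)] z3])
  have T2T: "mutate m d j ?T2 = T" by (rule mutate_mutate[OF gs j])
  have "bmat ?T2 j i \<noteq> 0" using b skew_zero[OF g(4) i j] by (simp add: mutate_sel)
  from rank_two_intersection[OF gs2 j i ij[symmetric] this f(2) _ f(3) W R2 z3]
  show ?thesis using T2T f(1) xi x2[OF ij] xT[OF gj(6)] z4 by simp
qed


section \<open>Coprime exchange polynomials\<close>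

lemma clear_mutation:
  assumes gs: "gseed m n d Q T" and i: "i \<in> {1..n}" and f: "f \<in> laur m (xvar (mutate m d i T))"
  obtains N where "exchange_poly m d i T ^ N * f \<in> laur m (xvar T)"
proof -
  note g = gseed_basic[OF gs i]
  let ?P = "exchange_poly m d i T"
  note L = subring_mspan_exps[OF g(5), of "{1..m}"]
  have P: "?P \<in> laur m (xvar T)" by (rule mspan_monoD[OF exchange_in[OF gs i]]) auto
  have x': "xvar (mutate m d i T) = (\<lambda>k. if k \<in> {i} then inverse (xvar T k) * ?P else xvar T k)"
    by (auto simp: mutate_sel)
  have "\<exists>N. ?P ^ N * f \<in> laur m (xvar T)"
    using f
  proof induction
    case zero
    show ?case by (simp add: mspan.zero)
  next
    case (step f e c)
    then obtain N where N: "?P ^ N * f \<in> laur m (xvar T)" by blast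
    define K where "K = nat \<bar>e i\<bar>"
    have "mon m (xvar (mutate m d i T)) e = mon m (xvar T) (flip {i} e) * ?P powi e i"
      unfolding x' using mon_exchange[of "{i}" m "xvar T" "\<lambda>_. ?P" e] g(6) by simp
    moreover have "?P ^ K * ?P powi e i = ?P ^ nat (int K + e i)"
      by (rule power_mult_powi[OF exchange_nonzero[OF gs i]]) (simp add: K_def)
    ultimately have "?P ^ K * mon m (xvar (mutate m d i T)) e = ?P ^ nat (int K + e i) * mon m (xvar T) (flip {i} e)"
      by simp
    moreover have "?P ^ (N + K) * (f + of_int c * mon m (xvar (mutate m d i T)) e) =
       ?P ^ K * (?P ^ N * f) + ?P ^ N * of_int c * (?P ^ K * mon m (xvar (mutate m d i T)) e)"
      by (simp add: power_add algebra_simps)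
    moreover have "?P ^ K * (?P ^ N * f) + ?P ^ N * of_int c * (?P ^ nat (int K + e i) * mon m (xvar T) (flip {i} e)) \<in> laur m (xvar T)"
      by (intro subring_add[OF L] subring_mult[OF L subring_power[OF L P]] N
          subring_mult[OF L subring_mult[OF L subring_power[OF L P] subring_of_int[OF L]]] mspan_mon flip_exps step(2))
    ultimately show ?case by metis
  qed
  then show thesis using that by blast
qed

text \<open>
  The factors are removed one at a time. The lemma serves both for coprime polynomials and for elements that generate the unit ideal.
\<close>

lemma coprime_powers:
  fixes p q :: "'a::comm_semiring_1"
  assumes pq: "\<And>X. p * X \<in> A \<Longrightarrow> q * X \<in> A \<Longrightarrow> X \<in> A" and p: "\<And>X. X \<in> A \<Longrightarrow> p * X \<in> A" and q: "\<And>X. X \<in> A \<Longrightarrow> q * X \<in> A"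
    and "p ^ N * X \<in> A" "q ^ M * X \<in> A"
  shows "X \<in> A"
proof -
  have p': "X \<in> A \<Longrightarrow> p ^ k * X \<in> A" for k X by (induction k) (auto simp: mult.assoc p)
  have q': "X \<in> A \<Longrightarrow> q ^ k * X \<in> A" for k X by (induction k) (auto simp: mult.assoc q)
  have one: "p ^ N * X \<in> A \<Longrightarrow> q * X \<in> A \<Longrightarrow> X \<in> A" for N X
  proof (induction N)
    case (Suc N)
    have "p ^ N * X \<in> A"
      by (rule pq) (use Suc(2) p'[OF Suc(3), of N] in \<open>simp_all add: mult_ac\<close>)
    then show ?case using Suc by blast
  qed simp
  show ?thesis using assms(4,5)
  proof (induction M)
    case (Suc M)
    have "q ^ M * X \<in> A"
      by (rule one[of N]) (use Suc(3) q'[OF Suc(2), of M] in \<open>simp_all add: mult_ac\<close>)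
    then show ?case using Suc by blast
  qed simp
qed

definition wt :: "nat \<Rightarrow> (nat \<Rightarrow> int) \<Rightarrow> (nat \<Rightarrow> int) \<Rightarrow> int" where
  "wt m \<omega> e = (\<Sum>l\<in>{1..m}. \<omega> l * e l)"

lemma wt_add: "wt m \<omega> (\<lambda>l. e l + e' l) = wt m \<omega> e + wt m \<omega> e'"
  and wt_diff: "wt m \<omega> (\<lambda>l. e l - e' l) = wt m \<omega> e - wt m \<omega> e'"
  and wt_scale: "wt m \<omega> (\<lambda>l. c * e l) = c * wt m \<omega> e"
  by (simp_all add: wt_def sum.distrib sum_subtractf sum_distrib_left algebra_simps)

text \<open>
  Write \<open>q\<close> for the second factor, whose lowest component is the monomial of \<open>\<mu>\<close>. The lowest components of the two
  sides of \<open>q * (p * X) = p * (q * X)\<close> show that the lowest component of \<open>p * X\<close> is \<open>p\<close> times a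
  Laurent polynomial \<open>X0\<close>. Subtracting \<open>X0\<close> from \<open>X\<close> reduces the number of components of \<open>p * X\<close>.
\<close>

lemma graded_coprime:
  fixes x :: "nat \<Rightarrow> 'a::field_char_0"
  assumes lind: "lind m x"
    and p: "p \<in> mspan m x {e \<in> exps {1..m}. wt m \<omega> e = a}" "p \<noteq> 0"
    and \<mu>: "\<mu> \<in> exps {1..m}" and r: "r \<in> mspan m x {e \<in> exps {1..m}. wt m \<omega> \<mu> < wt m \<omega> e}"
    and X: "p * X \<in> laur m x" "(mon m x \<mu> + r) * X \<in> laur m x"
  shows "X \<in> laur m x"
proof -
  note nz = lind_nzero[OF lind]
  note L = subring_mspan_exps[OF nz, of "{1..m}"]
  let ?q = "mon m x \<mu> + r"
  let ?b = "wt m \<omega> \<mu>"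
  have qL: "?q \<in> laur m x" by (intro mspan_add mspan_mon \<mu> mspan_monoD[OF r]) auto
  have main: "p * X = (\<Sum>c\<in>C. g c) \<Longrightarrow> ?q * X \<in> laur m x \<Longrightarrow> X \<in> laur m x"
    if "finite C" "\<And>c. c \<in> C \<Longrightarrow> g c \<in> mspan m x {e \<in> exps {1..m}. wt m \<omega> e = c}" for C :: "int set" and g X
    using that
  proof (induction C arbitrary: X rule: finite_psubset_induct)
    case (psubset C)
    show ?case
    proof (cases "C = {}")
      case True
      then show ?thesis using psubset.prems(1) p(2) mspan.zero by auto
    next
      case False
      define c where "c = Min C"
      have c: "c \<in> C" "\<And>c'. c' \<in> C - {c} \<Longrightarrow> c < c'"
        using False psubset.hyps(1) by (auto simp: c_def less_le)
      define e where "e = (\<Sum>c\<in>C - {c}. g c)"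
      have pX: "p * X = g c + e"
        using psubset.prems(1) sum.remove[OF psubset.hyps(1) c(1), of g] by (simp add: e_def)
      have gc: "g c \<in> mspan m x {e \<in> exps {1..m}. wt m \<omega> e = c}" by (rule psubset.prems(3)[OF c(1)])
      have e: "e \<in> mspan m x {e \<in> exps {1..m}. c < wt m \<omega> e}"
        unfolding e_def
      proof (rule mspan_sum)
        fix c' assume "c' \<in> C - {c}"
        then show "g c' \<in> mspan m x {e \<in> exps {1..m}. c < wt m \<omega> e}"
          using c(2)[of c'] by (intro mspan_monoD[OF psubset.prems(3)[of c']]) auto
      qed
      obtain f f' where f: "?q * X = f + f'" "f \<in> mspan m x {e \<in> exps {1..m}. wt m \<omega> e = c + ?b - a}"
          "f' \<in> mspan m x {e \<in> exps {1..m}. \<not> wt m \<omega> e = c + ?b - a}"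
        using mspan_split[OF psubset.prems(2), where Q = "\<lambda>e. wt m \<omega> e = c + ?b - a"] .
      let ?E = "{e \<in> exps {1..m}. wt m \<omega> e = c + ?b}" and ?F = "{e \<in> exps {1..m}. wt m \<omega> e \<noteq> c + ?b}"
      \<comment> \<open>the components of weight \<open>c + b\<close> on both sides of \<open>q * (p * X) = p * (q * X)\<close>\<close>
      have eq: "mon m x \<mu> * g c = p * f"
      proof (rule lind_direct_eq[OF lind])
        show "mon m x \<mu> * g c + (r * g c + ?q * e) = p * f + p * f'"
        proof -
          have "p * (f + f') = ?q * (g c + e)" using f(1) pX by (metis mult.left_commute)
          then show ?thesis by (simp add: algebra_simps)
        qed
        show "mon m x \<mu> * g c \<in> mspan m x ?E"
          by (rule mspan_mult[OF nz mspan_mon gc, of _ "{\<mu>}"]) (use \<mu> in \<open>auto simp: exps_def wt_add\<close>)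
        show "p * f \<in> mspan m x ?E"
          by (rule mspan_mult[OF nz p(1) f(2)]) (auto simp: exps_def wt_add)
        show "p * f' \<in> mspan m x ?F"
          by (rule mspan_mult[OF nz p(1) f(3)]) (auto simp: exps_def wt_add)
        have 1: "r * g c \<in> mspan m x ?F"
          by (rule mspan_mult[OF nz r gc]) (auto simp: exps_def wt_add)
        have 2: "mon m x \<mu> * e \<in> mspan m x ?F"
          by (rule mspan_mult[OF nz mspan_mon e, of _ "{\<mu>}"]) (use \<mu> in \<open>auto simp: exps_def wt_add\<close>)
        have 3: "r * e \<in> mspan m x ?F"
          by (rule mspan_mult[OF nz r e]) (auto simp: exps_def wt_add)
        show "r * g c + ?q * e \<in> mspan m x ?F"
          unfolding distrib_right by (intro mspan_add 1 2 3)
      qed auto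
      define X0 where "X0 = inverse (mon m x \<mu>) * f"
      have pX0: "p * X0 = g c"
        using eq mon_nonzero[OF nz] by (simp add: X0_def field_simps)
      have "inverse (mon m x \<mu>) \<in> laur m x"
        unfolding mon_uminus[symmetric] by (rule mspan_mon) (use \<mu> in \<open>auto simp: exps_def\<close>)
      then have X0: "X0 \<in> laur m x"
        unfolding X0_def by (intro subring_mult[OF L] mspan_monoD[OF f(2)]) auto
      have "X - X0 \<in> laur m x"
      proof (rule psubset.IH[of "C - {c}"])
        show "C - {c} \<subset> C" using c by blast
        show "p * (X - X0) = sum g (C - {c})" using pX pX0 by (simp add: e_def algebra_simps)
        have "?q * X - ?q * X0 \<in> laur m x" by (intro subring_diff[OF L] psubset.prems(2) subring_mult[OF L qL X0])
        then show "?q * (X - X0) \<in> laur m x" by (simp add: right_diff_distrib)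
        show "g c' \<in> mspan m x {e \<in> exps {1..m}. wt m \<omega> e = c'}" if "c' \<in> C - {c}" for c'
          using psubset.prems(3)[of c'] that by blast
      qed
      then have "X - X0 + X0 \<in> laur m x" using subring_add[OF L] X0 by blast
      then show ?thesis by simp
    qed
  qed
  obtain C g where C: "finite C" "p * X = (\<Sum>c\<in>C. g c)" "\<And>c. g c \<in> mspan m x {e \<in> exps {1..m}. wt m \<omega> e = c}"
    by (rule mspan_decomp[OF X(1), of "wt m \<omega>"]) (rule that; blast)
  show ?thesis by (rule main[OF C(1) C(3) C(2) X(2)])
qed

text \<open>
  The weight of \<open>u / v\<close> is 0 for the column \<open>i\<close> and positive for the column \<open>j\<close>, and the coefficients have
  weight 0. So \<open>P\<^sub>i\<close> is homogeneous, and the lowest component of \<open>P\<^sub>j\<close> is its term \<open>v ^ d\<close>.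
\<close>

lemma exchange_coprime:
  assumes gs: "gseed m n d Q T" and i: "i \<in> {1..n}" and j: "j \<in> {1..n}"
    and \<omega>: "\<And>l. l \<in> Q \<Longrightarrow> \<omega> l = 0" "wt m \<omega> (\<lambda>l. bmat T l i) = 0" "wt m \<omega> (\<lambda>l. bmat T l j) > 0"
    and X: "exchange_poly m d i T * X \<in> laur m (xvar T)" "exchange_poly m d j T * X \<in> laur m (xvar T)"
  shows "X \<in> laur m (xvar T)"
proof -
  note g = gseed_basic[OF gs i] and gj = gseed_basic[OF gs j]
  have wtQ: "wt m \<omega> e = 0" if "e \<in> pexps Q" for e
    unfolding wt_def
  proof (rule sum.neutral, rule ballI)
    fix l show "\<omega> l * e l = 0" using that \<omega>(1)[of l] by (cases "l \<in> Q") (auto simp: pexps_def exps_def)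
  qed
  have diff: "int (d k) * (wt m \<omega> (pos_exp m d T k) - wt m \<omega> (neg_exp m d T k)) = wt m \<omega> (\<lambda>l. bmat T l k)" if "k \<in> {1..n}" for k
    unfolding wt_diff[symmetric] wt_scale[symmetric]
    unfolding wt_def by (rule sum.cong) (auto simp: pos_exp_def neg_exp_def pos_part_diff gseed_beta[OF gs that])
  have ui: "wt m \<omega> (pos_exp m d T i) = wt m \<omega> (neg_exp m d T i)" using diff[OF i] \<omega>(2) g(8) by simp
  have uj: "wt m \<omega> (pos_exp m d T j) > wt m \<omega> (neg_exp m d T j)"
    using diff[OF j] \<omega>(3) gj(8) by (smt (verit) mult_nonneg_nonpos of_nat_0_le_iff)
  have exps: "pos_exp m d T k \<in> exps {1..m}" "neg_exp m d T k \<in> exps {1..m}" for k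
    by (auto simp: pos_exp_def neg_exp_def exps_def)
  have Q: "Q \<subseteq> {1..m}" using g(2) by auto
  have in_exps: "(\<lambda>l. a l + (int r * pos_exp m d T k l + (int (d k) - int r) * neg_exp m d T k l)) \<in> exps {1..m}" if "a \<in> pexps Q" for a k and r :: nat
    using that exps[of k] Q unfolding pexps_def exps_def by auto
  have wt_term: "wt m \<omega> (\<lambda>l. a l + (int r * pos_exp m d T k l + (int (d k) - int r) * neg_exp m d T k l)) =
     int (d k) * wt m \<omega> (neg_exp m d T k) + int r * (wt m \<omega> (pos_exp m d T k) - wt m \<omega> (neg_exp m d T k))" if "a \<in> pexps Q" for a k and r :: nat
    unfolding wt_add wt_scale wtQ[OF that] by (simp add: algebra_simps)
  have 1: "exchange_poly m d i T \<in> mspan m (xvar T) {e \<in> exps {1..m}. wt m \<omega> e = int (d i) * wt m \<omega> (neg_exp m d T i)}"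
    unfolding exchange_hpoly
    by (rule hpoly_in_mspan[OF g(5) gseed_rho[OF gs i]]) (use in_exps wt_term ui in auto)
  define \<mu> where "\<mu> = (\<lambda>l. int (d j) * neg_exp m d T j l)"
  have \<mu>: "\<mu> \<in> exps {1..m}" using exps(2)[of j] by (auto simp: \<mu>_def exps_def)
  have wt_\<mu>: "wt m \<omega> \<mu> = int (d j) * wt m \<omega> (neg_exp m d T j)" unfolding \<mu>_def wt_scale ..
  define r where "r = (\<Sum>r\<in>{1..d j}. rho T j r * (mon m (xvar T) (pos_exp m d T j) ^ r * mon m (xvar T) (neg_exp m d T j) ^ (d j - r)))"
  have 2: "r \<in> mspan m (xvar T) {e \<in> exps {1..m}. wt m \<omega> \<mu> < wt m \<omega> e}"
    unfolding r_def
  proof (rule hpoly_rest_in_mspan[OF g(5) gseed_rho[OF gs j]])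
    fix a and r :: nat assume a: "a \<in> pexps Q" and "1 \<le> r"
    then have "0 < int r * (wt m \<omega> (pos_exp m d T j) - wt m \<omega> (neg_exp m d T j))" using uj by simp
    then show "(\<lambda>l. a l + (int r * pos_exp m d T j l + (int (d j) - int r) * neg_exp m d T j l)) \<in> {e \<in> exps {1..m}. wt m \<omega> \<mu> < wt m \<omega> e}"
      using in_exps[OF a] wt_term[OF a] by (simp add: wt_\<mu>)
  qed
  have 3: "exchange_poly m d j T = mon m (xvar T) \<mu> + r"
    unfolding exchange_hpoly hpoly_extract[of "rho T j", OF gj(9)] r_def \<mu>_def mon_power[symmetric] ..
  show ?thesis
    by (rule graded_coprime[OF g(3) 1 exchange_nonzero[OF gs i] \<mu> 2 X(1) X(2)[unfolded 3]])
qed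

section \<open>The Laurent phenomenon for exchange matrices of full rank\<close>

definition full_rank :: "nat \<Rightarrow> nat \<Rightarrow> nat set \<Rightarrow> 'a seed \<Rightarrow> bool" where
  "full_rank m n Q T \<longleftrightarrow> (\<forall>w :: nat \<Rightarrow> int. (\<forall>k\<in>{1..m} - Q. (\<Sum>l\<in>{1..n}. bmat T k l * w l) = 0) \<longrightarrow> (\<forall>l\<in>{1..n}. w l = 0))"

text \<open>
  Row \<open>i\<close> and the vanishing of \<open>b\<^sub>i\<^sub>i\<close> imply that the relation \<open>w\<close> between the new columns is orthogonal to the
  old row \<open>i\<close>; changing its entry \<open>i\<close> turns it into a relation between the old columns.
\<close>

lemma full_rank_mutate:
  assumes gs: "gseed m n d Q T" and i: "i \<in> {1..n}" and fr: "full_rank m n Q T"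
  shows "full_rank m n Q (mutate m d i T)"
  unfolding full_rank_def
proof (intro allI impI)
  note g = gseed_basic[OF gs i]
  fix w :: "nat \<Rightarrow> int"
  let ?T = "mutate m d i T"
  let ?b = "bmat T"
  assume w: "\<forall>k\<in>{1..m} - Q. (\<Sum>l\<in>{1..n}. bmat ?T k l * w l) = 0"
  let ?I = "{1..n} - {i}"
  have rem: "(\<Sum>l\<in>{1..n}. h l) = h i + (\<Sum>l\<in>?I. h l)" for h :: "nat \<Rightarrow> int"
    using i by (intro sum.remove) auto
  have row_i: "(\<Sum>l\<in>?I. ?b i l * w l) = 0"
  proof -
    have "(\<Sum>l\<in>{1..n}. bmat ?T i l * w l) = - (\<Sum>l\<in>{1..n}. ?b i l * w l)" by (simp add: mutate_sel sum_negf)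
    then have "(\<Sum>l\<in>{1..n}. ?b i l * w l) = 0" using w g(6,7) by simp
    then show ?thesis using rem[of "\<lambda>l. ?b i l * w l"] g(11) by simp
  qed
  define s where "s = (\<Sum>l\<in>?I. pos_part (?b i l) * w l)"
  define w' where "w' = w(i := s - w i)"
  have "(\<Sum>l\<in>{1..n}. ?b k l * w' l) = 0" if k: "k \<in> {1..m} - Q" for k
  proof (cases "k = i")
    case True
    have "(\<Sum>l\<in>?I. ?b i l * w' l) = (\<Sum>l\<in>?I. ?b i l * w l)" by (rule sum.cong) (auto simp: w'_def)
    then show ?thesis using True row_i g(11) rem[of "\<lambda>l. ?b i l * w' l"] by simp
  next
    case False
    have "0 = (\<Sum>l\<in>{1..n}. bmat ?T k l * w l)" using w k by simp
    also have "\<dots> = - ?b k i * w i + (\<Sum>l\<in>?I. bmat ?T k l * w l)" unfolding rem by (simp add: mutate_sel)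
    also have "(\<Sum>l\<in>?I. bmat ?T k l * w l) =
        (\<Sum>l\<in>?I. ?b k l * w l + ?b k i * (pos_part (?b i l) * w l) + pos_part (- ?b k i) * (?b i l * w l))"
      by (rule sum.cong) (use False in \<open>auto simp: mutate_sel algebra_simps\<close>)
    also have "\<dots> = (\<Sum>l\<in>?I. ?b k l * w l) + ?b k i * s"
      unfolding sum.distrib sum_distrib_left[symmetric] row_i s_def by simp
    also have "(\<Sum>l\<in>?I. ?b k l * w l) = (\<Sum>l\<in>?I. ?b k l * w' l)" by (rule sum.cong) (auto simp: w'_def)
    finally show ?thesis unfolding rem by (simp add: w'_def algebra_simps)
  qed
  then have w'0: "\<forall>l\<in>{1..n}. w' l = 0" using fr unfolding full_rank_def by blast
  have w0: "w l = 0" if "l \<in> ?I" for l using w'0[rule_format, of l] that by (simp add: w'_def)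
  then have "s = 0" unfolding s_def by simp
  then have "w i = 0" using w'0[rule_format, OF i] by (simp add: w'_def)
  then show "\<forall>l\<in>{1..n}. w l = 0" using w0 by blast
qed

text \<open>
  Two independent columns have a nonzero 2x2 minor, say in the rows \<open>k\<close> and \<open>l\<close>. The weight supported
  in these rows that annihilates the column \<open>i\<close> evaluates, up to the sign, to the minor on the column \<open>j\<close>.
\<close>

lemma full_rank_weight:
  assumes fr: "full_rank m n Q T" and i: "i \<in> {1..n}" and j: "j \<in> {1..n}" and ij: "i \<noteq> j"
  obtains \<omega> where "\<And>l. l \<in> Q \<Longrightarrow> \<omega> l = 0" "wt m \<omega> (\<lambda>l. bmat T l i) = 0" "wt m \<omega> (\<lambda>l. bmat T l j) > 0"
proof -
  have two: "(\<Sum>l\<in>{1..n}. b l * (if l = i then u else if l = j then v else 0)) = b i * u + b j * v" for b :: "nat \<Rightarrow> int" and u v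
  proof -
    have "(\<Sum>l\<in>{1..n}. b l * (if l = i then u else if l = j then v else 0)) =
        (\<Sum>l\<in>{1..n}. (if l = i then b i * u else 0) + (if l = j then b j * v else 0))"
      by (rule sum.cong) (use ij in auto)
    then show ?thesis using i j by (simp add: sum.distrib)
  qed
  have nz: "\<exists>k\<in>{1..m} - Q. bmat T k i * u + bmat T k j * v \<noteq> 0" if "u \<noteq> 0 \<or> v \<noteq> 0" for u v
  proof (rule ccontr)
    assume "\<not> ?thesis"
    then have 0: "\<forall>k\<in>{1..m} - Q. (\<Sum>l\<in>{1..n}. bmat T k l * (if l = i then u else if l = j then v else 0)) = 0"
      unfolding two by blast
    have "\<forall>l\<in>{1..n}. (if l = i then u else if l = j then v else 0) = 0"
      by (rule fr[unfolded full_rank_def, THEN spec, THEN mp, OF 0])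
    from this[rule_format, OF i] this[rule_format, OF j] show False using that ij by simp
  qed
  obtain k where k: "k \<in> {1..m} - Q" "bmat T k i \<noteq> 0" using nz[of 1 0] by auto
  obtain l where l: "l \<in> {1..m} - Q" "bmat T l i * bmat T k j + bmat T l j * (- bmat T k i) \<noteq> 0"
    using nz[of "bmat T k j" "- bmat T k i"] k(2) by auto
  define \<omega>0 where "\<omega>0 = (\<lambda>t. (if t = k then bmat T l i else 0) - (if t = l then bmat T k i else 0))"
  have wt0: "wt m \<omega>0 e = bmat T l i * e k - bmat T k i * e l" for e
  proof -
    have "wt m \<omega>0 e = (\<Sum>t\<in>{1..m}. (if t = k then bmat T l i * e k else 0) - (if t = l then bmat T k i * e l else 0))"
      unfolding wt_def \<omega>0_def by (rule sum.cong) (auto simp: algebra_simps)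
    then show ?thesis using k l by (simp add: sum_subtractf)
  qed
  define \<sigma> where "\<sigma> = sgn (wt m \<omega>0 (\<lambda>l. bmat T l j))"
  have scale: "wt m (\<lambda>t. \<sigma> * \<omega>0 t) e = \<sigma> * wt m \<omega>0 e" for e
    by (simp add: wt_def sum_distrib_left mult.assoc)
  show thesis
  proof (rule that[of "\<lambda>t. \<sigma> * \<omega>0 t"])
    show "\<sigma> * \<omega>0 t = 0" if "t \<in> Q" for t using that k l by (auto simp: \<omega>0_def)
    show "wt m (\<lambda>t. \<sigma> * \<omega>0 t) (\<lambda>l. bmat T l i) = 0" unfolding scale wt0 by simp
    have "wt m \<omega>0 (\<lambda>l. bmat T l j) \<noteq> 0" unfolding wt0 using l(2) by (simp add: algebra_simps)
    then show "wt m (\<lambda>t. \<sigma> * \<omega>0 t) (\<lambda>l. bmat T l j) > 0" unfolding scale by (simp add: \<sigma>_def sgn_if)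
  qed
qed

lemma commuting_mutations:
  assumes gs: "gseed m n d Q T" and i: "i \<in> {1..n}" and j: "j \<in> {1..n}" and ij: "i \<noteq> j" and b: "bmat T i j = 0"
  shows "xvar (mutate m d i (mutate m d j (mutate m d i T))) = xvar (mutate m d j T)"
proof -
  note g = gseed_basic[OF gs i] and gj = gseed_basic[OF gs j]
  have ji: "bmat T j i = 0" using skew_zero[OF g(4) i j] b by simp
  let ?T1 = "mutate m d i T"
  let ?T2 = "mutate m d j ?T1"
  have 1: "exchange_poly m d j ?T1 = exchange_poly m d j T"
    by (rule exchange_cong) (use ij b in \<open>auto simp: mutate_sel\<close>)
  have "exchange_poly m d i ?T2 = exchange_poly m d i ?T1"
    by (rule exchange_cong) (use ij ji in \<open>auto simp: mutate_sel\<close>)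
  then have 2: "exchange_poly m d i ?T2 = exchange_poly m d i T" using exchange_mutate_self[OF gs i] by simp
  show ?thesis
    using ij exchange_nonzero[OF gs i] g(12)
    by (auto simp: fun_eq_iff mutate_sel(1)[of m d i ?T2] 2 mutate_sel(1)[of m d j ?T1] 1 mutate_sel(1)[of m d _ T])
qed

text \<open>
  Induction on the length of the path, for all initial seeds at once. The seed \<open>\<mu>\<^sub>i \<mu>\<^sub>j \<mu>\<^sub>i T\<close> is one step
  further away from \<open>T\<close>, but it leads to the end of the path in as many steps as \<open>\<mu>\<^sub>i T\<close> does.
\<close>

theorem laurent_phenomenon_full_rank:
  assumes "gseed m n d Q T" "full_rank m n Q T" "set is \<subseteq> {1..n}" "k \<in> {1..m}"
  shows "xvar (fold (mutate m d) is T) k \<in> laur m (xvar T)"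
  using assms(1-3)
proof (induction "length is" arbitrary: "is" T rule: less_induct)
  case less
  note gs = less.prems(1)
  show ?case
  proof (cases "is")
    case Nil
    then show ?thesis using laur_gen[OF assms(4)] by simp
  next
    case (Cons i js)
    then have i: "i \<in> {1..n}" using less.prems(3) by simp
    let ?T1 = "mutate m d i T"
    have gs1: "gseed m n d Q ?T1" and fr1: "full_rank m n Q ?T1"
      by (rule gseed_mutate[OF gs i]) (rule full_rank_mutate[OF gs i less.prems(2)])
    define X where "X = xvar (fold (mutate m d) js ?T1) k"
    have X1: "X \<in> laur m (xvar ?T1)" unfolding X_def
      by (rule less.hyps) (use Cons less.prems gs1 fr1 in auto)
    have "X \<in> laur m (xvar T)"
    proof (cases js)
      case Nil
      note L = subring_mspan_exps[OF gseed_basic(5)[OF gs i], of "{1..m}"]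
      have "inverse (xvar T i) * exchange_poly m d i T \<in> laur m (xvar T)"
        by (intro subring_mult[OF L] laur_inverse_gen gseed_basic(6)[OF gs i] exchange_in_subring[OF gs i L] laur_gen)
      then show ?thesis unfolding X_def Nil using laur_gen[OF assms(4), of "xvar T"] by (simp add: mutate_sel)
    next
      case js: (Cons j rest)
      then have j: "j \<in> {1..n}" using less.prems(3) Cons by simp
      let ?T2 = "mutate m d j ?T1"
      have gs2: "gseed m n d Q ?T2" and fr2: "full_rank m n Q ?T2"
        by (rule gseed_mutate[OF gs1 j]) (rule full_rank_mutate[OF gs1 j fr1])
      have XE: "X = xvar (fold (mutate m d) rest ?T2) k" unfolding X_def js by simp
      have X2: "X \<in> laur m (xvar ?T2)" unfolding XE
        by (rule less.hyps) (use Cons js less.prems gs2 fr2 in auto)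
      show ?thesis
      proof (cases "i = j")
        case True
        then show ?thesis using X2 mutate_mutate[OF gs i] by simp
      next
        case False
        let ?T3 = "mutate m d i ?T2"
        have gs3: "gseed m n d Q ?T3" and fr3: "full_rank m n Q ?T3"
          by (rule gseed_mutate[OF gs2 i]) (rule full_rank_mutate[OF gs2 i fr2])
        have "X = xvar (fold (mutate m d) (i # rest) ?T3) k"
          unfolding XE using mutate_mutate[OF gs2 i] by simp
        then have X3: "X \<in> laur m (xvar ?T3)"
          using less.hyps[of "i # rest" ?T3] Cons js less.prems gs3 fr3 by simp
        show ?thesis
        proof (cases "bmat T i j = 0")
          case True
          have X3': "X \<in> laur m (xvar (mutate m d j T))"
            using X3 commuting_mutations[OF gs i j False True] by simp
          note L = subring_mspan_exps[OF gseed_basic(5)[OF gs i], of "{1..m}"]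
          obtain N where N: "exchange_poly m d i T ^ N * X \<in> laur m (xvar T)" by (rule clear_mutation[OF gs i X1])
          obtain M where M: "exchange_poly m d j T ^ M * X \<in> laur m (xvar T)" by (rule clear_mutation[OF gs j X3'])
          obtain \<omega> where \<omega>: "\<And>l. l \<in> Q \<Longrightarrow> \<omega> l = 0" "wt m \<omega> (\<lambda>l. bmat T l i) = 0" "wt m \<omega> (\<lambda>l. bmat T l j) > 0"
            by (rule full_rank_weight[OF less.prems(2) i j False]) (rule that; blast)
          show ?thesis
          proof (rule coprime_powers[OF _ _ _ N M])
            show "Z \<in> laur m (xvar T)" if "exchange_poly m d i T * Z \<in> laur m (xvar T)" "exchange_poly m d j T * Z \<in> laur m (xvar T)" for Z
              by (rule exchange_coprime[OF gs i j \<omega> that])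
          qed (intro subring_mult[OF L] exchange_in_subring[OF gs i L] exchange_in_subring[OF gs j L] laur_gen; assumption)+
        next
          case b: False
          have "bmat ?T1 i j \<noteq> 0" using b by (simp add: mutate_sel)
          from rank_two_laurent[OF gs1 i j False this X1 X2 X3] show ?thesis using mutate_mutate[OF gs i] by simp
        qed
      qed
    qed
    then show ?thesis unfolding X_def Cons by simp
  qed
qed

section \<open>Specialization of a generic seed\<close>

instance fract :: ("{idom, ring_char_0}") field_char_0
proof
  show "inj (of_nat :: nat \<Rightarrow> 'a fract)"
    by (rule injI) (simp add: of_nat_fract eq_fract)
qed

text \<open>
  The fraction field of the ring of Laurent polynomials in countably many variables, which is the group
  ring of the finitely supported integer vectors.
\<close>

type_synonym generic_field = "((nat \<Rightarrow>\<^sub>0 int) \<Rightarrow>\<^sub>0 int) fract"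

definition gmon :: "(nat \<Rightarrow>\<^sub>0 int) \<Rightarrow> generic_field" where
  "gmon a = Fract (Poly_Mapping.single a 1) 1"

definition gvar :: "nat \<Rightarrow> generic_field" where
  "gvar j = gmon (Poly_Mapping.single j 1)"

lemma gmon_add: "gmon (a + b) = gmon a * gmon b"
  by (simp add: gmon_def mult_single)

lemma gmon_0: "gmon 0 = 1"
  by (simp add: gmon_def One_fract_def)

lemma gmon_uminus: "gmon (- a) = inverse (gmon a)"
proof -
  have "gmon a * gmon (- a) = 1" unfolding gmon_add[symmetric] by (simp add: gmon_0)
  then show ?thesis by (metis inverse_unique)
qed

lemma gvar_power: "gvar j ^ k = gmon (Poly_Mapping.single j (int k))"
proof (induction k)
  case (Suc k)
  have "Poly_Mapping.single j (int (Suc k)) = Poly_Mapping.single j 1 + Poly_Mapping.single j (int k)"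
    by (simp add: single_add[symmetric])
  then show ?case using Suc by (simp add: gmon_add gvar_def)
qed (simp add: gmon_0)

lemma gvar_powi: "gvar j powi a = gmon (Poly_Mapping.single j a)"
proof (cases "0 \<le> a")
  case True
  then show ?thesis by (simp add: power_int_def gvar_power)
next
  case False
  then have "gvar j powi a = inverse (gmon (Poly_Mapping.single j (- a)))"
    by (simp add: power_int_def power_inverse gvar_power)
  also have "\<dots> = gmon (- Poly_Mapping.single j (- a))" by (simp only: gmon_uminus)
  also have "- Poly_Mapping.single j (- a) = Poly_Mapping.single j a" by (simp add: single_uminus[symmetric])
  finally show ?thesis .
qed

definition exp_map :: "nat \<Rightarrow> (nat \<Rightarrow> 'b::comm_monoid_add) \<Rightarrow> nat \<Rightarrow>\<^sub>0 'b" where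
  "exp_map m e = (\<Sum>j\<in>{1..m}. Poly_Mapping.single j (e j))"

lemma lookup_exp_map: "Poly_Mapping.lookup (exp_map m e) j = (if j \<in> {1..m} then e j else 0)"
proof -
  have "Poly_Mapping.lookup (exp_map m e) j = (\<Sum>i\<in>{1..m}. if i = j then e i else 0)"
    unfolding exp_map_def lookup_sum by (rule sum.cong) (auto simp: lookup_single when_def)
  then show ?thesis by simp
qed

lemma mon_gvar: "mon m gvar e = gmon (exp_map m e)"
proof -
  have "(\<Prod>j\<in>A. gmon (Poly_Mapping.single j (e j))) = gmon (\<Sum>j\<in>A. Poly_Mapping.single j (e j))" for A
    by (induction A rule: infinite_finite_induct) (simp_all add: gmon_0 gmon_add)
  then show ?thesis unfolding mon_def gvar_powi exp_map_def .
qed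

lemma exp_map_inj: "e \<in> exps {1..m} \<Longrightarrow> e' \<in> exps {1..m} \<Longrightarrow> exp_map m e = exp_map m e' \<Longrightarrow> e = e'"
proof
  fix j assume *: "e \<in> exps {1..m}" "e' \<in> exps {1..m}" "exp_map m e = exp_map m e'"
  have "Poly_Mapping.lookup (exp_map m e) j = Poly_Mapping.lookup (exp_map m e') j" using *(3) by simp
  then show "e j = e' j" unfolding lookup_exp_map using *(1,2) by (cases "j \<in> {1..m}") (auto simp: exps_def)
qed

lemma lind_gvar: "lind m gvar"
  unfolding lind_def
proof (intro allI impI ballI)
  fix B :: "(nat \<Rightarrow> int) set" and c :: "(nat \<Rightarrow> int) \<Rightarrow> int" and e0
  assume B: "finite B" "B \<subseteq> exps {1..m}" and 0: "(\<Sum>e\<in>B. of_int (c e) * mon m gvar e) = 0" and e0: "e0 \<in> B"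
  let ?p = "\<Sum>e\<in>B. Poly_Mapping.single (exp_map m e) (c e)"
  have of_int_Fract: "(of_int k :: generic_field) = Fract (Poly_Mapping.single 0 k) 1" for k
  proof -
    have "(of_int k :: generic_field) = Fract (of_int k) 1"
      by (cases k rule: int_cases2) (simp_all add: of_nat_fract)
    also have "(of_int k :: (nat \<Rightarrow>\<^sub>0 int) \<Rightarrow>\<^sub>0 int) = Poly_Mapping.single 0 (of_int k)" by (rule single_of_int[symmetric])
    finally show ?thesis by simp
  qed
  have summand: "of_int (c e) * mon m gvar e = Fract (Poly_Mapping.single (exp_map m e) (c e)) 1" for e
    unfolding mon_gvar gmon_def of_int_Fract by (simp add: mult_single)
  have sum: "(\<Sum>e\<in>A. Fract (Poly_Mapping.single (exp_map m e) (c e)) 1) = Fract (\<Sum>e\<in>A. Poly_Mapping.single (exp_map m e) (c e)) 1" for A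
    by (induction A rule: infinite_finite_induct) (simp_all add: Zero_fract_def)
  have "?p = 0" using 0 unfolding summand sum by (simp add: Zero_fract_def eq_fract)
  then have "0 = Poly_Mapping.lookup ?p (exp_map m e0)" by simp
  also have "\<dots> = (\<Sum>e\<in>B. if e = e0 then c e else 0)"
    unfolding lookup_sum
  proof (rule sum.cong[OF refl])
    fix e assume "e \<in> B"
    then have "exp_map m e = exp_map m e0 \<longleftrightarrow> e = e0" using exp_map_inj[of e m e0] B(2) e0 by blast
    then show "Poly_Mapping.lookup (Poly_Mapping.single (exp_map m e) (c e)) (exp_map m e0) = (if e = e0 then c e else 0)"
      by (simp add: lookup_single when_def)
  qed
  also have "\<dots> = c e0" using B(1) e0 by simp
  finally show "c e0 = 0" by simp
qed

text \<open>
  The graph of the ring homomorphism that sends the variables \<open>x\<close> to the values \<open>y\<close>, defined on the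
  Laurent polynomials in \<open>x\<close>. It is the graph of a function if \<open>x\<close> is independent
  (\<open>specializes_unique\<close>), whereas \<open>y\<close> may be arbitrary.
\<close>

inductive_set specializes :: "nat \<Rightarrow> (nat \<Rightarrow> 'b::field_char_0) \<Rightarrow> (nat \<Rightarrow> 'a::field_char_0) \<Rightarrow> ('b \<times> 'a) set"
  for m x y where
  zero: "(0, 0) \<in> specializes m x y"
| step: "(f, g) \<in> specializes m x y \<Longrightarrow> e \<in> exps {1..m} \<Longrightarrow>
    (f + of_int c * mon m x e, g + of_int c * mon m y e) \<in> specializes m x y"

lemma specializes_add:
  "(f, g) \<in> specializes m x y \<Longrightarrow> (f', g') \<in> specializes m x y \<Longrightarrow> (f + f', g + g') \<in> specializes m x y"
proof -
  assume f: "(f, g) \<in> specializes m x y" and "(f', g') \<in> specializes m x y"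
  from this(2) show ?thesis
    by induction (simp_all add: f specializes.step flip: add.assoc)
qed

lemma specializes_mon: "e \<in> exps {1..m} \<Longrightarrow> (mon m x e, mon m y e) \<in> specializes m x y"
  using specializes.step[OF specializes.zero, of e m 1 x y] by simp

lemma specializes_1: "(1, 1) \<in> specializes m x y"
  using specializes_mon[of "\<lambda>_. 0" m x y] by (simp add: mon_zero exps_def)

lemma specializes_mult:
  assumes "nzero m x" "nzero m y" "(f, g) \<in> specializes m x y" "(f', g') \<in> specializes m x y"
  shows "(f * f', g * g') \<in> specializes m x y"
  using assms(3)
proof induction
  case (step f g e c)
  have "(of_int c * mon m x e * f', of_int c * mon m y e * g') \<in> specializes m x y"
    using assms(4)
  proof induction
    case (step f' g' e' c')
    have "(\<lambda>j. e j + e' j) \<in> exps {1..m}" using \<open>e \<in> _\<close> \<open>e' \<in> _\<close> by (auto simp: exps_def)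
    from specializes.step[OF step(3) this, of "c * c'"] show ?case
      by (simp add: mon_add[OF assms(1)] mon_add[OF assms(2)] distrib_left mult_ac)
  qed (simp add: specializes.zero)
  then show ?case using specializes_add[OF step(3)] by (simp add: distrib_right)
qed (simp add: specializes.zero)

lemma specializes_power:
  assumes "nzero m x" "nzero m y" "(f, g) \<in> specializes m x y"
  shows "(f ^ k, g ^ k) \<in> specializes m x y"
  by (induction k) (simp_all add: specializes_1 specializes_mult assms)

lemma specializes_sum:
  assumes "\<And>a. a \<in> A \<Longrightarrow> (f a, g a) \<in> specializes m x y"
  shows "(sum f A, sum g A) \<in> specializes m x y"
  using assms by (induction A rule: infinite_finite_induct) (simp_all add: specializes.zero specializes_add)

lemma specializes_prod:
  assumes "nzero m x" "nzero m y" "\<And>a. a \<in> A \<Longrightarrow> (f a, g a) \<in> specializes m x y"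
  shows "(prod f A, prod g A) \<in> specializes m x y"
  using assms(3)
  by (induction A rule: infinite_finite_induct) (simp_all add: specializes_1 specializes_mult assms(1,2))

lemma specializes_laur: "(f, g) \<in> specializes m x y \<Longrightarrow> g \<in> laur m y"
  by (induction rule: specializes.induct) (auto intro: mspan.intros)

lemma specializes_total:
  assumes "f \<in> mspan m x E" "E \<subseteq> exps {1..m}"
  obtains g where "(f, g) \<in> specializes m x y" "g \<in> mspan m y E"
proof -
  have "\<exists>g. (f, g) \<in> specializes m x y \<and> g \<in> mspan m y E"
    using assms(1)
  proof induction
    case (step f e c)
    then obtain g where "(f, g) \<in> specializes m x y" "g \<in> mspan m y E" by blast
    then show ?case using specializes.step[of f g m x y e c] mspan.step[of g m y E e c] step(2) assms(2) by blast
  qed (auto intro: specializes.zero mspan.zero)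
  then show thesis using that by blast
qed

lemma specializes_lift:
  assumes "g \<in> mspan m y E" "E \<subseteq> exps {1..m}"
  obtains f where "(f, g) \<in> specializes m x y" "f \<in> mspan m x E"
proof -
  have "\<exists>f. (f, g) \<in> specializes m x y \<and> f \<in> mspan m x E"
    using assms(1)
  proof induction
    case (step g e c)
    then obtain f where "(f, g) \<in> specializes m x y" "f \<in> mspan m x E" by blast
    then show ?case using specializes.step[of f g m x y e c] mspan.step[of f m x E e c] step(2) assms(2) by blast
  qed (auto intro: specializes.zero mspan.zero)
  then show thesis using that by blast
qed

lemma specializes_normal:
  assumes "(f, g) \<in> specializes m x y"
  obtains B c where "finite B" "B \<subseteq> exps {1..m}" "f = (\<Sum>e\<in>B. of_int (c e) * mon m x e)"
    "g = (\<Sum>e\<in>B. of_int (c e) * mon m y e)"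
proof -
  have "\<exists>B c. finite B \<and> B \<subseteq> exps {1..m} \<and> f = (\<Sum>e\<in>B. of_int (c e) * mon m x e) \<and>
    g = (\<Sum>e\<in>B. of_int (c e) * mon m y e)"
    using assms
  proof induction
    case zero
    show ?case by (rule exI[of _ "{}"]) simp
  next
    case (step f g e k)
    then obtain B c where *: "finite B" "B \<subseteq> exps {1..m}" "f = (\<Sum>e\<in>B. of_int (c e) * mon m x e)"
      "g = (\<Sum>e\<in>B. of_int (c e) * mon m y e)" by blast
    define c0 where "c0 = (\<lambda>a. if a \<in> B then c a else 0)"
    let ?B = "insert e B" and ?c = "\<lambda>a. c0 a + (if a = e then k else 0)"
    have sum: "(\<Sum>a\<in>?B. of_int (?c a) * h a) = (\<Sum>a\<in>B. of_int (c a) * h a) + of_int k * h e" for h :: "(nat \<Rightarrow> int) \<Rightarrow> 'c::field_char_0"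
    proof -
      have "(\<Sum>a\<in>?B. of_int (?c a) * h a) = (\<Sum>a\<in>?B. of_int (c0 a) * h a) + (\<Sum>a\<in>?B. if a = e then of_int k * h a else 0)"
        unfolding sum.distrib[symmetric] by (rule sum.cong) (auto simp: distrib_right)
      also have "(\<Sum>a\<in>?B. of_int (c0 a) * h a) = (\<Sum>a\<in>B. of_int (c a) * h a)"
        using *(1) by (intro sum.mono_neutral_cong_right) (auto simp: c0_def)
      also have "(\<Sum>a\<in>?B. if a = e then of_int k * h a else 0) = of_int k * h e" using *(1) by simp
      finally show ?thesis .
    qed
    show ?case
    proof (intro exI conjI)
      show "finite ?B" "?B \<subseteq> exps {1..m}" using * step(2) by auto
      show "f + of_int k * mon m x e = (\<Sum>a\<in>?B. of_int (?c a) * mon m x a)" by (simp only: sum *(3))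
      show "g + of_int k * mon m y e = (\<Sum>a\<in>?B. of_int (?c a) * mon m y a)" by (simp only: sum *(4))
    qed
  qed
  then show thesis using that by blast
qed

lemma specializes_unique:
  assumes "lind m x" "(f, g) \<in> specializes m x y" "(f, g') \<in> specializes m x y"
  shows "g = g'"
proof -
  note nz = lind_nzero[OF assms(1)]
  have "(- f', - h) \<in> specializes m x y" if "(f', h) \<in> specializes m x y" for f' h
    using that
  proof induction
    case (step f g e c)
    then show ?case using specializes.step[of "- f" "- g" m x y e "- c"] by simp
  qed (simp add: specializes.zero)
  from specializes_add[OF assms(2) this[OF assms(3)]] have "(0, g - g') \<in> specializes m x y" by simp
  then obtain B c where B: "finite B" "B \<subseteq> exps {1..m}" "0 = (\<Sum>e\<in>B. of_int (c e) * mon m x e)"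
    "g - g' = (\<Sum>e\<in>B. of_int (c e) * mon m y e)" by (rule specializes_normal)
  have "\<forall>e\<in>B. c e = 0" using assms(1) B(1,2) B(3)[symmetric] unfolding lind_def by blast
  then have "g - g' = 0" unfolding B(4) by simp
  then show ?thesis by simp
qed

text \<open>
  For each mutable direction \<open>l\<close> a frozen variable \<open>m + l\<close> is adjoined that occurs in the column \<open>l\<close> only. The
  entry is \<open>d l\<close> rather than 1, as the entries of this column must be divisible by \<open>d l\<close>.
\<close>

definition principal_ext :: "nat \<Rightarrow> (nat \<Rightarrow> nat) \<Rightarrow> (nat \<Rightarrow> nat \<Rightarrow> generic_field) \<Rightarrow> 'a seed \<Rightarrow> generic_field seed" where
  "principal_ext m d \<rho> S = \<lparr> xvar = gvar, rho = \<rho>,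
     bmat = (\<lambda>k l. if k \<le> m then bmat S k l else if k = m + l then int (d l) else 0) \<rparr>"

lemma principal_ext_gseed:
  assumes gs: "gseed m n d {n+1..m} S"
    and \<rho>: "\<And>i. i \<in> {1..n} \<Longrightarrow> \<rho> i 0 = 1 \<and> \<rho> i (d i) = 1 \<and> (\<forall>r\<le>d i. \<rho> i r \<in> mspan (m + n) gvar (pexps {n+1..m}))"
  shows "gseed (m + n) n d {n+1..m} (principal_ext m d \<rho> S)"
  unfolding gseed_def
proof (intro conjI ballI impI)
  let ?S = "principal_ext m d \<rho> S"
  have nm: "n \<le> m" using gs unfolding gseed_def by blast
  have b: "bmat ?S k l = bmat S k l" if "k \<le> m" for k l using that by (simp add: principal_ext_def)
  show "n \<le> m + n" "{n+1..m} \<subseteq> {n+1..m+n}" by auto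
  show "lind (m + n) (xvar ?S)" by (simp add: principal_ext_def lind_gvar)
  have "skew_symmetrizable n (bmat S)" using gs unfolding gseed_def by blast
  then show "skew_symmetrizable n (bmat ?S)" unfolding skew_symmetrizable_def using b nm by simp
  fix i assume i: "i \<in> {1..n}"
  show di: "d i > 0" using gs i unfolding gseed_def by blast
  show "int (d i) dvd bmat ?S k i" if "k \<in> {1..m + n}" for k
    using gseed_dvd[OF gs i, of k] that by (auto simp: principal_ext_def)
  show "rho ?S i 0 = 1" "rho ?S i (d i) = 1" using \<rho>[OF i] by (simp_all add: principal_ext_def)
  show "\<forall>r\<le>d i. rho ?S i r \<in> mspan (m + n) (xvar ?S) (pexps {n+1..m})"
    using \<rho>[OF i] by (simp add: principal_ext_def)
  assume "\<forall>k\<in>{1..m + n}. bmat ?S k i = 0"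
  moreover have "bmat ?S (m + i) i = int (d i)" using i by (simp add: principal_ext_def)
  ultimately show "exchange_poly (m + n) d i ?S \<noteq> 0" using di i by auto
qed

text \<open>
  The new rows form a diagonal matrix.
\<close>

lemma principal_ext_full_rank:
  assumes gs: "gseed m n d {n+1..m} S"
  shows "full_rank (m + n) n {n+1..m} (principal_ext m d \<rho> S)"
  unfolding full_rank_def
proof (intro allI impI ballI)
  fix w :: "nat \<Rightarrow> int" and l
  let ?S = "principal_ext m d \<rho> S"
  assume w: "\<forall>k\<in>{1..m + n} - {n+1..m}. (\<Sum>l\<in>{1..n}. bmat ?S k l * w l) = 0" and l: "l \<in> {1..n}"
  have "0 = (\<Sum>l'\<in>{1..n}. bmat ?S (m + l) l' * w l')" using w l by auto
  also have "\<dots> = (\<Sum>l'\<in>{1..n}. if l' = l then int (d l) * w l else 0)"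
    by (rule sum.cong) (use l in \<open>auto simp: principal_ext_def\<close>)
  also have "\<dots> = int (d l) * w l" using l by simp
  finally show "w l = 0" using gseed_basic(8)[OF gs l] by simp
qed

text \<open>
  The variables of the seeds along the path are lifted one by one. In the extended seed the new variable is a
  Laurent polynomial, so it can be specialized, and its image satisfies the exchange relation
  that determines the new variable of the given seed.
\<close>

theorem laurent_phenomenon:
  fixes S :: "'a::field_char_0 seed"
  assumes gs: "gseed m n d {n+1..m} S" and "is": "set is \<subseteq> {1..n}" and k: "k \<in> {1..m}"
  shows "xvar (fold (mutate m d) is S) k \<in> laur m (xvar S)"
proof -
  let ?M = "m + n"
  define x :: "nat \<Rightarrow> 'a" where "x = xvar S"
  \<comment> \<open>the adjoined frozen variables are set to 1\<close>
  define y where "y = (\<lambda>j. if j \<le> m then x j else 1)"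
  note nm = gs[unfolded gseed_def, THEN conjunct1]
  have lx: "lind m x" using gs unfolding gseed_def x_def by blast
  have nzx: "nzero m x" by (rule lind_nzero[OF lx])
  have nzy: "nzero ?M y" using nzx by (auto simp: nzero_def y_def)
  note lg = lind_gvar[of ?M]
  note nzg = lind_nzero[OF lg]
  let ?sp = "specializes ?M gvar y"
  have lift: "\<exists>f. (f, rho S i r) \<in> ?sp \<and> f \<in> mspan ?M gvar (pexps {n+1..m})" if "i \<in> {1..n}" "r \<le> d i" for i r
  proof -
    have "rho S i r \<in> mspan m x (pexps {n+1..m})" using gseed_rho[OF gs that] unfolding x_def .
    then have "rho S i r \<in> mspan ?M y (pexps {n+1..m})"
    proof induction
      case (step f e c)
      have "mon ?M y e = mon m x e"
        unfolding mon_def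
        by (rule prod.mono_neutral_cong_right) (use step(2) in \<open>auto simp: pexps_def exps_def y_def\<close>)
      then show ?case using mspan.step[OF step(3,2), of c] by simp
    qed (rule mspan.zero)
    then show ?thesis
      by (rule specializes_lift) (auto simp: pexps_def exps_def)
  qed
  define \<rho> where "\<rho> = (\<lambda>i r. if r = 0 \<or> r = d i then 1 else
     (SOME f. (f, rho S i r) \<in> ?sp \<and> f \<in> mspan ?M gvar (pexps {n+1..m})))"
  have \<rho>: "(\<rho> i r, rho S i r) \<in> ?sp \<and> \<rho> i r \<in> mspan ?M gvar (pexps {n+1..m})" if "i \<in> {1..n}" "r \<le> d i" for i r
  proof (cases "r = 0 \<or> r = d i")
    case True
    have "1 \<in> mspan ?M gvar (pexps {n+1..m})"
      using mspan_mon[of "\<lambda>_. 0" "pexps {n+1..m}" ?M gvar] by (simp add: mon_zero pexps_def exps_def)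
    then show ?thesis using True gseed_basic(9,10)[OF gs that(1)] specializes_1 by (auto simp: \<rho>_def)
  next
    case False
    then show ?thesis using someI_ex[OF lift[OF that]] by (simp add: \<rho>_def)
  qed
  let ?S = "principal_ext m d \<rho> S"
  have gsS: "gseed ?M n d {n+1..m} ?S"
    by (rule principal_ext_gseed[OF gs]) (use \<rho> in \<open>auto simp: \<rho>_def\<close>)
  have frS: "full_rank ?M n {n+1..m} ?S" by (rule principal_ext_full_rank[OF gs])
  have xS: "xvar ?S = gvar" by (simp add: principal_ext_def)
  have "(\<forall>k\<in>{1..m}. \<forall>l\<in>{1..n}. bmat (fold (mutate ?M d) is ?S) k l = bmat (fold (mutate m d) is S) k l) \<and>
     (\<forall>i\<in>{1..n}. \<forall>r\<le>d i. (rho (fold (mutate ?M d) is ?S) i r, rho (fold (mutate m d) is S) i r) \<in> ?sp) \<and>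
     (\<forall>j\<in>{1..?M}. (xvar (fold (mutate ?M d) is ?S) j, if j \<le> m then xvar (fold (mutate m d) is S) j else 1) \<in> ?sp) \<and>
     gseed m n d {n+1..m} (fold (mutate m d) is S) \<and> gseed ?M n d {n+1..m} (fold (mutate ?M d) is ?S)"
    using "is"
  proof (induction "is" rule: rev_induct)
    case Nil
    have var: "(gvar j, y j) \<in> ?sp" if "j \<in> {1..?M}" for j
      using specializes_mon[of "\<lambda>k. if k = j then 1 else 0" ?M gvar y] that
      by (simp add: mon_single exps_def)
    show ?case unfolding fold_simps id_apply
    proof (intro conjI ballI allI impI)
      show "(xvar ?S j, if j \<le> m then xvar S j else 1) \<in> ?sp" if "j \<in> {1..?M}" for j
        using var[OF that] unfolding xS y_def x_def .
      show "(rho ?S i r, rho S i r) \<in> ?sp" if "i \<in> {1..n}" "r \<le> d i" for i r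
        using \<rho>[OF that] by (simp add: principal_ext_def)
    qed (use gs gsS in \<open>auto simp: principal_ext_def\<close>)
  next
    case (snoc i js)
    define T where "T = fold (mutate m d) js S"
    define T' where "T' = fold (mutate ?M d) js ?S"
    have i: "i \<in> {1..n}" and js: "set js \<subseteq> {1..n}" using snoc.prems by auto
    have IH: "\<And>k l. k \<in> {1..m} \<Longrightarrow> l \<in> {1..n} \<Longrightarrow> bmat T' k l = bmat T k l"
      "\<And>i r. i \<in> {1..n} \<Longrightarrow> r \<le> d i \<Longrightarrow> (rho T' i r, rho T i r) \<in> ?sp"
      "\<And>j. j \<in> {1..?M} \<Longrightarrow> (xvar T' j, if j \<le> m then xvar T j else 1) \<in> ?sp"
      "gseed m n d {n+1..m} T" "gseed ?M n d {n+1..m} T'"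
      using snoc.IH[OF js] unfolding T_def T'_def by auto
    note g = gseed_basic[OF IH(4) i] and g' = gseed_basic[OF IH(5) i]
    let ?ex = "\<lambda>r j. r * nat (pos_part (beta d T' j i)) + (d i - r) * nat (pos_part (- beta d T' j i))"
    have "exchange_poly m d i T = (\<Sum>r\<in>{0..d i}. rho T i r * (\<Prod>j\<in>{1..?M}. (if j \<le> m then xvar T j else 1) ^ ?ex r j))"
      unfolding exchange_poly_def
    proof (intro sum.cong arg_cong2[of _ _ _ _ "(*)"] refl)
      fix r
      show "(\<Prod>j\<in>{1..m}. xvar T j ^ (r * nat (pos_part (beta d T j i)) + (d i - r) * nat (pos_part (- beta d T j i)))) =
         (\<Prod>j\<in>{1..?M}. (if j \<le> m then xvar T j else 1) ^ ?ex r j)"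
        by (rule prod.mono_neutral_cong_left) (use IH(1) i in \<open>auto simp: beta_def\<close>)
    qed
    then have P: "(exchange_poly ?M d i T', exchange_poly m d i T) \<in> ?sp"
      unfolding exchange_poly_def[of ?M]
      by (simp only:) (intro specializes_sum specializes_mult[OF nzg nzy] specializes_prod[OF nzg nzy]
          specializes_power[OF nzg nzy] IH(2,3) i; simp)
    define z' where "z' = inverse (xvar T' i) * exchange_poly ?M d i T'"
    have "xvar (fold (mutate ?M d) (js @ [i]) ?S) i \<in> laur ?M (xvar ?S)"
      by (rule laurent_phenomenon_full_rank[OF gsS frS]) (use i js nm in auto)
    then have "z' \<in> laur ?M gvar" unfolding z'_def T'_def xS by (simp add: mutate_sel)
    then obtain w where w: "(z', w) \<in> ?sp" by (rule specializes_total) auto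
    have xi: "(xvar T' i, xvar T i) \<in> ?sp" using IH(3)[of i] g(6) by simp
    have "(exchange_poly ?M d i T', xvar T i * w) \<in> ?sp"
    proof -
      have "xvar T' i * z' = exchange_poly ?M d i T'" using g'(12) by (simp add: z'_def field_simps)
      then show ?thesis using specializes_mult[OF nzg nzy xi w] by simp
    qed
    then have "xvar T i * w = exchange_poly m d i T" using specializes_unique[OF lg _ P] by blast
    then have "w = inverse (xvar T i) * exchange_poly m d i T" using g(12) by (simp add: field_simps)
    then have z: "(inverse (xvar T' i) * exchange_poly ?M d i T', inverse (xvar T i) * exchange_poly m d i T) \<in> ?sp"
      using w unfolding z'_def by simp
    have fold: "fold (mutate m d) (js @ [i]) S = mutate m d i T" "fold (mutate ?M d) (js @ [i]) ?S = mutate ?M d i T'"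
      unfolding T_def T'_def by simp_all
    show ?case
      unfolding fold
    proof (intro conjI ballI allI impI)
      show "gseed m n d {n+1..m} (mutate m d i T)" by (rule gseed_mutate[OF IH(4) i])
      show "gseed ?M n d {n+1..m} (mutate ?M d i T')" by (rule gseed_mutate[OF IH(5) i])
      show "(xvar (mutate ?M d i T') j, if j \<le> m then xvar (mutate m d i T) j else 1) \<in> ?sp" if "j \<in> {1..?M}" for j
        using z IH(3)[OF that] g(6) by (auto simp: mutate_sel)
      show "(rho (mutate ?M d i T') l r, rho (mutate m d i T) l r) \<in> ?sp" if "l \<in> {1..n}" "r \<le> d l" for l r
        using IH(2)[OF that(1)] that(2) by (auto simp: mutate_sel)
      show "bmat (mutate ?M d i T') k l = bmat (mutate m d i T) k l" if "k \<in> {1..m}" "l \<in> {1..n}" for k l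
        using IH(1)[OF that] IH(1)[OF g(6) that(2)] IH(1)[OF that(1) i] by (simp add: mutate_sel)
    qed
  qed
  then have "(xvar (fold (mutate ?M d) is ?S) k, xvar (fold (mutate m d) is S) k) \<in> ?sp" using k by force
  then have "xvar (fold (mutate m d) is S) k \<in> laur ?M y" by (rule specializes_laur)
  moreover have "laur ?M y \<subseteq> laur m x"
    by (rule mspan_exps_subset_subring[OF subring_mspan_exps[OF nzx]])
      (use laur_gen[of _ m x] laur_inverse_gen[of _ m x] subring_1[OF subring_mspan_exps[OF nzx]] in \<open>auto simp: y_def\<close>)
  ultimately show ?thesis unfolding x_def by blast
qed

section \<open>Acyclic seeds\<close>

text \<open>
  Multiplication with a high power of all the variables makes the exponents of a relation nonnegative, and what
  results is a polynomial relation.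
\<close>

lemma lind_of_alg_independent:
  fixes x :: "nat \<Rightarrow> 'a::field_char_0"
  assumes "alg_independent m x"
  shows "lind m x"
  unfolding lind_def
proof (intro allI impI)
  fix B :: "(nat \<Rightarrow> int) set" and c :: "(nat \<Rightarrow> int) \<Rightarrow> int"
  assume B: "finite B" "B \<subseteq> exps {1..m}" and 0: "(\<Sum>e\<in>B. of_int (c e) * mon m x e) = 0"
  have xnz: "x j \<noteq> 0" if j: "j \<in> {1..m}" for j
  proof
    assume x0: "x j = 0"
    let ?p = "Poly_Mapping.single (Poly_Mapping.single j 1) 1 :: qpoly"
    have "poly_eval x ?p = 0" by (simp add: poly_eval_def x0)
    moreover have "poly_vars ?p \<subseteq> {1..m}" using j by (simp add: poly_vars_def)
    ultimately have "?p = 0" using assms unfolding alg_independent_def by blast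
    then have "Poly_Mapping.lookup ?p (Poly_Mapping.single j 1) = 0" by (simp only: lookup_zero)
    then show False by (simp only: lookup_single_eq)
  qed
  then have nz: "nzero m x" by (simp add: nzero_def)
  define N where "N = (\<Sum>e\<in>B. \<Sum>j\<in>{1..m}. nat \<bar>e j\<bar>)"
  have N: "0 \<le> e j + int N" if "e \<in> B" "j \<in> {1..m}" for e j
  proof -
    have "nat \<bar>e j\<bar> \<le> (\<Sum>j\<in>{1..m}. nat \<bar>e j\<bar>)" using that by (intro member_le_sum) auto
    also have "\<dots> \<le> N" unfolding N_def using that B(1) by (intro member_le_sum) auto
    finally show ?thesis by linarith
  qed
  define E where "E = (\<lambda>e. exp_map m (\<lambda>j. nat (e j + int N)))"
  have E: "Poly_Mapping.lookup (E e) j = (if j \<in> {1..m} then nat (e j + int N) else 0)" for e j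
    unfolding E_def lookup_exp_map ..
  have inj: "inj_on E B"
  proof (rule inj_onI, rule ext)
    fix e e' j assume *: "e \<in> B" "e' \<in> B" "E e = E e'"
    then have "Poly_Mapping.lookup (E e) j = Poly_Mapping.lookup (E e') j" by simp
    then show "e j = e' j"
      using N[OF *(1), of j] N[OF *(2), of j] subsetD[OF B(2) *(1)] subsetD[OF B(2) *(2)]
      unfolding E by (cases "j \<in> {1..m}") (simp_all add: exps_def)
  qed
  define p :: qpoly where "p = (\<Sum>e\<in>B. Poly_Mapping.single (E e) (of_int (c e)))"
  have lookup_p: "Poly_Mapping.lookup p (E e) = of_int (c e)" if e: "e \<in> B" for e
  proof -
    have "Poly_Mapping.lookup p (E e) = (\<Sum>e'\<in>B. if e' = e then of_int (c e) else 0)"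
      unfolding p_def lookup_sum
    proof (rule sum.cong[OF refl])
      fix e' assume "e' \<in> B"
      then have "E e' = E e \<longleftrightarrow> e' = e" using inj e by (auto dest: inj_onD)
      then show "Poly_Mapping.lookup (Poly_Mapping.single (E e') (of_int (c e'))) (E e) = (if e' = e then of_int (c e) else (0 :: rat))"
        by (simp add: lookup_single when_def)
    qed
    then show ?thesis using e B(1) by simp
  qed
  have keys_p: "Poly_Mapping.keys p \<subseteq> E ` B"
  proof -
    have "Poly_Mapping.keys p \<subseteq> (\<Union>e\<in>B. Poly_Mapping.keys (Poly_Mapping.single (E e) (of_int (c e) :: rat)))"
      unfolding p_def by (rule keys_sum)
    also have "\<dots> \<subseteq> E ` B" by auto
    finally show ?thesis .
  qed
  have keys_E: "Poly_Mapping.keys (E e) \<subseteq> {1..m}" for e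
    using E[of e] by (auto simp: in_keys_iff split: if_splits)
  have "poly_vars p \<subseteq> {1..m}" unfolding poly_vars_def using keys_p keys_E by blast
  moreover have "poly_eval x p = 0"
  proof -
    have "poly_eval x p = (\<Sum>k\<in>E ` B. of_rat (Poly_Mapping.lookup p k) * (\<Prod>j\<in>Poly_Mapping.keys k. x j ^ Poly_Mapping.lookup k j))"
      unfolding poly_eval_def by (rule sum.mono_neutral_left) (use keys_p B(1) in \<open>auto simp: in_keys_iff\<close>)
    also have "\<dots> = (\<Sum>e\<in>B. of_rat (Poly_Mapping.lookup p (E e)) * (\<Prod>j\<in>Poly_Mapping.keys (E e). x j ^ Poly_Mapping.lookup (E e) j))"
      by (rule sum.reindex[OF inj, unfolded comp_def])
    also have "\<dots> = (\<Sum>e\<in>B. mon m x (\<lambda>_. int N) * (of_int (c e) * mon m x e))"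
    proof (rule sum.cong[OF refl])
      fix e assume e: "e \<in> B"
      have "(\<Prod>j\<in>Poly_Mapping.keys (E e). x j ^ Poly_Mapping.lookup (E e) j) = (\<Prod>j\<in>{1..m}. x j ^ Poly_Mapping.lookup (E e) j)"
        by (rule prod.mono_neutral_left) (use keys_E in \<open>auto simp: in_keys_iff\<close>)
      also have "\<dots> = mon m x (\<lambda>j. int N + e j)"
        unfolding mon_def
        by (rule prod.cong) (use N[OF e] in \<open>auto simp: E power_int_def add.commute\<close>)
      also have "\<dots> = mon m x (\<lambda>_. int N) * mon m x e" by (rule mon_add[OF nz])
      finally show "of_rat (Poly_Mapping.lookup p (E e)) * (\<Prod>j\<in>Poly_Mapping.keys (E e). x j ^ Poly_Mapping.lookup (E e) j) =
         mon m x (\<lambda>_. int N) * (of_int (c e) * mon m x e)"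
        by (simp add: lookup_p[OF e] mult.left_commute)
    qed
    also have "\<dots> = 0" using 0 by (simp flip: sum_distrib_left)
    finally show ?thesis .
  qed
  ultimately have "p = 0" using assms unfolding alg_independent_def by blast
  then show "\<forall>e\<in>B. c e = 0" using lookup_p by force
qed

lemma gseed_of_generalized_seed:
  assumes "n \<le> m" "generalized_seed K m n d S" "nondegenerate m n d S"
  shows "gseed m n d {n+1..m} S"
  unfolding gseed_def
proof (intro conjI)
  note gs = assms(2)[unfolded generalized_seed_def]
  show "n \<le> m" by fact
  show "{n+1..m} \<subseteq> {n+1..m}" by simp
  show "lind m (xvar S)" using gs lind_of_alg_independent unfolding freely_generates_def by blast
  show "skew_symmetrizable n (bmat S)" using gs by blast
  show "\<forall>s\<in>{1..n}. d s > 0 \<and> (\<forall>i\<in>{1..m}. int (d s) dvd bmat S i s)" using gs by blast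
  show "\<forall>i\<in>{1..n}. (\<forall>k\<in>{1..m}. bmat S k i = 0) \<longrightarrow> exchange_poly m d i S \<noteq> 0"
    using assms(3) unfolding nondegenerate_def by blast
  show "\<forall>i\<in>{1..n}. rho S i 0 = 1 \<and> rho S i (d i) = 1 \<and> (\<forall>r\<le>d i. rho S i r \<in> mspan m (xvar S) (pexps {n+1..m}))"
  proof (intro ballI conjI allI impI)
    fix i assume i: "i \<in> {1..n}"
    show r0: "rho S i 0 = 1" and rd: "rho S i (d i) = 1" using gs i by auto
    fix r assume r: "r \<le> d i"
    show "rho S i r \<in> mspan m (xvar S) (pexps {n+1..m})"
    proof (cases "r = 0 \<or> r = d i")
      case True
      have "1 \<in> mspan m (xvar S) (pexps {n+1..m})"
        using mspan_mon[of "\<lambda>_. 0" "pexps {n+1..m}" m "xvar S"] by (simp add: mon_zero pexps_def exps_def)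
      then show ?thesis using True r0 rd by auto
    next
      case False
      then have "r \<in> {1..d i - 1}" using r by auto
      then have "is_frozen_monomial m n (xvar S) (rho S i r)" using gs i by blast
      then obtain c :: int and e :: "nat \<Rightarrow> nat" where ce: "rho S i r = of_int c * (\<Prod>k\<in>{n+1..m}. xvar S k ^ e k)"
        unfolding is_frozen_monomial_def by blast
      define e' where "e' = (\<lambda>k. if k \<in> {n+1..m} then int (e k) else 0)"
      have "(\<Prod>k\<in>{n+1..m}. xvar S k ^ e k) = mon m (xvar S) e'"
        unfolding mon_def by (rule prod.mono_neutral_cong_left) (auto simp: e'_def)
      moreover have "e' \<in> pexps {n+1..m}" by (auto simp: e'_def pexps_def exps_def)
      ultimately show ?thesis unfolding ce by (auto intro: mspan_cmult_mon)
    qed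
  qed
qed

lemma reach_path:
  assumes "reach m d I S T"
  obtains "is" where "set is \<subseteq> I" "T = fold (mutate m d) is S"
proof -
  have "\<exists>is. set is \<subseteq> I \<and> T = fold (mutate m d) is S"
    using assms
  proof (induction rule: reach_induct)
    case refl
    show ?case by (rule exI[of _ "[]"]) simp
  next
    case (step T i)
    then obtain "is" where "set is \<subseteq> I" "T = fold (mutate m d) is S" by blast
    then show ?case using step by (intro exI[of _ "is @ [i]"]) simp
  qed
  then show thesis using that by blast
qed

text \<open>
  The cluster algebra of the seed in which mutation is allowed in the directions \<open>I\<close> only: the other
  variables count as frozen, hence they are invertible.
\<close>

definition calg :: "nat \<Rightarrow> (nat \<Rightarrow> nat) \<Rightarrow> nat set \<Rightarrow> 'a::field_char_0 seed \<Rightarrow> 'a set" where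
  "calg m d I S = is_subring hull (mspan m (xvar S) (exps ({1..m} - I)) \<union> {xvar T k | T k. reach m d I S T \<and> k \<in> I})"

lemma subring_calg: "is_subring (calg m d I S)"
  unfolding calg_def by (rule is_subring_hull)

lemma calg_frozen: "mspan m (xvar S) (exps ({1..m} - I)) \<subseteq> calg m d I S"
  unfolding calg_def by (auto intro: hull_inc)

lemma calg_var: "reach m d I S T \<Longrightarrow> k \<in> I \<Longrightarrow> xvar T k \<in> calg m d I S"
  unfolding calg_def by (auto intro: hull_inc)

lemma calg_initial: "k \<in> {1..m} \<Longrightarrow> xvar S k \<in> calg m d I S"
proof (cases "k \<in> I")
  case False
  assume k: "k \<in> {1..m}"
  have "xvar S k \<in> mspan m (xvar S) (exps ({1..m} - I))"
    using gen_mspan[OF k, of 1 "exps ({1..m} - I)" "xvar S"] False k by (simp add: exps_def)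
  then show ?thesis using calg_frozen by blast
qed (rule calg_var[OF reach_refl])

lemma calg_initial_mspan:
  assumes "\<And>e k. e \<in> E \<Longrightarrow> k \<in> I \<Longrightarrow> 0 \<le> e k"
  shows "mspan m (xvar S) E \<subseteq> calg m d I S"
proof (rule mspan_gen_subset_subring[OF subring_calg])
  fix e k assume e: "e \<in> E" and k: "k \<in> {1..m}" "e k \<noteq> 0"
  have "inverse (xvar S k) \<in> calg m d I S" if "e k < 0"
  proof -
    have "k \<notin> I" using assms[OF e, of k] that by force
    then have "inverse (xvar S k) \<in> mspan m (xvar S) (exps ({1..m} - I))"
      unfolding xvar_inverse_mon[of k m "xvar S", OF k(1)] by (intro mspan_mon) (use k in \<open>auto simp: exps_def\<close>)
    then show ?thesis using calg_frozen by blast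
  qed
  then show "xvar S k \<in> calg m d I S \<and> (e k < 0 \<longrightarrow> inverse (xvar S k) \<in> calg m d I S)"
    using calg_initial[OF k(1)] by blast
qed

text \<open>
  Freezing \<open>i\<close> merely adjoins the inverse of \<open>x\<^sub>i\<close>; the remaining generators are also generators for \<open>I\<close>.
\<close>

lemma calg_unfreeze:
  assumes i: "i \<in> {1..m}" "i \<in> I" and nz: "nzero m (xvar S)" and f: "f \<in> calg m d (I - {i}) S"
  obtains N where "xvar S i ^ N * f \<in> calg m d I S"
proof -
  note A = subring_calg[of m d I S]
  have xi: "xvar S i ^ k \<in> calg m d I S" for k by (intro subring_power[OF A] calg_initial i)
  have up: "xvar S i ^ (N + M) * f \<in> calg m d I S" if "xvar S i ^ N * f \<in> calg m d I S" for N M f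
    using subring_mult[OF A xi[of M] that] by (simp add: power_add mult_ac)
  have "\<exists>N. xvar S i ^ N * f \<in> calg m d I S"
    using f unfolding calg_def[of m d "I - {i}"]
  proof (rule hull_induct)
    fix f assume "f \<in> mspan m (xvar S) (exps ({1..m} - (I - {i}))) \<union> {xvar T k |T k. reach m d (I - {i}) S T \<and> k \<in> I - {i}}"
    then show "\<exists>N. xvar S i ^ N * f \<in> calg m d I S"
    proof
      assume "f \<in> mspan m (xvar S) (exps ({1..m} - (I - {i})))"
      then show ?thesis
      proof induction
        case zero
        show ?case using subring_0[OF A] by simp
      next
        case (step f e c)
        then obtain N where N: "xvar S i ^ N * f \<in> calg m d I S" by blast
        define M where "M = nat \<bar>e i\<bar>"
        have "xvar S i ^ M * mon m (xvar S) e = mon m (xvar S) (\<lambda>l. (if l = i then int M else 0) + e l)"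
          unfolding xvar_power_mon[of i m "xvar S", OF i(1)] mon_add[OF nz] ..
        also have "\<dots> \<in> calg m d I S"
          by (rule subsetD[OF calg_initial_mspan mspan_mon[OF singletonI]])
            (use step(2) in \<open>auto simp: exps_def M_def\<close>)
        finally have "xvar S i ^ M * mon m (xvar S) e \<in> calg m d I S" .
        from up[OF this, of N] have "of_int c * (xvar S i ^ (M + N) * mon m (xvar S) e) \<in> calg m d I S"
          by (rule subring_mult[OF A subring_of_int[OF A]])
        from subring_add[OF A up[OF N, of M] this]
        have "xvar S i ^ (N + M) * (f + of_int c * mon m (xvar S) e) \<in> calg m d I S" by (simp add: algebra_simps)
        then show ?case by blast
      qed
    next
      assume "f \<in> {xvar T k |T k. reach m d (I - {i}) S T \<and> k \<in> I - {i}}"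
      then have "f \<in> calg m d I S" using calg_var reach_mono[of m d "I - {i}" S _ I] by blast
      then show ?thesis by (intro exI[of _ 0]) simp
    qed
  next
    show "is_subring {f. \<exists>N. xvar S i ^ N * f \<in> calg m d I S}"
      unfolding is_subring_def mem_Collect_eq
    proof (intro conjI ballI)
      show "\<exists>N. xvar S i ^ N * 0 \<in> calg m d I S" using subring_0[OF A] by simp
      show "\<exists>N. xvar S i ^ N * 1 \<in> calg m d I S" using xi by simp
    next
      fix f g assume "f \<in> {f. \<exists>N. xvar S i ^ N * f \<in> calg m d I S}" "g \<in> {f. \<exists>N. xvar S i ^ N * f \<in> calg m d I S}"
      then obtain N M where N: "xvar S i ^ N * f \<in> calg m d I S" and M: "xvar S i ^ M * g \<in> calg m d I S" by blast
      from subring_add[OF A up[OF N, of M] up[OF M, of N]]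
      have "xvar S i ^ (N + M) * (f + g) \<in> calg m d I S" by (simp add: distrib_left add.commute)
      then show "\<exists>N. xvar S i ^ N * (f + g) \<in> calg m d I S" by blast
      from subring_mult[OF A N M] have "xvar S i ^ (N + M) * (f * g) \<in> calg m d I S" by (simp add: power_add mult_ac)
      then show "\<exists>N. xvar S i ^ N * (f * g) \<in> calg m d I S" by blast
    next
      fix f assume "f \<in> {f. \<exists>N. xvar S i ^ N * f \<in> calg m d I S}"
      then obtain N where "xvar S i ^ N * f \<in> calg m d I S" by blast
      from subring_uminus[OF A this] have "xvar S i ^ N * - f \<in> calg m d I S" by simp
      then show "\<exists>N. xvar S i ^ N * - f \<in> calg m d I S" by blast
    qed
  qed
  then show thesis using that by blast
qed

text \<open>
  Without edges in \<open>I\<close>, mutation in one of these directions does not affect the exchange polynomials of the others.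
\<close>

lemma isolated_mutations:
  assumes gs: "gseed m n d Q S" and I: "I \<subseteq> {1..n}" and iso: "\<And>i j. i \<in> I \<Longrightarrow> j \<in> I \<Longrightarrow> bmat S i j = 0"
    and "finite J" "J \<subseteq> I"
  shows "\<exists>T. reach m d I S T \<and> xvar T = (\<lambda>k. if k \<in> J then inverse (xvar S k) * exchange_poly m d k S else xvar S k) \<and>
    (\<forall>k\<in>I - J. rho T k = rho S k \<and> (\<forall>l. bmat T l k = bmat S l k)) \<and> (\<forall>k\<in>I. \<forall>l\<in>I. bmat T l k = 0)"
  using assms(4,5)
proof (induction J rule: finite_induct)
  case empty
  show ?case by (rule exI[of _ S]) (auto simp: reach_refl iso)
next
  case (insert i J)
  then obtain T where T: "reach m d I S T" "xvar T = (\<lambda>k. if k \<in> J then inverse (xvar S k) * exchange_poly m d k S else xvar S k)"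
    "\<And>k. k \<in> I - J \<Longrightarrow> rho T k = rho S k" "\<And>k l. k \<in> I - J \<Longrightarrow> bmat T l k = bmat S l k"
    "\<And>k l. k \<in> I \<Longrightarrow> l \<in> I \<Longrightarrow> bmat T l k = 0" by auto
  have i: "i \<in> I - J" using insert by auto
  have P: "exchange_poly m d i T = exchange_poly m d i S"
  proof (rule exchange_cong)
    show "xvar T l = xvar S l" if "bmat S l i \<noteq> 0" for l
    proof -
      have "l \<notin> I" using iso[of l i] i that by auto
      then show ?thesis using T(2) insert.prems by auto
    qed
  qed (use T(3,4) i in auto)
  show ?case
  proof (intro exI conjI ballI allI)
    show "reach m d I S (mutate m d i T)" using reach_mutate[OF T(1)] i by blast
    show "xvar (mutate m d i T) = (\<lambda>k. if k \<in> insert i J then inverse (xvar S k) * exchange_poly m d k S else xvar S k)"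
      using i by (auto simp: mutate_sel P T(2))
    fix k assume k: "k \<in> I - insert i J"
    show "rho (mutate m d i T) k = rho S k" using T(3)[of k] k by (auto simp: mutate_sel)
    show "bmat (mutate m d i T) l k = bmat S l k" for l
      using T(4)[of k l] T(5)[of k i] k i by (auto simp: mutate_sel pos_part_def)
  next
    fix k l assume "k \<in> I" "l \<in> I"
    then show "bmat (mutate m d i T) l k = 0" using T(5)[of k l] T(5)[of k i] i by (simp add: mutate_sel)
  qed
qed

text \<open>
  Let \<open>g\<close> be the component of \<open>f\<close> with exponents \<open>a\<close> in \<open>I\<close>. In the seed where exactly the variables with
  negative exponent are exchanged, \<open>exchange_component\<close> shows that \<open>g\<close> is divisible by \<open>P\<^sub>k ^ (- a\<^sub>k)\<close> for each of
  these. So every negative power of \<open>x\<^sub>k\<close> in \<open>g\<close> can be replaced by a positive power of \<open>x\<^sub>k'\<close>.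
\<close>

lemma upper_subset_isolated:
  assumes gs: "gseed m n d Q S" and I: "I \<subseteq> {1..n}" and iso: "\<And>i j. i \<in> I \<Longrightarrow> j \<in> I \<Longrightarrow> bmat S i j = 0"
    and f: "\<And>T. reach m d I S T \<Longrightarrow> f \<in> laur m (xvar T)"
  shows "f \<in> calg m d I S"
proof -
  let ?x = "xvar S"
  have lind: "lind m ?x" and nm: "n \<le> m" and Q: "Q \<subseteq> {n+1..m}" using gs unfolding gseed_def by auto
  note nz = lind_nzero[OF lind]
  note A = subring_calg[of m d I S]
  have Im: "I \<subseteq> {1..m}" using I nm by auto
  have finI: "finite I" using I finite_subset by blast
  define w where "w = (\<lambda>e :: nat \<Rightarrow> int. \<lambda>k. if k \<in> I then e k else 0)"
  obtain B g where B: "finite B" "f = (\<Sum>a\<in>B. g a)" "\<And>a. g a \<in> mspan m ?x {e \<in> exps {1..m}. w e = a}"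
    by (rule mspan_decomp[OF f[OF reach_refl], of w]) (rule that; blast)
  have P: "exchange_poly m d k S \<in> mspan m ?x (exps ({1..m} - I)) \<and> exchange_poly m d k S \<noteq> 0" if k: "k \<in> I" for k
  proof
    have kn: "k \<in> {1..n}" using k I by auto
    show "exchange_poly m d k S \<noteq> 0" by (rule exchange_nonzero[OF gs kn])
    have "l \<notin> I" if "l \<in> Q \<or> bmat S l k \<noteq> 0" for l
      using that subsetD[OF Q, of l] subsetD[OF I, of l] iso[of l k] k by auto
    then show "exchange_poly m d k S \<in> mspan m ?x (exps ({1..m} - I))"
      by (intro mspan_monoD[OF exchange_in[OF gs kn]]) (auto simp: exps_def)
  qed
  have "g a \<in> calg m d I S" if a: "a \<in> B" for a
  \<comment> \<open>an index that is not itself supported in \<open>I\<close> belongs to an empty component\<close>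
  proof (cases "w a = a")
    case False
    have "{e \<in> exps {1..m}. w e = a} = {}" using False by (auto simp: w_def)
    from B(3)[of a, unfolded this] have "g a \<in> mspan m ?x {}" .
    then show ?thesis using calg_initial_mspan[of "{}" I m S d] by blast
  next
    case True
    have wa: "w e = a \<longleftrightarrow> (\<forall>k\<in>I. e k = a k)" for e
      using fun_cong[OF True] unfolding w_def fun_eq_iff by (metis (full_types))
    define J where "J = {k \<in> I. a k < 0}"
    have JI: "J \<subseteq> I" unfolding J_def by blast
    have finJ: "finite J" using JI finI finite_subset by blast
    obtain T where T: "reach m d I S T" "xvar T = (\<lambda>k. if k \<in> J then inverse (?x k) * exchange_poly m d k S else ?x k)"
      using isolated_mutations[OF gs I iso finJ JI] by blast
    obtain g' where g': "g' \<in> mspan m ?x {e \<in> exps {1..m}. \<forall>k\<in>I. e k = a k}"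
      "g a = (\<Prod>k\<in>J. exchange_poly m d k S powi - a k) * g'"
    proof (rule exchange_component[OF lind JI Im, where P = "\<lambda>k. exchange_poly m d k S"])
      show "g a + (\<Sum>b\<in>B - {a}. g b) \<in> laur m (\<lambda>k. if k \<in> J then inverse (?x k) * exchange_poly m d k S else ?x k)"
        using f[OF T(1)] sum.remove[OF B(1) a, of g] unfolding T(2) B(2) by simp
      show "g a \<in> mspan m ?x {e \<in> exps {1..m}. \<forall>k\<in>I. e k = a k}" using B(3)[of a] unfolding wa .
      show "(\<Sum>b\<in>B - {a}. g b) \<in> mspan m ?x {e \<in> exps {1..m}. \<not> (\<forall>k\<in>I. e k = a k)}"
      proof (rule mspan_sum)
        fix b assume "b \<in> B - {a}"
        then show "g b \<in> mspan m ?x {e \<in> exps {1..m}. \<not> (\<forall>k\<in>I. e k = a k)}"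
          using B(3)[of b] unfolding wa[symmetric] by (auto elim!: mspan_monoD)
      qed
    qed (use P JI in \<open>auto intro: that\<close>)
    define z where "z = (\<lambda>k. inverse (?x k) * exchange_poly m d k S)"
    have z: "z k \<in> calg m d I S" if "k \<in> I" for k
      using calg_var[OF reach_mutate[OF reach_refl that] that, of m d S] by (simp add: mutate_sel z_def)
    have "mon m ?x (\<lambda>k. if k \<in> J then - a k else 0) = (\<Prod>k\<in>J. ?x k powi - a k)"
      unfolding mon_def by (rule prod.mono_neutral_cong_right) (use JI Im in auto)
    then have "g a = (\<Prod>k\<in>J. z k powi - a k) * (mon m ?x (\<lambda>k. if k \<in> J then - a k else 0) * g')"
    proof -
      have "(\<Prod>k\<in>J. exchange_poly m d k S powi - a k) = (\<Prod>k\<in>J. z k powi - a k * ?x k powi - a k)"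
      proof (rule prod.cong[OF refl])
        fix k assume "k \<in> J"
        then have "?x k \<noteq> 0" using nz JI Im unfolding nzero_def by auto
        then have "exchange_poly m d k S = z k * ?x k" by (simp add: z_def)
        then show "exchange_poly m d k S powi - a k = z k powi - a k * ?x k powi - a k"
          by (simp only: power_int_mult_distrib)
      qed
      then show ?thesis using g'(2) \<open>mon m ?x _ = _\<close> by (simp add: prod.distrib mult.assoc)
    qed
    moreover have "mon m ?x (\<lambda>k. if k \<in> J then - a k else 0) * g' \<in> mspan m ?x {e \<in> exps {1..m}. \<forall>k\<in>I. 0 \<le> e k}"
      by (rule mspan_mult[OF nz mspan_mon g'(1), of _ "{\<lambda>k. if k \<in> J then - a k else 0}"])
        (use JI Im in \<open>auto simp: exps_def J_def\<close>)
    then have "mon m ?x (\<lambda>k. if k \<in> J then - a k else 0) * g' \<in> calg m d I S"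
      by (rule subsetD[OF calg_initial_mspan, rotated]) auto
    moreover have "(\<Prod>k\<in>J. z k powi - a k) \<in> calg m d I S"
    proof (rule subring_prod[OF A])
      fix k assume k: "k \<in> J"
      then have "z k powi - a k = z k ^ nat (- a k)" by (simp add: J_def power_int_def)
      then show "z k powi - a k \<in> calg m d I S" using subring_power[OF A z] k JI by auto
    qed
    ultimately show ?thesis using subring_mult[OF A] by simp
  qed
  then show ?thesis unfolding B(2) by (rule subring_sum[OF A])
qed

text \<open>
  For a source \<open>i\<close> of the graph on \<open>I\<close>, the monomial of positive entries of the column \<open>i\<close> involves only variables
  outside \<open>I\<close>, so it is a unit. For an edge from \<open>i\<close> to \<open>j\<close>, the rest of the exchange polynomial is divisible by
  \<open>x\<^sub>j\<close>. Hence \<open>x\<^sub>i\<close> and \<open>x\<^sub>j\<close> generate the unit ideal, and it suffices to treat \<open>f\<close> after freezing one of them.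
\<close>

lemma upper_subset_calg:
  assumes gs: "gseed m n d Q S" and ac: "acyclic {(i, j). i \<in> {1..n} \<and> j \<in> {1..n} \<and> bmat S i j > 0}"
    and I: "I \<subseteq> {1..n}" and f: "\<And>T. reach m d I S T \<Longrightarrow> f \<in> laur m (xvar T)"
  shows "f \<in> calg m d I S"
proof -
  have nm: "n \<le> m" and Q: "Q \<subseteq> {n+1..m}" and skew: "skew_symmetrizable n (bmat S)" and lind: "lind m (xvar S)"
    using gs unfolding gseed_def by auto
  note nz = lind_nzero[OF lind]
  have "finite I" using I finite_subset by blast
  then show ?thesis using I f
  proof (induction I rule: finite_psubset_induct)
    case (psubset I)
    note A = subring_calg[of m d I S]
    show ?case
    proof (cases "\<exists>i\<in>I. \<exists>j\<in>I. bmat S i j > 0")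
      case False
      show ?thesis
      proof (rule upper_subset_isolated[OF gs psubset.prems(1) _ psubset.prems(2)])
        fix i j assume "i \<in> I" "j \<in> I"
        then show "bmat S i j = 0"
          using False skew_sign[OF skew, of j i] psubset.prems(1) by (meson linorder_cases subsetD)
      qed
    next
      case True
      define E where "E = {(i, j). i \<in> I \<and> j \<in> I \<and> bmat S i j > 0}"
      have "E \<subseteq> {(i, j). i \<in> {1..n} \<and> j \<in> {1..n} \<and> bmat S i j > 0}" using psubset.prems(1) by (auto simp: E_def)
      then have "acyclic E" using ac acyclic_subset by blast
      moreover have "finite E" using psubset.hyps(1) by (auto simp: E_def intro: finite_subset[of _ "I \<times> I"])
      ultimately have "wf E" by (rule finite_acyclic_wf[rotated])
      obtain i0 where "i0 \<in> Domain E" using True by (auto simp: E_def)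
      with \<open>wf E\<close> obtain i where i: "i \<in> Domain E" "\<And>k. (k, i) \<in> E \<Longrightarrow> k \<notin> Domain E" by (rule wfE_min) blast
      then have source: "(k, i) \<notin> E" for k by blast
      \<comment> \<open>minimality in the domain of \<open>E\<close> excludes incoming edges altogether, as their starting points are in the domain\<close>
      from i(1) obtain j where ij: "i \<in> I" "j \<in> I" "bmat S i j > 0" by (auto simp: E_def)
      have n: "i \<in> {1..n}" "j \<in> {1..n}" and m: "i \<in> {1..m}" "j \<in> {1..m}" using ij psubset.prems(1) nm by auto
      have ji: "bmat S j i < 0" using skew_sign[OF skew n] ij(3) by simp
      obtain p where p: "exchange_poly m d i S = mon m (xvar S) (\<lambda>l. int (d i) * (if bmat S j i > 0 then neg_exp m d S i l else pos_exp m d S i l)) + p"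
        "p \<in> mspan m (xvar S) {e \<in> exps {1..m}. (\<forall>l. 0 \<le> e l \<and> (e l \<noteq> 0 \<longrightarrow> l \<in> Q \<or> bmat S l i \<noteq> 0)) \<and> 0 < e j}"
        by (rule exchange_lowest[OF gs n(1) m(2)]) (use ji in simp, rule that)
      define \<mu> where "\<mu> = (\<lambda>l. int (d i) * pos_exp m d S i l)"
      have P: "exchange_poly m d i S = mon m (xvar S) \<mu> + p" using p(1) ji by (simp add: \<mu>_def)
      have \<mu>m: "\<mu> l = 0" if "l \<notin> {1..m}" for l using that by (simp only: \<mu>_def pos_exp_def if_False mult_zero_right)
      have "\<mu> l = 0" if "l \<in> I" for l
      proof -
        have "\<not> bmat S l i > 0" using source[of l] that ij(1) by (auto simp: E_def)
        moreover have "l \<in> {1..m}" using that psubset.prems(1) nm by auto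
        ultimately have "\<not> beta d S l i > 0" using gseed_beta_pos_iff[OF gs n(1)] by simp
        then show ?thesis by (simp add: \<mu>_def pos_exp_def pos_part_def)
      qed
      then have \<mu>: "\<mu> \<in> exps ({1..m} - I)" "(\<lambda>l. - \<mu> l) \<in> exps ({1..m} - I)"
        using \<mu>m by (auto simp: exps_def)
      let ?M = "mon m (xvar S) \<mu>"
      have Minv: "inverse ?M \<in> calg m d I S"
        unfolding mon_uminus[symmetric] using mspan_mon[OF \<mu>(2)] calg_frozen by blast
      define q where "q = inverse (xvar S j) * p"
      have "q \<in> mspan m (xvar S) {e \<in> exps {1..m}. \<forall>l. 0 \<le> e l}"
        unfolding q_def xvar_inverse_mon[of j m "xvar S", OF m(2)]
        by (rule mspan_mult[OF nz mspan_mon p(2), of _ "{\<lambda>l. if l = j then -1 else 0}"])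
          (use m(2) in \<open>auto simp: exps_def\<close>)
      then have q: "q \<in> calg m d I S" by (rule subsetD[OF calg_initial_mspan, rotated]) auto
      define z where "z = xvar (mutate m d i S) i"
      have z: "z \<in> calg m d I S" unfolding z_def by (rule calg_var[OF reach_mutate[OF reach_refl ij(1)] ij(1)])
      have xnz: "xvar S i \<noteq> 0" "xvar S j \<noteq> 0" using nz m unfolding nzero_def by auto
      have rel: "xvar S i * z = ?M + xvar S j * q"
        using xnz P by (simp add: z_def q_def mutate_sel mult.assoc[symmetric])
      have ne: "i \<noteq> j" using ij(3) skew_diag[OF skew n(1)] by auto
      have freeze: "\<exists>N. xvar S k ^ N * f \<in> calg m d I S" if k: "k \<in> I" for k
      proof -
        have "f \<in> calg m d (I - {k}) S"
        proof (rule psubset.IH)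
          show "I - {k} \<subset> I" using k by blast
          show "I - {k} \<subseteq> {1..n}" using psubset.prems(1) by blast
          show "f \<in> laur m (xvar T)" if "reach m d (I - {k}) S T" for T
            using psubset.prems(2)[OF reach_mono[OF that]] by blast
        qed
        moreover have "k \<in> {1..m}" using k psubset.prems(1) nm by auto
        ultimately show ?thesis using calg_unfreeze[of k m I S f d] k nz by blast
      qed
      obtain N M where NM: "xvar S i ^ N * f \<in> calg m d I S" "xvar S j ^ M * f \<in> calg m d I S"
        using freeze[OF ij(1)] freeze[OF ij(2)] by blast
      show ?thesis
      proof (rule coprime_powers[OF _ _ _ NM])
        fix X assume X: "xvar S i * X \<in> calg m d I S" "xvar S j * X \<in> calg m d I S"
        have "inverse ?M * (z * (xvar S i * X) - q * (xvar S j * X)) \<in> calg m d I S"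
          by (rule subring_mult[OF A Minv subring_diff[OF A subring_mult[OF A z X(1)] subring_mult[OF A q X(2)]]])
        also have "z * (xvar S i * X) - q * (xvar S j * X) = (xvar S i * z - xvar S j * q) * X" by (simp add: algebra_simps)
        also have "xvar S i * z - xvar S j * q = ?M" using rel by simp
        also have "inverse ?M * (?M * X) = X" using mon_nonzero[OF nz] by simp
        finally show "X \<in> calg m d I S" .
      qed (intro subring_mult[OF A] calg_initial m; assumption)+
    qed
  qed
qed

section \<open>Equality of the two algebras\<close>

lemma ZP_eq_mspan:
  assumes "nzero m (xvar S)"
  shows "ZP m n S = mspan m (xvar S) (exps {n+1..m})"
proof
  note L = subring_mspan_exps[OF assms, of "{n+1..m}"]
  have gen: "xvar S k \<in> mspan m (xvar S) (exps {n+1..m}) \<and> inverse (xvar S k) \<in> mspan m (xvar S) (exps {n+1..m})"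
    if k: "k \<in> {n+1..m}" for k
  proof
    have km: "k \<in> {1..m}" using k by auto
    show "xvar S k \<in> mspan m (xvar S) (exps {n+1..m})"
      using gen_mspan[OF km, of 1 "exps {n+1..m}" "xvar S"] k by (simp add: exps_def)
    show "inverse (xvar S k) \<in> mspan m (xvar S) (exps {n+1..m})"
      unfolding xvar_inverse_mon[of k m "xvar S", OF km] by (rule mspan_mon) (use k in \<open>auto simp: exps_def\<close>)
  qed
  show "ZP m n S \<subseteq> mspan m (xvar S) (exps {n+1..m})"
    unfolding ZP_def laurent_ring_def
    by (rule hull_minimal[where S = is_subring, OF _ L]) (use gen subring_of_int[OF L] in \<open>auto elim!: Ints_cases\<close>)
  show "mspan m (xvar S) (exps {n+1..m}) \<subseteq> ZP m n S"
    unfolding ZP_def laurent_ring_def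
    by (rule mspan_exps_subset_subring[OF is_subring_hull]) (auto intro!: hull_inc)
qed

lemma laurent_ring_eq_laur:
  assumes nm: "n \<le> m" and nz: "nzero m (xvar S)" "nzero m (xvar T)"
    and fr: "\<And>k. k \<in> {n+1..m} \<Longrightarrow> xvar T k = xvar S k"
  shows "laurent_ring (ZP m n S) (cluster n T) = laur m (xvar T)"
proof
  note L = subring_mspan_exps[OF nz(2), of "{1..m}"]
  have Z: "ZP m n S = mspan m (xvar T) (exps {n+1..m})"
    unfolding ZP_eq_mspan[OF nz(1)]
  proof (rule mspan_cong)
    fix e j assume "e \<in> exps {n+1..m}" "e j \<noteq> 0"
    then have "j \<in> {n+1..m}" by (auto simp: exps_def)
    then show "xvar S j = xvar T j" using fr by simp
  qed
  have "ZP m n S \<subseteq> laur m (xvar T)" unfolding Z by (rule mspan_mono) (auto simp: exps_def)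
  then show "laurent_ring (ZP m n S) (cluster n T) \<subseteq> laur m (xvar T)"
    unfolding laurent_ring_def cluster_def using nm
    by (intro hull_minimal[where S = is_subring, OF _ L]) (use laur_gen[of _ m "xvar T"] laur_inverse_gen[of _ m "xvar T"] in auto)
  show "laur m (xvar T) \<subseteq> laurent_ring (ZP m n S) (cluster n T)"
    unfolding laurent_ring_def
  proof (rule mspan_exps_subset_subring[OF is_subring_hull])
    fix k assume "k \<in> {1..m} \<inter> {1..m}"
    then have k: "k \<in> {1..m}" by simp
    show "xvar T k \<in> is_subring hull (ZP m n S \<union> cluster n T \<union> inverse ` cluster n T) \<and>
        inverse (xvar T k) \<in> is_subring hull (ZP m n S \<union> cluster n T \<union> inverse ` cluster n T)"
    proof (cases "k \<le> n")
      case True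
      then show ?thesis using k unfolding cluster_def by (auto intro!: hull_inc)
    next
      case False
      then have "xvar T k \<in> ZP m n S" "inverse (xvar T k) \<in> ZP m n S"
        unfolding Z using gen_mspan[OF k, of 1 "exps {n+1..m}" "xvar T"] gen_mspan[OF k, of "-1" "exps {n+1..m}" "xvar T"] k
        by (auto simp: exps_def power_int_minus)
      then show ?thesis by (auto intro!: hull_inc)
    qed
  qed
qed

theorem corollaryA10:
  fixes K :: "'a::field_char_0 set"
    and m n :: nat
    and d :: "nat \<Rightarrow> nat"
    and S :: "'a seed"
  assumes "1 \<le> n" and "n \<le> m"
    and "generalized_seed K m n d S"
    and "nondegenerate m n d S"
    and "acyclic_cluster_algebra m n d S"
  shows "gen_cluster_algebra m n d S = gen_upper_cluster_algebra m n d S"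
proof
  let ?I = "{1..n}"
  have gs: "gseed m n d {n+1..m} S" by (rule gseed_of_generalized_seed[OF assms(2-4)])
  have me: "mutation_equivalent m n d T U \<longleftrightarrow> reach m d ?I T U" for T U :: "'a seed"
    unfolding mutation_equivalent_def reach_def ..
  have gsT: "gseed m n d {n+1..m} T" if "reach m d ?I S T" for T by (rule reach_gseed[OF that gs subset_refl])
  have nzT: "nzero m (xvar T)" if "reach m d ?I S T" for T
    using gsT[OF that] lind_nzero unfolding gseed_def by blast
  have frT: "xvar T k = xvar S k" if "reach m d ?I S T" "k \<in> {n+1..m}" for T k
    using reach_frozen[OF that(1)] that(2) by simp
  have LT: "laurent_ring (ZP m n S) (cluster n T) = laur m (xvar T)" if "reach m d ?I S T" for T
    by (rule laurent_ring_eq_laur[OF assms(2) nzT[OF reach_refl] nzT[OF that] frT[OF that]])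
  have U: "gen_upper_cluster_algebra m n d S = {f. \<forall>T. reach m d ?I S T \<longrightarrow> f \<in> laur m (xvar T)}"
    unfolding gen_upper_cluster_algebra_def me using LT by auto
  show "gen_cluster_algebra m n d S \<subseteq> gen_upper_cluster_algebra m n d S"
    unfolding U
  proof (intro subsetI CollectI allI impI)
    fix f T assume f: "f \<in> gen_cluster_algebra m n d S" and T: "reach m d ?I S T"
    note L = subring_mspan_exps[OF nzT[OF T], of "{1..m}"]
    have "ZP m n S \<union> (\<Union>T\<in>{T. mutation_equivalent m n d S T}. cluster n T) \<subseteq> laur m (xvar T)"
    proof (intro Un_least UN_least)
      show "ZP m n S \<subseteq> laur m (xvar T)" unfolding LT[OF T, symmetric] laurent_ring_def by (auto intro: hull_inc)
      fix U assume "U \<in> {T. mutation_equivalent m n d S T}"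
      then have "reach m d ?I T U" using reach_trans[OF reach_sym[OF T gs subset_refl]] unfolding me by blast
      then obtain "is" where "is": "set is \<subseteq> ?I" "U = fold (mutate m d) is T" by (rule reach_path)
      show "cluster n U \<subseteq> laur m (xvar T)"
        unfolding cluster_def "is"(2) using laurent_phenomenon[OF gsT[OF T] "is"(1)] assms(2) by auto
    qed
    then have "gen_cluster_algebra m n d S \<subseteq> laur m (xvar T)"
      unfolding gen_cluster_algebra_def by (rule hull_minimal[where S = is_subring, OF _ L])
    then show "f \<in> laur m (xvar T)" using f by blast
  qed
  show "gen_upper_cluster_algebra m n d S \<subseteq> gen_cluster_algebra m n d S"
  proof
    fix f assume "f \<in> gen_upper_cluster_algebra m n d S"
    then have f: "f \<in> laur m (xvar T)" if "reach m d ?I S T" for T using that unfolding U by blast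
    obtain T where T: "reach m d ?I S T" "acyclic_seed n T"
      using assms(5) unfolding acyclic_cluster_algebra_def me by blast
    have "f \<in> calg m d ?I T"
      by (rule upper_subset_calg[OF gsT[OF T(1)] T(2)[unfolded acyclic_seed_def] subset_refl f[OF reach_trans[OF T(1)]]])
    also have "calg m d ?I T \<subseteq> gen_cluster_algebra m n d S"
      unfolding calg_def
    proof (rule hull_minimal)
      show "is_subring (gen_cluster_algebra m n d S)" unfolding gen_cluster_algebra_def by (rule is_subring_hull)
      have "{1..m} - ?I = {n+1..m}" by auto
      moreover have "mspan m (xvar T) (exps {n+1..m}) = mspan m (xvar S) (exps {n+1..m})"
        by (rule mspan_cong) (use frT[OF T(1)] in \<open>auto simp: exps_def\<close>)
      ultimately have "mspan m (xvar T) (exps ({1..m} - ?I)) = ZP m n S"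
        using ZP_eq_mspan[OF nzT[OF reach_refl]] by simp
      moreover have "{xvar U k | U k. reach m d ?I T U \<and> k \<in> ?I} \<subseteq> (\<Union>T\<in>{T. mutation_equivalent m n d S T}. cluster n T)"
        unfolding me cluster_def using reach_trans[OF T(1)] by blast
      ultimately show "mspan m (xvar T) (exps ({1..m} - ?I)) \<union> {xvar U k | U k. reach m d ?I T U \<and> k \<in> ?I} \<subseteq> gen_cluster_algebra m n d S"
        unfolding gen_cluster_algebra_def by (auto intro!: hull_inc)
    qed
    finally show "f \<in> gen_cluster_algebra m n d S" .
  qed
qed

end
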